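(* Let $(N^4,g_4,J,\mathcal{X}^1,\mathcal{X}^2)$ be any scalar-flat toric Kähler 4-manifold with moment functions $\varphi^1,\varphi^2$, and let $\omega^-=d\varphi^1\wedge d\varphi^2+Jd\varphi^1\wedge Jd\varphi^2$. Then $\omega^-\in\bigwedge^-$ and $\omega^-$ is an eigenform of the Weyl tensor: $W^-(\omega^-)=2K_\Sigma\,\omega^-$. More particularly, if $(N^4,g_4,J)$ is a generalized Taub-NUT with chirality number $k\neq 0$ (so that the Ricci form $\rho$ is nowhere zero), then $\rho\in\bigwedge^-$ is an eigenform of the Weyl tensor, $W^-(\rho)=-4K_\Sigma\,\rho$, and $$W^+=0,\qquad W^-=-K_\Sigma\left(6|\rho|^{-2}\rho\otimes\rho-2\,\mathrm{Id}_{\bigwedge^-}\right).$$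
   Context: A toric Kähler 4-manifold $(N^4,g_4,J,\mathcal{X}^1,\mathcal{X}^2)$ is a Kähler manifold of complex dimension 2 with two commuting Killing fields $\mathcal{X}^1,\mathcal{X}^2$ that are also real-holomorphic and symplectomorphic, linearly independent on an open dense set, and with moment functions $\varphi^1,\varphi^2$ satisfying $\mathcal{X}^i=J\nabla\varphi^i$ and $[\nabla\varphi^1,\nabla\varphi^2]=0$. Scalar-flat means zero scalar curvature. Identities involving the $d\varphi^i$ are on the set where $\mathcal{X}^1,\mathcal{X}^2$ are independent. $K_\Sigma$ is the Gaussian curvature of the metric polytope $(\Sigma^2,g_\Sigma)$, the Riemannian quotient of $N^4$ by the $\mathcal{X}^1,\mathcal{X}^2$ action, regarded as an invariant function on $N^4$. $N^4$ has its complex orientation, $\bigwedge^\pm$ are the (anti-)self-dual 2-forms, $W^\pm$ are the corresponding parts of the Weyl tensor. The Weyl tensor and Riemann tensor act on 2-forms by $F(\zeta)_{ij}=\frac12F_{ijkl}\zeta^{lk}$, with the sign convention that $\mathrm{Rm}_{ijji}$ is the sectional curvature in an orthonormal frame. $\rho=\mathrm{Ric}(J\cdot,\cdot)$ is the Ricci form. The norm $|\rho|$ is the 2-form norm (in which $e^1\wedge e^2$ has length 1 for orthonormal $e^1,e^2$), and, as an operator on $\bigwedge^-$, $\rho\otimes\rho$ sends $\zeta$ to $\langle\rho,\zeta\rangle\rho$. Generalized Taub-NUT metrics: for a scale $M>0$ and chirality number $k\in[-1,1]$, $N^4=\mathbb{C}\times\mathbb{C}$ with coordinates $u,v\in[0,\infty)$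 (quadratic normal coordinates) and $\theta_1,\theta_2\in[0,\sqrt8\pi)$ periodic, $\mathcal{X}^i=\partial/\partial\theta_i$, $\varphi^1=\frac{v^2}{\sqrt2M}(1+(1+k)u^2)$, $\varphi^2=\frac{u^2}{\sqrt2M}(1+(1-k)v^2)$, $g_4=g_\Sigma+G^{ij}d\theta_i\otimes d\theta_j$ with $g_\Sigma=\frac2M(1+(1+k)u^2+(1-k)v^2)(du^2+dv^2)$ and $G^{ij}=\langle\nabla\varphi^i,\nabla\varphi^j\rangle_{g_\Sigma}$, and $J$ determined by $J\nabla\varphi^i=\mathcal{X}^i$. These are scalar-flat toric Kähler.
   Formalization: The moment functions are additionally required to be invariant under the action, dφ^i(X^j)=0; without this the claim fails, e.g. on flat C^2 with X^1=∂/∂x_1, X^2=∂/∂y_1, where ω^- is a multiple of dx_1∧dy_1 and not anti-self-dual. *)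

theory Defs
  imports "HOL-Analysis.Analysis"
begin

section \<open>Tensor calculus in coordinates\<close>

definition pd :: "'n::finite \<Rightarrow> (real^'n \<Rightarrow> real) \<Rightarrow> real^'n \<Rightarrow> real" where
  "pd i f x = frechet_derivative f (at x) (axis i 1)"

text \<open>Differentiability classes; only used for open \<open>S\<close>.\<close>

primrec Ck_on :: "nat \<Rightarrow> (real^'n::finite) set \<Rightarrow> (real^'n \<Rightarrow> real) \<Rightarrow> bool" where
  "Ck_on 0 S f \<longleftrightarrow> continuous_on S f"
| "Ck_on (Suc r) S f \<longleftrightarrow> f differentiable_on S \<and> (\<forall>i. Ck_on r S (pd i f))"

definition smooth_on :: "(real^'n::finite) set \<Rightarrow> (real^'n \<Rightarrow> real) \<Rightarrow> bool" where
  "smooth_on S f \<longleftrightarrow> (\<forall>r. Ck_on r S f)"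

definition smooth_vec_on :: "(real^'n::finite) set \<Rightarrow> (real^'n \<Rightarrow> real^'m::finite) \<Rightarrow> bool" where
  "smooth_vec_on S f \<longleftrightarrow> (\<forall>i. smooth_on S (\<lambda>x. f x $ i))"

definition smooth_mat_on ::
  "(real^'n::finite) set \<Rightarrow> (real^'n \<Rightarrow> real^'m::finite^'l::finite) \<Rightarrow> bool" where
  "smooth_mat_on S f \<longleftrightarrow> (\<forall>i j. smooth_on S (\<lambda>x. f x $ i $ j))"

definition bilin :: "real^'n::finite^'n \<Rightarrow> real^'n \<Rightarrow> real^'n \<Rightarrow> real" where
  "bilin A v w = v \<bullet> (A *v w)"

definition riemannian_metric_on ::
  "(real^'n::finite) set \<Rightarrow> (real^'n \<Rightarrow> real^'n^'n) \<Rightarrow> bool" where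
  "riemannian_metric_on S g \<longleftrightarrow> smooth_mat_on S g \<and>
     (\<forall>x\<in>S. transpose (g x) = g x \<and> (\<forall>v. v \<noteq> 0 \<longrightarrow> 0 < bilin (g x) v v))"

definition differential :: "(real^'n::finite \<Rightarrow> real) \<Rightarrow> real^'n \<Rightarrow> real^'n" where
  "differential f x = (\<chi> i. pd i f x)"

definition grad ::
  "(real^'n::finite \<Rightarrow> real^'n^'n) \<Rightarrow> (real^'n \<Rightarrow> real) \<Rightarrow> real^'n \<Rightarrow> real^'n" where
  "grad g f x = matrix_inv (g x) *v differential f x"

definition christoffel ::
  "(real^'n::finite \<Rightarrow> real^'n^'n) \<Rightarrow> 'n \<Rightarrow> 'n \<Rightarrow> 'n \<Rightarrow> real^'n \<Rightarrow> real" where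
  "christoffel g l i j x = (\<Sum>m\<in>UNIV. matrix_inv (g x) $ l $ m *
     (pd i (\<lambda>y. g y $ j $ m) x + pd j (\<lambda>y. g y $ i $ m) x - pd m (\<lambda>y. g y $ i $ j) x)) / 2"

text \<open>
  \<open>curvature_up g i j k l\<close> is the \<open>l\<close>-th component of \<open>R(\<partial>\<^sub>i, \<partial>\<^sub>j) \<partial>\<^sub>k\<close>, where
  \<open>R(X,Y)Z = \<nabla>\<^sub>X \<nabla>\<^sub>Y Z - \<nabla>\<^sub>Y \<nabla>\<^sub>X Z - \<nabla>\<^bsub>[X,Y]\<^esub> Z\<close>, and \<open>riemann g i j k l = \<langle>R(\<partial>\<^sub>i, \<partial>\<^sub>j) \<partial>\<^sub>k, \<partial>\<^sub>l\<rangle>\<close>.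
  Thus \<open>riemann g i j j i\<close> is the sectional curvature in an orthonormal frame.
\<close>

definition curvature_up ::
  "(real^'n::finite \<Rightarrow> real^'n^'n) \<Rightarrow> 'n \<Rightarrow> 'n \<Rightarrow> 'n \<Rightarrow> 'n \<Rightarrow> real^'n \<Rightarrow> real" where
  "curvature_up g i j k l x =
     pd i (christoffel g l j k) x - pd j (christoffel g l i k) x +
     (\<Sum>m\<in>UNIV. christoffel g m j k x * christoffel g l i m x
             - christoffel g m i k x * christoffel g l j m x)"

definition riemann ::
  "(real^'n::finite \<Rightarrow> real^'n^'n) \<Rightarrow> 'n \<Rightarrow> 'n \<Rightarrow> 'n \<Rightarrow> 'n \<Rightarrow> real^'n \<Rightarrow> real" where
  "riemann g i j k l x = (\<Sum>m\<in>UNIV. g x $ l $ m * curvature_up g i j k m x)"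

definition ricci :: "(real^'n::finite \<Rightarrow> real^'n^'n) \<Rightarrow> real^'n \<Rightarrow> real^'n^'n" where
  "ricci g x = (\<chi> j k. \<Sum>i\<in>UNIV. \<Sum>l\<in>UNIV. matrix_inv (g x) $ i $ l * riemann g i j k l x)"

definition scalar_curvature :: "(real^'n::finite \<Rightarrow> real^'n^'n) \<Rightarrow> real^'n \<Rightarrow> real" where
  "scalar_curvature g x = (\<Sum>j\<in>UNIV. \<Sum>k\<in>UNIV. matrix_inv (g x) $ j $ k * ricci g x $ j $ k)"

definition gauss_curvature :: "(real^2 \<Rightarrow> real^2^2) \<Rightarrow> real^2 \<Rightarrow> real" where
  "gauss_curvature h x =
     riemann h 1 2 2 1 x / (h x $ 1 $ 1 * h x $ 2 $ 2 - h x $ 1 $ 2 * h x $ 1 $ 2)"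

text \<open>The Weyl tensor in dimension four (the factors are \<open>1/(n-2)\<close> and \<open>1/((n-1)(n-2))\<close>).\<close>

definition weyl ::
  "(real^4 \<Rightarrow> real^4^4) \<Rightarrow> 4 \<Rightarrow> 4 \<Rightarrow> 4 \<Rightarrow> 4 \<Rightarrow> real^4 \<Rightarrow> real" where
  "weyl g i j k l x = riemann g i j k l x
     - (ricci g x $ i $ l * g x $ j $ k + g x $ i $ l * ricci g x $ j $ k
        - ricci g x $ i $ k * g x $ j $ l - g x $ i $ k * ricci g x $ j $ l) / 2
     + scalar_curvature g x * (g x $ i $ l * g x $ j $ k - g x $ i $ k * g x $ j $ l) / 6"

definition lie_bracket ::
  "(real^'n::finite \<Rightarrow> real^'n) \<Rightarrow> (real^'n \<Rightarrow> real^'n) \<Rightarrow> real^'n \<Rightarrow> real^'n" where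
  "lie_bracket X Y x = (\<chi> k. \<Sum>m\<in>UNIV.
     X x $ m * pd m (\<lambda>y. Y y $ k) x - Y x $ m * pd m (\<lambda>y. X y $ k) x)"

text \<open>Lie derivatives of a covariant 2-tensor and of an endomorphism field
  (rows of the matrix of an endomorphism carry the upper index).\<close>

definition lie_cov2 ::
  "(real^'n::finite \<Rightarrow> real^'n) \<Rightarrow> (real^'n \<Rightarrow> real^'n^'n) \<Rightarrow> real^'n \<Rightarrow> real^'n^'n" where
  "lie_cov2 X T x = (\<chi> i j. \<Sum>m\<in>UNIV. X x $ m * pd m (\<lambda>y. T y $ i $ j) x
     + T x $ m $ j * pd i (\<lambda>y. X y $ m) x + T x $ i $ m * pd j (\<lambda>y. X y $ m) x)"

definition lie_endo ::
  "(real^'n::finite \<Rightarrow> real^'n) \<Rightarrow> (real^'n \<Rightarrow> real^'n^'n) \<Rightarrow> real^'n \<Rightarrow> real^'n^'n" where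
  "lie_endo X A x = (\<chi> i j. \<Sum>m\<in>UNIV. X x $ m * pd m (\<lambda>y. A y $ i $ j) x
     - A x $ m $ j * pd m (\<lambda>y. X y $ i) x + A x $ i $ m * pd j (\<lambda>y. X y $ m) x)"

definition cov_deriv_endo ::
  "(real^'n::finite \<Rightarrow> real^'n^'n) \<Rightarrow> (real^'n \<Rightarrow> real^'n^'n) \<Rightarrow> 'n \<Rightarrow> real^'n \<Rightarrow> real^'n^'n" where
  "cov_deriv_endo g A i x = (\<chi> k j. pd i (\<lambda>y. A y $ k $ j) x + (\<Sum>m\<in>UNIV.
     christoffel g k i m x * A x $ m $ j - christoffel g m i j x * A x $ k $ m))"

definition kahler_on ::
  "(real^'n::finite) set \<Rightarrow> (real^'n \<Rightarrow> real^'n^'n) \<Rightarrow> (real^'n \<Rightarrow> real^'n^'n) \<Rightarrow> bool" where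
  "kahler_on S g J \<longleftrightarrow> riemannian_metric_on S g \<and> smooth_mat_on S J \<and>
     (\<forall>x\<in>S. J x ** J x = - mat 1 \<and> transpose (J x) ** g x ** J x = g x \<and>
       (\<forall>i. cov_deriv_endo g J i x = 0))"

text \<open>The forms \<open>\<omega> = g(J\<cdot>,\<cdot>)\<close> and \<open>\<rho> = Ric(J\<cdot>,\<cdot>)\<close>.\<close>

definition kahler_form ::
  "(real^'n::finite \<Rightarrow> real^'n^'n) \<Rightarrow> (real^'n \<Rightarrow> real^'n^'n) \<Rightarrow> real^'n \<Rightarrow> real^'n^'n" where
  "kahler_form g J x = transpose (J x) ** g x"

definition ricci_form ::
  "(real^'n::finite \<Rightarrow> real^'n^'n) \<Rightarrow> (real^'n \<Rightarrow> real^'n^'n) \<Rightarrow> real^'n \<Rightarrow> real^'n^'n" where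
  "ricci_form g J x = transpose (J x) ** ricci g x"


section \<open>Two-forms at a point of a four-manifold\<close>

text \<open>Two-forms are antisymmetric matrices; \<open>G\<close> and \<open>J\<close> are the metric and the complex structure
  at the point.\<close>

definition two_form :: "real^4^4 \<Rightarrow> bool" where
  "two_form \<zeta> \<longleftrightarrow> transpose \<zeta> = - \<zeta>"

definition wedge :: "real^4 \<Rightarrow> real^4 \<Rightarrow> real^4^4" where
  "wedge \<alpha> \<beta> = (\<chi> i j. \<alpha> $ i * \<beta> $ j - \<alpha> $ j * \<beta> $ i)"

definition raise2 :: "real^4^4 \<Rightarrow> real^4^4 \<Rightarrow> real^4^4" where
  "raise2 G \<zeta> = matrix_inv G ** \<zeta> ** matrix_inv G"

definition form_inner :: "real^4^4 \<Rightarrow> real^4^4 \<Rightarrow> real^4^4 \<Rightarrow> real" where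
  "form_inner G \<alpha> \<beta> = (\<Sum>i\<in>UNIV. \<Sum>j\<in>UNIV. \<alpha> $ i $ j * raise2 G \<beta> $ i $ j) / 2"

definition form_norm :: "real^4^4 \<Rightarrow> real^4^4 \<Rightarrow> real" where
  "form_norm G \<alpha> = sqrt (form_inner G \<alpha> \<alpha>)"

text \<open>The Riemannian volume form of the complex orientation is \<open>\<omega> \<and> \<omega> / 2\<close> (Wirtinger):
  it equals 1 on every orthonormal frame of the form \<open>v, J v, w, J w\<close>.\<close>

definition complex_volume ::
  "real^4^4 \<Rightarrow> real^4^4 \<Rightarrow> 4 \<Rightarrow> 4 \<Rightarrow> 4 \<Rightarrow> 4 \<Rightarrow> real" where
  "complex_volume G J i j k l = (let \<omega> = transpose J ** G in
     \<omega> $ i $ j * \<omega> $ k $ l - \<omega> $ i $ k * \<omega> $ j $ l + \<omega> $ i $ l * \<omega> $ j $ k)"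

definition hodge_star :: "real^4^4 \<Rightarrow> real^4^4 \<Rightarrow> real^4^4 \<Rightarrow> real^4^4" where
  "hodge_star G J \<zeta> = (\<chi> i j. (\<Sum>k\<in>UNIV. \<Sum>l\<in>UNIV.
     complex_volume G J i j k l * raise2 G \<zeta> $ k $ l) / 2)"

definition self_dual :: "real^4^4 \<Rightarrow> real^4^4 \<Rightarrow> (real^4^4) set" where
  "self_dual G J = {\<zeta>. two_form \<zeta> \<and> hodge_star G J \<zeta> = \<zeta>}"

definition anti_self_dual :: "real^4^4 \<Rightarrow> real^4^4 \<Rightarrow> (real^4^4) set" where
  "anti_self_dual G J = {\<zeta>. two_form \<zeta> \<and> hodge_star G J \<zeta> = - \<zeta>}"

definition sd_part :: "real^4^4 \<Rightarrow> real^4^4 \<Rightarrow> real^4^4 \<Rightarrow> real^4^4" where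
  "sd_part G J \<zeta> = (1/2) *\<^sub>R (\<zeta> + hodge_star G J \<zeta>)"

definition asd_part :: "real^4^4 \<Rightarrow> real^4^4 \<Rightarrow> real^4^4 \<Rightarrow> real^4^4" where
  "asd_part G J \<zeta> = (1/2) *\<^sub>R (\<zeta> - hodge_star G J \<zeta>)"

text \<open>\<open>F(\<zeta>)\<^bsub>ij\<^esub> = (1/2) F\<^bsub>ijkl\<^esub> \<zeta>\<^bsup>lk\<^esup>\<close>; note the order of the last two indices.\<close>

definition tensor_act ::
  "real^4^4 \<Rightarrow> (4 \<Rightarrow> 4 \<Rightarrow> 4 \<Rightarrow> 4 \<Rightarrow> real) \<Rightarrow> real^4^4 \<Rightarrow> real^4^4" where
  "tensor_act G F \<zeta> = (\<chi> i j. (\<Sum>k\<in>UNIV. \<Sum>l\<in>UNIV. F i j k l * raise2 G \<zeta> $ l $ k) / 2)"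

definition weyl_op :: "(real^4 \<Rightarrow> real^4^4) \<Rightarrow> real^4 \<Rightarrow> real^4^4 \<Rightarrow> real^4^4" where
  "weyl_op g x \<zeta> = tensor_act (g x) (\<lambda>i j k l. weyl g i j k l x) \<zeta>"

definition weyl_plus ::
  "(real^4 \<Rightarrow> real^4^4) \<Rightarrow> (real^4 \<Rightarrow> real^4^4) \<Rightarrow> real^4 \<Rightarrow> real^4^4 \<Rightarrow> real^4^4" where
  "weyl_plus g J x \<zeta> = sd_part (g x) (J x) (weyl_op g x (sd_part (g x) (J x) \<zeta>))"

definition weyl_minus ::
  "(real^4 \<Rightarrow> real^4^4) \<Rightarrow> (real^4 \<Rightarrow> real^4^4) \<Rightarrow> real^4 \<Rightarrow> real^4^4 \<Rightarrow> real^4^4" where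
  "weyl_minus g J x \<zeta> = asd_part (g x) (J x) (weyl_op g x (asd_part (g x) (J x) \<zeta>))"


section \<open>Toric Kaehler four-manifolds\<close>

type_synonym 'a chart = "'a set \<times> ('a \<Rightarrow> real^4)"

definition chart_image :: "'a chart \<Rightarrow> (real^4) set" where
  "chart_image c = snd c ` fst c"

definition chart_inv :: "'a chart \<Rightarrow> real^4 \<Rightarrow> 'a" where
  "chart_inv c = inv_into (fst c) (snd c)"

definition is_chart :: "'a::topological_space chart \<Rightarrow> bool" where
  "is_chart c \<longleftrightarrow> open (fst c) \<and> open (chart_image c) \<and>
     homeomorphism (fst c) (chart_image c) (snd c) (chart_inv c)"

definition smooth_atlas :: "'a::topological_space chart set \<Rightarrow> bool" where
  "smooth_atlas A \<longleftrightarrow> (\<forall>c\<in>A. is_chart c) \<and> (\<Union>c\<in>A. fst c) = UNIV \<and>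
     (\<forall>c\<in>A. \<forall>d\<in>A. smooth_vec_on (snd c ` (fst c \<inter> fst d)) (snd d \<circ> chart_inv c))"

text \<open>
  The manifold is the whole type \<open>'a\<close> with a smooth atlas.  A tensor field is given by its
  components in every chart of the atlas, as functions on the chart image (values outside the
  chart image are irrelevant); the components in different charts are related by the tensor
  transformation law, see \<open>tensorial\<close>.
\<close>

record 'a toric_data =
  atlas :: "'a chart set"
  metric_in :: "'a chart \<Rightarrow> real^4 \<Rightarrow> real^4^4"
  cplx_in :: "'a chart \<Rightarrow> real^4 \<Rightarrow> real^4^4"
  killing_in :: "2 \<Rightarrow> 'a chart \<Rightarrow> real^4 \<Rightarrow> real^4"
  moment :: "2 \<Rightarrow> 'a \<Rightarrow> real"

definition moment_in :: "'a toric_data \<Rightarrow> 2 \<Rightarrow> 'a chart \<Rightarrow> real^4 \<Rightarrow> real" where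
  "moment_in N i c = moment N i \<circ> chart_inv c"

definition tensorial :: "'a toric_data \<Rightarrow> bool" where
  "tensorial N \<longleftrightarrow> (\<forall>c\<in>atlas N. \<forall>d\<in>atlas N. \<forall>p\<in>fst c \<inter> fst d.
     let x = snd c p; y = snd d p; D = jacobian (snd d \<circ> chart_inv c) (at x) in
       metric_in N c x = transpose D ** metric_in N d y ** D \<and>
       D ** cplx_in N c x = cplx_in N d y ** D \<and>
       (\<forall>i. killing_in N i d y = D *v killing_in N i c x))"

text \<open>The set on which the two Killing fields are linearly independent.\<close>

definition regular :: "'a toric_data \<Rightarrow> 'a set" where
  "regular N = {p. \<forall>c\<in>atlas N. p \<in> fst c \<longrightarrow>
     (\<forall>a b. a *\<^sub>R killing_in N 1 c (snd c p) + b *\<^sub>R killing_in N 2 c (snd c p) = 0 \<longrightarrow> a = 0 \<and> b = 0)}"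

text \<open>
  The last condition says that the moment functions are invariant under the action, which is part
  of the notion of a moment map of an abelian action.  It does not follow from the other
  conditions: two orthogonal constant fields spanning a complex line of flat \<open>\<complex>\<^sup>2\<close> satisfy these.
\<close>

definition toric_kahler :: "'a::{t2_space,second_countable_topology} toric_data \<Rightarrow> bool" where
  "toric_kahler N \<longleftrightarrow> smooth_atlas (atlas N) \<and> tensorial N \<and>
     open (regular N) \<and> closure (regular N) = UNIV \<and>
     (\<forall>c\<in>atlas N. kahler_on (chart_image c) (metric_in N c) (cplx_in N c) \<and>
       (\<forall>i. smooth_vec_on (chart_image c) (killing_in N i c) \<and>
            smooth_on (chart_image c) (moment_in N i c)) \<and>
       (\<forall>x\<in>chart_image c.
         (\<forall>i. lie_cov2 (killing_in N i c) (metric_in N c) x = 0 \<and>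
              lie_endo (killing_in N i c) (cplx_in N c) x = 0 \<and>
              lie_cov2 (killing_in N i c) (kahler_form (metric_in N c) (cplx_in N c)) x = 0 \<and>
              killing_in N i c x = cplx_in N c x *v grad (metric_in N c) (moment_in N i c) x) \<and>
         lie_bracket (killing_in N 1 c) (killing_in N 2 c) x = 0 \<and>
         lie_bracket (grad (metric_in N c) (moment_in N 1 c))
                     (grad (metric_in N c) (moment_in N 2 c)) x = 0 \<and>
         (\<forall>i j. differential (moment_in N i c) x \<bullet> killing_in N j c x = 0)))"

definition scalar_flat :: "'a toric_data \<Rightarrow> bool" where
  "scalar_flat N \<longleftrightarrow> (\<forall>c\<in>atlas N. \<forall>x\<in>chart_image c. scalar_curvature (metric_in N c) x = 0)"

text \<open>
  A local coordinate description of the Riemannian quotient: \<open>\<pi>\<close> maps the open set \<open>V\<close> onto an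
  open subset of the plane, \<open>h\<close> is a metric there, and \<open>\<pi>\<close> is a Riemannian submersion whose
  vertical spaces are spanned by the two Killing fields (the isometry condition makes the
  differential of \<open>\<pi>\<close> injective on the two-dimensional horizontal spaces, hence surjective).
\<close>

definition local_quotient ::
  "'a::topological_space toric_data \<Rightarrow> 'a set \<Rightarrow> ('a \<Rightarrow> real^2) \<Rightarrow> (real^2 \<Rightarrow> real^2^2) \<Rightarrow> bool" where
  "local_quotient N V \<pi> h \<longleftrightarrow> open V \<and> V \<subseteq> regular N \<and> open (\<pi> ` V) \<and>
     riemannian_metric_on (\<pi> ` V) h \<and>
     (\<forall>c\<in>atlas N. smooth_vec_on (snd c ` (fst c \<inter> V)) (\<pi> \<circ> chart_inv c) \<and>
       (\<forall>q\<in>fst c \<inter> V. let x = snd c q; D = jacobian (\<pi> \<circ> chart_inv c) (at x) in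
          (\<forall>i. D *v killing_in N i c x = 0) \<and>
          (\<forall>v. (\<forall>i. bilin (metric_in N c x) v (killing_in N i c x) = 0) \<longrightarrow>
             bilin (h (\<pi> q)) (D *v v) (D *v v) = bilin (metric_in N c x) v v)))"

text \<open>
  \<open>K\<close> is the Gaussian curvature of the quotient, as a function on \<open>N\<close>.  Only its values on
  \<open>regular N\<close> are constrained; at the remaining points, which lie over the boundary of the
  polytope, the curvature is the continuous extension of these values.
\<close>

definition is_quotient_curvature :: "'a::topological_space toric_data \<Rightarrow> ('a \<Rightarrow> real) \<Rightarrow> bool" where
  "is_quotient_curvature N K \<longleftrightarrow> (\<forall>p\<in>regular N. \<exists>V \<pi> h. local_quotient N V \<pi> h \<and> p \<in> V \<and>
     K p = gauss_curvature h (\<pi> p))"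

text \<open>The action of \<open>J\<close> on one-forms is taken as \<open>\<alpha> \<mapsto> \<alpha> \<circ> J\<close>; the opposite sign
  convention gives the same form.\<close>

definition omega_minus :: "'a toric_data \<Rightarrow> 'a chart \<Rightarrow> real^4 \<Rightarrow> real^4^4" where
  "omega_minus N c x =
     (let d1 = differential (moment_in N 1 c) x; d2 = differential (moment_in N 2 c) x;
          Jt = transpose (cplx_in N c x)
      in wedge d1 d2 + wedge (Jt *v d1) (Jt *v d2))"


section \<open>Generalized Taub-NUT metrics\<close>

text \<open>In the plane the coordinates are \<open>u = w$1\<close>, \<open>v = w$2\<close>.\<close>

definition gtn_sigma :: "real \<Rightarrow> real \<Rightarrow> real^2 \<Rightarrow> real^2^2" where
  "gtn_sigma M k w = mat (2 / M * (1 + (1 + k) * (w$1)\<^sup>2 + (1 - k) * (w$2)\<^sup>2))"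

definition gtn_moment :: "real \<Rightarrow> real \<Rightarrow> 2 \<Rightarrow> real^2 \<Rightarrow> real" where
  "gtn_moment M k i w =
     (if i = 1 then (w$2)\<^sup>2 / (sqrt 2 * M) * (1 + (1 + k) * (w$1)\<^sup>2)
      else (w$1)\<^sup>2 / (sqrt 2 * M) * (1 + (1 - k) * (w$2)\<^sup>2))"

definition gtn_G :: "real \<Rightarrow> real \<Rightarrow> real^2 \<Rightarrow> real^2^2" where
  "gtn_G M k w = (\<chi> i j. bilin (gtn_sigma M k w)
     (grad (gtn_sigma M k) (gtn_moment M k i) w) (grad (gtn_sigma M k) (gtn_moment M k j) w))"

text \<open>
  The coordinates \<open>u, v, \<theta>\<^sub>1, \<theta>\<^sub>2\<close> are \<open>y$1, y$2, y$3, y$4\<close>.  The field \<open>\<partial>/\<partial>\<theta>\<^sub>1\<close> has length tending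
  to zero as \<open>v\<close> does, so \<open>\<theta>\<^sub>1\<close> is the angle of the factor with radius \<open>v\<close>; likewise \<open>\<theta>\<^sub>2\<close> and \<open>u\<close>.
  The period \<open>sqrt 8 * pi\<close> of the \<open>\<theta>\<^sub>i\<close> corresponds to a full turn.
\<close>

definition gtn_polar :: "real^4 \<Rightarrow> complex \<times> complex" where
  "gtn_polar y = (complex_of_real (y$1) * cis (y$4 / sqrt 2),
                  complex_of_real (y$2) * cis (y$3 / sqrt 2))"

definition c2_coords :: "complex \<times> complex \<Rightarrow> real^4" where
  "c2_coords z = vector [Re (fst z), Im (fst z), Re (snd z), Im (snd z)]"

definition uv_part :: "real^4 \<Rightarrow> real^2" where
  "uv_part y = vector [y$1, y$2]"

definition theta_part :: "real^4 \<Rightarrow> real^2" where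
  "theta_part y = vector [y$3, y$4]"

text \<open>
  The map \<open>z\<close> identifies \<open>N\<close> diffeomorphically with \<open>\<complex> \<times> \<complex>\<close>.  The metric, the fields and the
  moment functions are prescribed where \<open>u, v > 0\<close>, hence everywhere by continuity; the complex
  structure is then determined by \<open>J \<nabla>\<phi>\<^sup>i = X\<^sup>i\<close>, which is part of \<open>toric_kahler\<close>.
\<close>

definition generalized_taub_nut ::
  "real \<Rightarrow> real \<Rightarrow> 'a::{t2_space,second_countable_topology} toric_data \<Rightarrow> bool" where
  "generalized_taub_nut M k N \<longleftrightarrow> toric_kahler N \<and>
     (\<exists>z :: 'a \<Rightarrow> complex \<times> complex. bij z \<and>
        smooth_atlas (insert (UNIV, c2_coords \<circ> z) (atlas N)) \<and>
        (\<forall>y. 0 < y$1 \<and> 0 < y$2 \<longrightarrow>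
          (let p = inv z (gtn_polar y) in
            (\<forall>i. moment N i p = gtn_moment M k i (uv_part y)) \<and>
            (\<forall>c\<in>atlas N. p \<in> fst c \<longrightarrow>
              (let D = jacobian (snd c \<circ> inv z \<circ> gtn_polar) (at y) in
                killing_in N 1 c (snd c p) = D *v axis 3 1 \<and>
                killing_in N 2 c (snd c p) = D *v axis 4 1 \<and>
                (\<forall>a b. bilin (metric_in N c (snd c p)) (D *v a) (D *v b) =
                   bilin (gtn_sigma M k (uv_part y)) (uv_part a) (uv_part b) +
                   bilin (gtn_G M k (uv_part y)) (theta_part a) (theta_part b)))))))"

end

(*
  On the regular set the Killing fields X_i = J grad phi_i span the orthogonal complement of the
  horizontal planes spanned by the grad phi_i.  Because [grad phi_1, grad phi_2] = 0 and the X_i are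
  Killing, the second fundamental form of the horizontal distribution vanishes; hence for gradients
  E_a of functions pulled back from the quotient, nabla_{E_a} E_b is again a combination of the E_d
  with coefficients pulled back from the quotient, and R(E_a, E_b) E_c is given by the curvature of
  the quotient.  With J parallel this determines R(E_1, E_2) completely, so omega^- is an eigenform
  of Rm with eigenvalue 2 K, and for scalar-flat metrics W^- is the restriction of Rm to the
  anti-self-dual forms.

  Since [X_i, E_a] = 0, the remaining curvature components R(E_a, X_i) E_b are J applied to third
  covariant derivatives of phi_i, which are computed on the quotient.  For the generalized Taub-NUT
  metrics this gives the eigenvalues 2 K, 2 K, - 4 K of W^- and |rho|^2 = 8 k^2 M^2 / L^4 with
  L = 1 + (1 + k) u^2 + (1 - k) v^2, first where u, v > 0 and then everywhere by continuity.
*)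
theory Submission
  imports Defs
begin

section \<open>Smooth functions on open sets\<close>

text \<open>The quotient is given only through local submersions, so \<open>N\<close> and the
  polytope are compared by means of the gradients \<open>E a\<close> of pulled-back base
  coordinates. Their Gram matrix is the inverse of the base metric, and the Koszul formula for
  gradients contains nothing but the Gram matrix and its derivatives: the same coefficient functions
  therefore describe connection and curvature upstairs and downstairs. In a frame
  \<open>e 1, e 2, J e 1, J e 2\<close> with \<open>e 1, e 2\<close> horizontal, W^- is a trace-free
  3 by 3 matrix, and horizontality splits off the form \<open>e1 e2 + e3 e4\<close>. For the
  Taub-NUT metrics the Gaussian curvature is not computed from the conformal factor; scalar-flatness
  expresses it through the mixed components. The 6 in the rank-one term is the gap between the
  eigenvalues 2K and -4K, divided by K. On the axes the Killing fields become dependent and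
  \<open>is_quotient_curvature\<close> says nothing about \<open>K\<close>. Hence statements about
  \<rho> and W^+ hold at every point, whereas formulas containing \<open>K\<close> pass to an axis
  only if \<open>K\<close> is continuous there.\<close>

lemma has_derivative_pd:
  assumes "(f has_derivative f') (at x)"
  shows "pd i f x = f' (axis i 1)"
  using assms by (simp add: pd_def frechet_derivative_at[OF assms, symmetric])

lemma has_derivative_cong_open:
  assumes "open S" "x \<in> S" "\<And>y. y \<in> S \<Longrightarrow> f y = g y"
  shows "(f has_derivative h) (at x) \<longleftrightarrow> (g has_derivative h) (at x)"
  using has_derivative_transform_within_open[of f h x UNIV S g]
    has_derivative_transform_within_open[of g h x UNIV S f] assms by auto

lemma pd_cong:
  assumes "open S" "x \<in> S" "\<And>y. y \<in> S \<Longrightarrow> f y = g y"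
  shows "pd i f x = pd i g x"
  using has_derivative_cong_open[OF assms] by (simp add: pd_def frechet_derivative_def)

lemma pd_const [simp]: "pd i (\<lambda>x. c) x = 0"
  by (simp add: pd_def)

lemma pd_add:
  assumes "f differentiable at x" "g differentiable at x"
  shows "pd i (\<lambda>x. f x + g x) x = pd i f x + pd i g x"
  using assms by (subst has_derivative_pd[OF has_derivative_add])
    (auto simp: frechet_derivative_works pd_def)

lemma pd_mult:
  assumes "f differentiable at x" "g differentiable at x"
  shows "pd i (\<lambda>x. f x * g x) x = pd i f x * g x + f x * pd i g x"
  using assms by (subst has_derivative_pd[OF has_derivative_mult])
    (auto simp: frechet_derivative_works pd_def)

lemma pd_cmult:
  assumes "f differentiable at x"
  shows "pd i (\<lambda>x. c * f x) x = c * pd i f x"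
  using pd_mult[of "\<lambda>_. c" x f i] assms by simp

lemma pd_sum:
  assumes "\<And>a. a \<in> A \<Longrightarrow> f a differentiable at x"
  shows "pd i (\<lambda>x. \<Sum>a\<in>A. f a x) x = (\<Sum>a\<in>A. pd i (f a) x)"
  using assms by (subst has_derivative_pd[OF has_derivative_sum])
    (auto simp: frechet_derivative_works pd_def)

lemma pd_real_compose:
  assumes "f differentiable at x" "(h has_real_derivative h') (at (f x))"
  shows "pd i (\<lambda>x. h (f x)) x = h' * pd i f x"
proof -
  have "(f has_derivative frechet_derivative f (at x)) (at x)"
    using assms frechet_derivative_works by blast
  from has_derivative_pd[OF diff_chain_at[OF this assms(2)[unfolded has_field_derivative_def]], of i]
  show ?thesis by (simp add: o_def pd_def)
qed

lemma frechet_eq_sum_pd: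
  fixes f :: "real^'n::finite \<Rightarrow> real"
  assumes "f differentiable at x"
  shows "frechet_derivative f (at x) v = (\<Sum>i\<in>UNIV. v $ i * pd i f x)"
proof -
  have l: "linear (frechet_derivative f (at x))"
    using assms frechet_derivative_works has_derivative_linear by blast
  have "v = (\<Sum>i\<in>UNIV. v $ i *\<^sub>R axis i 1)"
    by (simp add: vec_eq_iff axis_def if_distrib cong: if_cong)
  then have "frechet_derivative f (at x) v = frechet_derivative f (at x) (\<Sum>i\<in>UNIV. v $ i *\<^sub>R axis i 1)"
    by simp
  also have "\<dots> = (\<Sum>i\<in>UNIV. v $ i * pd i f x)"
    by (simp add: linear_sum[OF l] linear_cmul[OF l] pd_def)
  finally show ?thesis .
qed

lemma has_derivative_vec_nth_differentiable:
  fixes F :: "'a::real_normed_vector \<Rightarrow> real^'m::finite"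
  assumes "\<And>a. (\<lambda>x. F x $ a) differentiable at x"
  shows "(F has_derivative (\<lambda>v. \<chi> a. frechet_derivative (\<lambda>x. F x $ a) (at x) v)) (at x)"
proof -
  have "((\<lambda>x. F x $ a) has_derivative frechet_derivative (\<lambda>x. F x $ a) (at x)) (at x)" for a
    using assms frechet_derivative_works by blast
  then show ?thesis
    by (subst has_derivative_componentwise_within) (auto simp: Basis_vec_def inner_axis)
qed

lemma pd_compose:
  fixes F :: "real^'n::finite \<Rightarrow> real^'m::finite"
  assumes "f differentiable at (F x)" "\<And>a. (\<lambda>x. F x $ a) differentiable at x"
  shows "pd i (\<lambda>x. f (F x)) x = (\<Sum>a\<in>UNIV. pd a f (F x) * pd i (\<lambda>x. F x $ a) x)" (is ?P1)
    and "(\<lambda>x. f (F x)) differentiable at x"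
proof -
  have 1: "(f has_derivative frechet_derivative f (at (F x))) (at (F x))"
    using assms frechet_derivative_works by blast
  from diff_chain_at[OF has_derivative_vec_nth_differentiable[OF assms(2)] 1]
  have *: "((\<lambda>x. f (F x)) has_derivative frechet_derivative f (at (F x)) \<circ>
     (\<lambda>v. \<chi> a. frechet_derivative (\<lambda>x. F x $ a) (at x) v)) (at x)"
    by (simp add: o_def)
  then show "(\<lambda>x. f (F x)) differentiable at x"
    by (auto simp: differentiable_def)
  show ?P1
    unfolding has_derivative_pd[OF *] o_def frechet_eq_sum_pd[OF assms(1)]
    by (simp add: pd_def mult.commute)
qed

lemma pd_vec_nth [simp]: "pd i (\<lambda>w::real^'n::finite. w $ j) x = (if i = j then 1 else 0)"
proof -
  have "((\<lambda>w::real^'n. w $ j) has_derivative (\<lambda>w. w $ j)) (at x)"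
    by (rule bounded_linear_imp_has_derivative[OF bounded_linear_vec_nth])
  then show ?thesis by (simp add: has_derivative_pd axis_def)
qed

lemma Ck_on_cong:
  assumes "open S" "\<And>x. x \<in> S \<Longrightarrow> f x = g x"
  shows "Ck_on r S f \<longleftrightarrow> Ck_on r S g"
  using assms(2)
proof (induction r arbitrary: f g)
  case 0
  then show ?case by (auto cong: continuous_on_cong)
next
  case (Suc r)
  have "Ck_on r S (pd i f) \<longleftrightarrow> Ck_on r S (pd i g)" for i
    by (rule Suc.IH) (use Suc.prems assms(1) in \<open>auto intro: pd_cong\<close>)
  moreover have "f differentiable_on S \<longleftrightarrow> g differentiable_on S"
    using has_derivative_cong_open[OF assms(1) _ Suc.prems]
    by (simp add: differentiable_on_eq_differentiable_at[OF assms(1)] differentiable_def)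
  ultimately show ?case by simp
qed

lemma Ck_on_Suc_imp: "Ck_on (Suc r) S f \<Longrightarrow> Ck_on r S f"
  by (induction r arbitrary: f) (auto simp: differentiable_imp_continuous_on)

lemma Ck_on_subset: "Ck_on r S f \<Longrightarrow> T \<subseteq> S \<Longrightarrow> Ck_on r T f"
  by (induction r arbitrary: f) (auto intro: continuous_on_subset differentiable_on_subset)

lemma Ck_on_const: "Ck_on r S (\<lambda>x. c)"
proof (induction r arbitrary: c)
  case (Suc r)
  have "pd i (\<lambda>x. c) = (\<lambda>x. 0)" for i :: 'a by (rule ext) simp
  with Suc show ?case by simp
qed simp

lemma Ck_on_add:
  assumes "open S" "Ck_on r S f" "Ck_on r S g"
  shows "Ck_on r S (\<lambda>x. f x + g x)"
  using assms(2,3)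
proof (induction r arbitrary: f g)
  case 0
  then show ?case by (auto intro: continuous_intros)
next
  case (Suc r)
  have "Ck_on r S (pd i (\<lambda>x. f x + g x)) \<longleftrightarrow> Ck_on r S (\<lambda>x. pd i f x + pd i g x)" for i
    by (rule Ck_on_cong[OF \<open>open S\<close>], rule pd_add)
      (use Suc.prems assms(1) in \<open>auto simp: differentiable_on_eq_differentiable_at\<close>)
  with Suc show ?case by (auto intro: differentiable_on_add)
qed

lemma Ck_on_mult:
  assumes "open S" "Ck_on r S f" "Ck_on r S g"
  shows "Ck_on r S (\<lambda>x. f x * g x)"
  using assms(2,3)
proof (induction r arbitrary: f g)
  case 0
  then show ?case by (auto intro: continuous_intros)
next
  case (Suc r)
  have "Ck_on r S (pd i (\<lambda>x. f x * g x)) \<longleftrightarrow> Ck_on r S (\<lambda>x. pd i f x * g x + f x * pd i g x)" for i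
    by (rule Ck_on_cong[OF \<open>open S\<close>], rule pd_mult)
      (use Suc.prems assms(1) in \<open>auto simp: differentiable_on_eq_differentiable_at\<close>)
  moreover have "Ck_on r S (\<lambda>x. pd i f x * g x + f x * pd i g x)" for i
    by (intro Ck_on_add[OF assms(1)] Suc.IH Suc.prems[THEN Ck_on_Suc_imp]) (use Suc.prems in auto)
  ultimately show ?case using Suc.prems by (auto intro: differentiable_on_mult)
qed

text \<open>A bootstrap for functions \<open>h\<close> whose derivative is a polynomial in
  \<open>h\<close> itself: if \<open>h (f x)\<close> is of class C^r then so is
  \<open>h' (f x)\<close>, hence so are the partial derivatives of \<open>h (f x)\<close>, which
  gains one order. Inverse and inverse square root are of this kind.\<close>

lemma smooth_on_real_compose:
  assumes "open S" "smooth_on S f"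
    and h': "\<And>x. x \<in> S \<Longrightarrow> (h has_real_derivative h' (f x)) (at (f x))"
    and step: "\<And>r. Ck_on r S (\<lambda>x. h (f x)) \<Longrightarrow> Ck_on r S (\<lambda>x. h' (f x))"
  shows "smooth_on S (\<lambda>x. h (f x))"
proof -
  have d: "f differentiable at x" if "x \<in> S" for x
    using assms(1,2) that
    by (metis Ck_on.simps(2) differentiable_on_eq_differentiable_at smooth_on_def)
  have dh: "(\<lambda>x. h (f x)) differentiable at x" if "x \<in> S" for x
    using differentiable_chain_at[OF d[OF that], of h] h'[OF that]
    by (auto simp: o_def real_differentiable_def)
  have "Ck_on r S (\<lambda>x. h (f x))" for r
  proof (induction r)
    case 0
    show ?case
      using dh by (auto intro!: continuous_at_imp_continuous_on differentiable_imp_continuous_within)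
  next
    case (Suc r)
    have "Ck_on r S (pd i (\<lambda>x. h (f x))) \<longleftrightarrow> Ck_on r S (\<lambda>x. h' (f x) * pd i f x)" for i
      by (rule Ck_on_cong[OF \<open>open S\<close>], rule pd_real_compose[OF d h'])
    moreover have "Ck_on r S (\<lambda>x. h' (f x) * pd i f x)" for i
      using assms(2) by (intro Ck_on_mult[OF assms(1)] step Suc) (metis Ck_on.simps(2) smooth_on_def)
    ultimately show ?case
      using dh assms(1) by (simp add: differentiable_on_eq_differentiable_at)
  qed
  then show ?thesis by (simp add: smooth_on_def)
qed

lemma smooth_on_cong:
  "open S \<Longrightarrow> (\<And>x. x \<in> S \<Longrightarrow> f x = g x) \<Longrightarrow> smooth_on S f \<longleftrightarrow> smooth_on S g"
  by (auto simp: smooth_on_def Ck_on_cong[of S f g])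

lemma smooth_on_subset: "smooth_on S f \<Longrightarrow> T \<subseteq> S \<Longrightarrow> smooth_on T f"
  by (auto simp: smooth_on_def intro: Ck_on_subset)

lemma smooth_on_pd: "smooth_on S f \<Longrightarrow> smooth_on S (pd i f)"
  by (metis Ck_on.simps(2) smooth_on_def)

lemma smooth_on_imp_differentiable: "smooth_on S f \<Longrightarrow> open S \<Longrightarrow> x \<in> S \<Longrightarrow> f differentiable at x"
  by (metis Ck_on.simps(2) differentiable_on_eq_differentiable_at smooth_on_def)

lemma smooth_on_imp_continuous_on: "smooth_on S f \<Longrightarrow> continuous_on S f"
  by (metis Ck_on.simps(1) smooth_on_def)

lemma smooth_on_const: "smooth_on S (\<lambda>x. c)"
  by (simp add: smooth_on_def Ck_on_const)

lemma smooth_on_add: "open S \<Longrightarrow> smooth_on S f \<Longrightarrow> smooth_on S g \<Longrightarrow> smooth_on S (\<lambda>x. f x + g x)"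
  by (simp add: smooth_on_def Ck_on_add)

lemma smooth_on_mult: "open S \<Longrightarrow> smooth_on S f \<Longrightarrow> smooth_on S g \<Longrightarrow> smooth_on S (\<lambda>x. f x * g x)"
  by (simp add: smooth_on_def Ck_on_mult)

lemma smooth_on_uminus: "open S \<Longrightarrow> smooth_on S f \<Longrightarrow> smooth_on S (\<lambda>x. - f x)"
  using smooth_on_mult[OF _ smooth_on_const[of S "-1"], of f] by simp

lemma smooth_on_diff: "open S \<Longrightarrow> smooth_on S f \<Longrightarrow> smooth_on S g \<Longrightarrow> smooth_on S (\<lambda>x. f x - g x)"
  using smooth_on_add[OF _ _ smooth_on_uminus, of S f g] by simp

lemma smooth_on_sum:
  "open S \<Longrightarrow> (\<And>a. a \<in> A \<Longrightarrow> smooth_on S (f a)) \<Longrightarrow> smooth_on S (\<lambda>x. \<Sum>a\<in>A. f a x)"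
  by (induction A rule: infinite_finite_induct) (auto intro: smooth_on_const smooth_on_add)

lemma smooth_on_prod:
  "open S \<Longrightarrow> (\<And>a. a \<in> A \<Longrightarrow> smooth_on S (f a)) \<Longrightarrow> smooth_on S (\<lambda>x. \<Prod>a\<in>A. f a x)"
  by (induction A rule: infinite_finite_induct) (auto intro: smooth_on_const smooth_on_mult)

lemma smooth_on_inverse:
  assumes "open S" "smooth_on S f" "\<And>x. x \<in> S \<Longrightarrow> f x \<noteq> 0"
  shows "smooth_on S (\<lambda>x. inverse (f x))"
proof (rule smooth_on_real_compose[where h = inverse and h' = "\<lambda>y. - (inverse y * inverse y)"])
  show "(inverse has_real_derivative - (inverse (f x) * inverse (f x))) (at (f x))" if "x \<in> S" for x
    using DERIV_inverse[of "f x" UNIV] assms(3)[OF that] by (simp add: power2_eq_square)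
  show "Ck_on r S (\<lambda>x. - (inverse (f x) * inverse (f x)))" if "Ck_on r S (\<lambda>x. inverse (f x))" for r
    using Ck_on_mult[OF assms(1) Ck_on_const[of r S "-1"] Ck_on_mult[OF assms(1) that that]] by simp
qed fact+

lemma smooth_on_divide:
  "open S \<Longrightarrow> smooth_on S f \<Longrightarrow> smooth_on S g \<Longrightarrow> (\<And>x. x \<in> S \<Longrightarrow> g x \<noteq> 0)
    \<Longrightarrow> smooth_on S (\<lambda>x. f x / g x)"
  using smooth_on_mult[OF _ _ smooth_on_inverse, of S f g] by (simp add: divide_inverse)

lemma smooth_on_sqrt:
  assumes "open S" "smooth_on S f" "\<And>x. x \<in> S \<Longrightarrow> f x > 0"
  shows "smooth_on S (\<lambda>x. sqrt (f x))"
proof -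
  have eq: "smooth_on S (\<lambda>x. sqrt (f x)) \<longleftrightarrow> smooth_on S (\<lambda>x. f x * inverse (sqrt (f x)))"
    by (rule smooth_on_cong[OF assms(1)])
       (use assms(3) in \<open>simp add: real_div_sqrt less_imp_le flip: divide_inverse\<close>)
  \<comment> \<open>The derivative of \<open>1 / sqrt y\<close> is \<open>-1/2\<close> times its own
    cube, so the bootstrap applies to it; the derivative of \<open>sqrt\<close> is not a polynomial
    in \<open>sqrt\<close>. This is why \<open>sqrt (f x)\<close> was rewritten as
    \<open>f x\<close> times its inverse square root.\<close>
  have "smooth_on S (\<lambda>x. inverse (sqrt (f x)))"
  proof (rule smooth_on_real_compose[where h = "\<lambda>y. inverse (sqrt y)" and
        h' = "\<lambda>y. - 1 / 2 * (inverse (sqrt y) * (inverse (sqrt y) * inverse (sqrt y)))"])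
    fix x assume "x \<in> S"
    then have "f x > 0" using assms by auto
    then show "((\<lambda>y. inverse (sqrt y)) has_real_derivative
       - 1 / 2 * (inverse (sqrt (f x)) * (inverse (sqrt (f x)) * inverse (sqrt (f x))))) (at (f x))"
      by (auto intro!: derivative_eq_intros simp: field_simps)
  next
    fix r assume "Ck_on r S (\<lambda>x. inverse (sqrt (f x)))"
    then show "Ck_on r S (\<lambda>x. - 1 / 2 * (inverse (sqrt (f x)) * (inverse (sqrt (f x)) * inverse (sqrt (f x)))))"
      by (intro Ck_on_mult Ck_on_const assms(1))
  qed fact+
  then show ?thesis unfolding eq by (intro smooth_on_mult assms)
qed

lemma smooth_on_nth: "smooth_on S (\<lambda>w::real^'n::finite. w $ j)"
proof -
  have "Ck_on r S (\<lambda>w::real^'n. w $ j)" for r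
  proof (cases r)
    case (Suc r')
    have "pd i (\<lambda>w::real^'n. w $ j) = (\<lambda>_. if i = j then 1 else 0)" for i
      by (rule ext) simp
    then show ?thesis
      unfolding Suc
      by (auto simp: Ck_on_const intro!: linear_imp_differentiable_on bounded_linear.linear[OF bounded_linear_vec_nth])
  qed (auto intro: continuous_intros)
  then show ?thesis by (simp add: smooth_on_def)
qed

lemmas smooth_intros = smooth_on_const smooth_on_add smooth_on_mult smooth_on_uminus smooth_on_diff
  smooth_on_sum smooth_on_prod smooth_on_pd smooth_on_nth

section \<open>Symmetry of second partial derivatives\<close>

lemma has_real_derivative_along_axis:
  fixes f :: "real^'n::finite \<Rightarrow> real"
  assumes "f differentiable at (x + s *\<^sub>R axis i 1)"
  shows "((\<lambda>s. f (x + s *\<^sub>R axis i 1)) has_real_derivative pd i f (x + s *\<^sub>R axis i 1)) (at s)"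
proof -
  let ?y = "x + s *\<^sub>R axis i 1"
  have 1: "((\<lambda>s. x + s *\<^sub>R axis i 1) has_derivative (\<lambda>h. h *\<^sub>R axis i 1)) (at s)"
    by (auto intro!: derivative_eq_intros)
  have 2: "(f has_derivative frechet_derivative f (at ?y)) (at ?y)"
    using assms frechet_derivative_works by blast
  have l: "linear (frechet_derivative f (at ?y))" using 2 has_derivative_linear by blast
  from diff_chain_at[OF 1 2] show ?thesis
    by (simp add: has_field_derivative_def o_def linear_cmul[OF l] pd_def mult_commute_abs)
qed

text \<open>The mean value theorem is used twice: in direction \<open>i\<close> for the difference
  of \<open>f\<close> across the square, then in direction \<open>j\<close> for
  \<open>pd i f\<close>. The bound \<open>2 * h < e\<close> keeps the whole square of side
  \<open>h\<close> inside the ball.\<close>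

lemma second_difference_mvt:
  fixes f :: "real^'n::finite \<Rightarrow> real"
  assumes S: "open S" "ball x e \<subseteq> S" and sm: "smooth_on S f" and h: "0 < h" "2 * h < e"
  obtains y where "dist x y < e"
    "f (x + h *\<^sub>R axis i 1 + h *\<^sub>R axis j 1) - f (x + h *\<^sub>R axis i 1) - f (x + h *\<^sub>R axis j 1) + f x
      = h * h * pd j (pd i f) y"
proof -
  have inS: "x + s *\<^sub>R axis i 1 + t *\<^sub>R axis j 1 \<in> ball x e" if "0 \<le> s" "s \<le> h" "0 \<le> t" "t \<le> h" for s t
  proof -
    have "norm (s *\<^sub>R axis i 1 + t *\<^sub>R axis j 1 :: real^'n) \<le> s + t"
      using norm_triangle_ineq[of "s *\<^sub>R axis i 1 :: real^'n" "t *\<^sub>R axis j 1"] that by simp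
    moreover have "dist x (x + s *\<^sub>R axis i 1 + t *\<^sub>R axis j 1) = norm (s *\<^sub>R axis i 1 + t *\<^sub>R axis j 1 :: real^'n)"
      by (metis add.assoc add_diff_cancel_left' dist_commute dist_norm)
    ultimately show ?thesis using that h by simp
  qed
  have d: "f differentiable at y" "pd i f differentiable at y" if "y \<in> ball x e" for y
    using that S sm smooth_on_imp_differentiable[OF _ S(1)] smooth_on_pd[OF sm] by blast+
  let ?\<phi> = "\<lambda>s. f (x + h *\<^sub>R axis j 1 + s *\<^sub>R axis i 1) - f (x + s *\<^sub>R axis i 1)"
  let ?\<phi>' = "\<lambda>s. pd i f (x + h *\<^sub>R axis j 1 + s *\<^sub>R axis i 1) - pd i f (x + s *\<^sub>R axis i 1)"
  have "\<exists>s>0. s < h \<and> ?\<phi> h - ?\<phi> 0 = (h - 0) * ?\<phi>' s"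
  proof (rule MVT2[OF h(1)])
    fix s :: real assume s: "0 \<le> s" "s \<le> h"
    show "(?\<phi> has_real_derivative ?\<phi>' s) (at s)"
      by (intro DERIV_diff has_real_derivative_along_axis d)
         (use inS[OF s, of h] inS[OF s, of 0] h in \<open>auto simp: ac_simps\<close>)
  qed
  then obtain s where s: "0 < s" "s < h" "?\<phi> h - ?\<phi> 0 = h * ?\<phi>' s" by auto
  let ?\<psi> = "\<lambda>t. pd i f (x + s *\<^sub>R axis i 1 + t *\<^sub>R axis j 1)"
  have "\<exists>t>0. t < h \<and> ?\<psi> h - ?\<psi> 0 = (h - 0) * pd j (pd i f) (x + s *\<^sub>R axis i 1 + t *\<^sub>R axis j 1)"
  proof (rule MVT2[OF h(1)])
    fix t :: real assume t: "0 \<le> t" "t \<le> h"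
    show "(?\<psi> has_real_derivative pd j (pd i f) (x + s *\<^sub>R axis i 1 + t *\<^sub>R axis j 1)) (at t)"
      by (intro has_real_derivative_along_axis d) (use inS[OF _ _ t, of s] s in auto)
  qed
  then obtain t where t: "0 < t" "t < h"
    "?\<psi> h - ?\<psi> 0 = h * pd j (pd i f) (x + s *\<^sub>R axis i 1 + t *\<^sub>R axis j 1)" by auto
  show ?thesis
  proof (rule that)
    show "dist x (x + s *\<^sub>R axis i 1 + t *\<^sub>R axis j 1) < e" using inS[of s t] s t by auto
    show "f (x + h *\<^sub>R axis i 1 + h *\<^sub>R axis j 1) - f (x + h *\<^sub>R axis i 1) - f (x + h *\<^sub>R axis j 1) + f x
      = h * h * pd j (pd i f) (x + s *\<^sub>R axis i 1 + t *\<^sub>R axis j 1)"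
      using s(3) t(3) by (simp add: ac_simps)
  qed
qed

text \<open>Schwarz's theorem: the second difference is symmetric in the two directions, so the two
  mixed derivatives agree at some pair of points arbitrarily close to \<open>x\<close>, and by
  continuity at \<open>x\<close>.\<close>

lemma pd_commute:
  fixes f :: "real^'n::finite \<Rightarrow> real"
  assumes S: "open S" "x \<in> S" and sm: "smooth_on S f"
  shows "pd i (pd j f) x = pd j (pd i f) x"
proof (rule ccontr)
  assume ne: "\<not> ?thesis"
  define d where "d = \<bar>pd i (pd j f) x - pd j (pd i f) x\<bar> / 2"
  have "d > 0" using ne by (simp add: d_def)
  have c: "isCont (pd i (pd j f)) x" "isCont (pd j (pd i f)) x"
    using smooth_on_imp_continuous_on[OF smooth_on_pd[OF smooth_on_pd[OF sm]]] S
    by (auto simp: continuous_on_eq_continuous_at)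
  obtain e1 where e1: "e1 > 0" "\<And>y. dist y x < e1 \<Longrightarrow> dist (pd i (pd j f) y) (pd i (pd j f) x) < d"
    using c(1)[unfolded continuous_at_eps_delta] \<open>d > 0\<close> by blast
  obtain e2 where e2: "e2 > 0" "\<And>y. dist y x < e2 \<Longrightarrow> dist (pd j (pd i f) y) (pd j (pd i f) x) < d"
    using c(2)[unfolded continuous_at_eps_delta] \<open>d > 0\<close> by blast
  obtain e3 where e3: "e3 > 0" "ball x e3 \<subseteq> S" using S openE by blast
  define e where "e = min e1 (min e2 e3)"
  have e: "e > 0" "e \<le> e1" "e \<le> e2" "ball x e \<subseteq> S" using e1 e2 e3 by (auto simp: e_def)
  define h where "h = e / 4"
  have h: "0 < h" "2 * h < e" using e by (auto simp: h_def)
  obtain y where y: "dist x y < e" "f (x + h *\<^sub>R axis i 1 + h *\<^sub>R axis j 1) - f (x + h *\<^sub>R axis i 1)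
     - f (x + h *\<^sub>R axis j 1) + f x = h * h * pd j (pd i f) y"
    using second_difference_mvt[OF S(1) e(4) sm h] by metis
  obtain z where z: "dist x z < e" "f (x + h *\<^sub>R axis j 1 + h *\<^sub>R axis i 1) - f (x + h *\<^sub>R axis j 1)
     - f (x + h *\<^sub>R axis i 1) + f x = h * h * pd i (pd j f) z"
    using second_difference_mvt[OF S(1) e(4) sm h] by metis
  have "h * h * pd j (pd i f) y = h * h * pd i (pd j f) z"
    unfolding y(2)[symmetric] z(2)[symmetric] by (simp add: ac_simps)
  then have "pd j (pd i f) y = pd i (pd j f) z" using h by simp
  moreover have "dist (pd j (pd i f) y) (pd j (pd i f) x) < d" "dist (pd i (pd j f) z) (pd i (pd j f) x) < d"
    using e1(2)[of z] e2(2)[of y] y z e by (auto simp: dist_commute)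
  ultimately show False
    by (simp add: d_def dist_real_def abs_if split: if_splits)
qed

section \<open>Smoothness of determinants and inverse matrices\<close>

lemma smooth_on_det:
  assumes "open S" "smooth_mat_on S A"
  shows "smooth_on S (\<lambda>x. det (A x :: real^'m::finite^'m))"
  using assms unfolding det_def smooth_mat_on_def
  by (intro smooth_intros) auto

lemma matrix_inv_left_right:
  fixes A :: "real^'n::finite^'n"
  assumes "det A \<noteq> 0"
  shows "A ** matrix_inv A = mat 1" "matrix_inv A ** A = mat 1"
proof -
  have "invertible A" using assms by (simp add: invertible_det_nz)
  then have "A ** matrix_inv A = mat 1 \<and> matrix_inv A ** A = mat 1"
    unfolding invertible_def matrix_inv_def by (rule someI_ex)
  then show "A ** matrix_inv A = mat 1" "matrix_inv A ** A = mat 1" by auto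
qed

text \<open>Applying Cramer's rule to the columns of the inverse makes its entries quotients of
  determinants, from which smoothness of the inverse metric is read off.\<close>

lemma matrix_inv_nth_cramer:
  fixes A :: "real^'n::finite^'n"
  assumes "det A \<noteq> 0"
  shows "matrix_inv A $ k $ l = det (\<chi> i j. if j = k then axis l 1 $ i else A $ i $ j) / det A"
proof -
  have "A *v (matrix_inv A *v axis l 1) = axis l 1"
    by (simp add: matrix_vector_mul_assoc matrix_inv_left_right[OF assms])
  then have "matrix_inv A *v axis l 1 = (\<chi> k. det (\<chi> i j. if j = k then axis l 1 $ i else A $ i $ j) / det A)"
    by (simp only: cramer[OF assms])
  then have "(matrix_inv A *v axis l 1) $ k = det (\<chi> i j. if j = k then axis l 1 $ i else A $ i $ j) / det A"
    by simp
  moreover have "(matrix_inv A *v axis l 1) $ k = matrix_inv A $ k $ l"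
    by (simp add: matrix_vector_mult_def axis_def if_distrib cong: if_cong)
  ultimately show ?thesis by simp
qed

lemma smooth_on_matrix_inv:
  assumes "open S" "smooth_mat_on S A" "\<And>x. x \<in> S \<Longrightarrow> det (A x :: real^'m::finite^'m) \<noteq> 0"
  shows "smooth_mat_on S (\<lambda>x. matrix_inv (A x))"
  unfolding smooth_mat_on_def
proof (intro allI)
  fix k l
  have "smooth_mat_on S (\<lambda>x. \<chi> i j. if j = k then axis l 1 $ i else A x $ i $ j)"
    unfolding smooth_mat_on_def
  proof (intro allI)
    fix i j
    show "smooth_on S (\<lambda>x. (\<chi> i j. if j = k then axis l 1 $ i else A x $ i $ j) $ i $ j)"
      using assms(2) by (cases "j = k") (simp_all add: smooth_mat_on_def smooth_on_const)
  qed
  from smooth_on_divide[OF assms(1) smooth_on_det[OF assms(1) this] smooth_on_det[OF assms(1,2)] assms(3)]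
  have "smooth_on S (\<lambda>x. det (\<chi> i j. if j = k then axis l 1 $ i else A x $ i $ j) / det (A x))" .
  moreover have "smooth_on S (\<lambda>x. matrix_inv (A x) $ k $ l) \<longleftrightarrow>
      smooth_on S (\<lambda>x. det (\<chi> i j. if j = k then axis l 1 $ i else A x $ i $ j) / det (A x))"
    by (rule smooth_on_cong[OF assms(1)], rule matrix_inv_nth_cramer, erule assms(3))
  ultimately show "smooth_on S (\<lambda>x. matrix_inv (A x) $ k $ l)" by blast
qed

section \<open>Levi-Civita calculus in coordinates\<close>

lemma sum_rotate3:
  "(\<Sum>a\<in>A. \<Sum>b\<in>B. \<Sum>c\<in>C. f a b c) = (\<Sum>b\<in>B. \<Sum>c\<in>C. \<Sum>a\<in>A. f a b c)"
  by (rule trans[OF sum.swap]) (intro sum.cong refl sum.swap)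

lemma sum_swap_pairs:
  "(\<Sum>a\<in>A. \<Sum>b\<in>B. \<Sum>c\<in>C. \<Sum>d\<in>D. f a b c d) = (\<Sum>c\<in>C. \<Sum>d\<in>D. \<Sum>a\<in>A. \<Sum>b\<in>B. f a b c d)"
  by (rule trans[OF sum.cong[OF refl sum_rotate3] sum_rotate3])

lemma sum_reverse3:
  "(\<Sum>a\<in>A. \<Sum>b\<in>B. \<Sum>c\<in>C. f a b c) = (\<Sum>c\<in>C. \<Sum>b\<in>B. \<Sum>a\<in>A. f a b c)"
proof -
  have "(\<Sum>a\<in>A. \<Sum>b\<in>B. \<Sum>c\<in>C. f a b c) = (\<Sum>a\<in>A. \<Sum>c\<in>C. \<Sum>b\<in>B. f a b c)"
    by (intro sum.cong refl sum.swap)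
  also have "\<dots> = (\<Sum>c\<in>C. \<Sum>a\<in>A. \<Sum>b\<in>B. f a b c)"
    by (rule sum.swap)
  also have "\<dots> = (\<Sum>c\<in>C. \<Sum>b\<in>B. \<Sum>a\<in>A. f a b c)"
    by (intro sum.cong refl sum.swap)
  finally show ?thesis .
qed

lemma sum_swap_ends:
  "(\<Sum>a\<in>A. \<Sum>b\<in>B. \<Sum>c\<in>C. \<Sum>d\<in>D. f a b c d) = (\<Sum>d\<in>D. \<Sum>b\<in>B. \<Sum>c\<in>C. \<Sum>a\<in>A. f a b c d)"
proof -
  have "(\<Sum>a\<in>A. \<Sum>b\<in>B. \<Sum>c\<in>C. \<Sum>d\<in>D. f a b c d) = (\<Sum>a\<in>A. \<Sum>d\<in>D. \<Sum>c\<in>C. \<Sum>b\<in>B. f a b c d)"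
    by (rule sum.cong[OF refl sum_reverse3])
  also have "\<dots> = (\<Sum>d\<in>D. \<Sum>a\<in>A. \<Sum>c\<in>C. \<Sum>b\<in>B. f a b c d)"
    by (rule sum.swap)
  also have "\<dots> = (\<Sum>d\<in>D. \<Sum>b\<in>B. \<Sum>c\<in>C. \<Sum>a\<in>A. f a b c d)"
    by (rule sum.cong[OF refl sum_reverse3])
  finally show ?thesis .
qed

lemma vec_eq_sum_axis: "v = (\<Sum>i\<in>UNIV. v $ i *\<^sub>R axis i (1::real))"
  by (simp add: vec_eq_iff axis_def if_distrib cong: if_cong)

lemma bilin_sum_def: "bilin A v w = (\<Sum>i\<in>UNIV. \<Sum>j\<in>UNIV. v $ i * A $ i $ j * w $ j)"
  by (simp add: bilin_def inner_vec_def matrix_vector_mult_def sum_distrib_left mult.assoc)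

lemma bilin_add: "bilin A (v + v') w = bilin A v w + bilin A v' w"
    "bilin A v (w + w') = bilin A v w + bilin A v w'"
  and bilin_diff: "bilin A (v - v') w = bilin A v w - bilin A v' w"
    "bilin A v (w - w') = bilin A v w - bilin A v w'"
  and bilin_scale: "bilin A (c *\<^sub>R v) w = c * bilin A v w" "bilin A v (c *\<^sub>R w) = c * bilin A v w"
  and bilin_minus: "bilin A (- v) w = - bilin A v w" "bilin A v (- w) = - bilin A v w"
  and bilin_0: "bilin A 0 w = 0" "bilin A v 0 = 0"
  and bilin_sum: "bilin A (\<Sum>a\<in>I. f a) w = (\<Sum>a\<in>I. bilin A (f a) w)"
    "bilin A v (\<Sum>a\<in>I. f a) = (\<Sum>a\<in>I. bilin A v (f a))"
  by (simp_all add: bilin_def matrix_vector_right_distrib matrix_vector_mult_diff_distrib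
      inner_add_left inner_add_right inner_diff_left inner_diff_right matrix_vector_mult_scaleR
      inner_sum_left inner_sum_right linear_sum[OF matrix_vector_mul_linear] linear_neg[OF matrix_vector_mul_linear])

lemmas bilin_simps = bilin_add bilin_diff bilin_scale bilin_minus bilin_0 bilin_sum

lemma bilin_axis: "bilin A (axis i 1) (axis j 1) = A $ i $ j"
  by (simp add: bilin_def inner_axis' matrix_vector_mult_def) (simp add: axis_def if_distrib cong: if_cong)

lemma differentiable_vec_nth:
  fixes Y :: "'a::real_normed_vector \<Rightarrow> real^'m::finite"
  assumes "Y differentiable at x"
  shows "(\<lambda>y. Y y $ k) differentiable at x"
proof -
  obtain Y' where "(Y has_derivative Y') (at x)" using assms by (auto simp: differentiable_def)
  from bounded_linear.has_derivative[OF bounded_linear_vec_nth this, of k]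
  show ?thesis by (auto simp: differentiable_def)
qed

lemma differentiable_vecI:
  fixes Y :: "'a::real_normed_vector \<Rightarrow> real^'m::finite"
  assumes "\<And>k. (\<lambda>y. Y y $ k) differentiable at x"
  shows "Y differentiable at x"
  using has_derivative_vec_nth_differentiable[OF assms] by (auto simp: differentiable_def)

lemma smooth_vec_on_imp_differentiable:
  "smooth_vec_on S Y \<Longrightarrow> open S \<Longrightarrow> x \<in> S \<Longrightarrow> Y differentiable at x"
  by (rule differentiable_vecI) (auto simp: smooth_vec_on_def intro: smooth_on_imp_differentiable)

section \<open>Directional derivatives, the covariant derivative and the curvature map\<close>

definition dirv :: "real^'n::finite \<Rightarrow> (real^'n \<Rightarrow> real) \<Rightarrow> real^'n \<Rightarrow> real" where
  "dirv v f x = (\<Sum>i\<in>UNIV. v $ i * pd i f x)"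

text \<open>The direction \<open>v\<close> is a vector at the point and not a field, so tensoriality
  in the direction is built in; only \<open>Y\<close> is differentiated.\<close>

definition cov :: "(real^'n::finite \<Rightarrow> real^'n^'n) \<Rightarrow> real^'n \<Rightarrow> (real^'n \<Rightarrow> real^'n) \<Rightarrow> real^'n \<Rightarrow> real^'n" where
  "cov g v Y x = (\<chi> k. dirv v (\<lambda>y. Y y $ k) x +
     (\<Sum>i\<in>UNIV. \<Sum>m\<in>UNIV. christoffel g k i m x * v $ i * Y x $ m))"

text \<open>The multilinear extension of \<open>curvature_up\<close> to vectors at a point. Its
  meaning as a commutator of covariant derivatives is \<open>cov_comm\<close>.\<close>

definition curv ::
  "(real^'n::finite \<Rightarrow> real^'n^'n) \<Rightarrow> real^'n \<Rightarrow> real^'n \<Rightarrow> real^'n \<Rightarrow> real^'n \<Rightarrow> real^'n" where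
  "curv g v w z x = (\<chi> l. \<Sum>i\<in>UNIV. \<Sum>j\<in>UNIV. \<Sum>k\<in>UNIV. v $ i * w $ j * z $ k * curvature_up g i j k l x)"

lemma dirv_cong:
  "open S \<Longrightarrow> x \<in> S \<Longrightarrow> (\<And>y. y \<in> S \<Longrightarrow> f y = h y) \<Longrightarrow> dirv v f x = dirv v h x"
  by (simp add: dirv_def pd_cong[of S x f h])

lemma dirv_const [simp]: "dirv v (\<lambda>x. c) x = 0"
  by (simp add: dirv_def)

lemma dirv_linear:
  "dirv (v + w) f x = dirv v f x + dirv w f x" "dirv (v - w) f x = dirv v f x - dirv w f x"
  "dirv (c *\<^sub>R v) f x = c * dirv v f x"
  "dirv (\<Sum>a\<in>I. h a) f x = (\<Sum>a\<in>I. dirv (h a) f x)"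
  by (simp_all add: dirv_def algebra_simps sum.distrib sum_subtractf sum_distrib_left)
     (subst sum.swap, simp add: sum_distrib_right)

lemma dirv_axis [simp]: "dirv (axis i 1) f x = pd i f x"
  by (simp add: dirv_def axis_def if_distrib if_distribR cong: if_cong)

lemma dirv_add: "f differentiable at x \<Longrightarrow> h differentiable at x \<Longrightarrow>
    dirv v (\<lambda>x. f x + h x) x = dirv v f x + dirv v h x"
  and dirv_mult: "f differentiable at x \<Longrightarrow> h differentiable at x \<Longrightarrow>
    dirv v (\<lambda>x. f x * h x) x = dirv v f x * h x + f x * dirv v h x"
  by (simp_all add: dirv_def pd_add pd_mult algebra_simps sum.distrib sum_subtractf sum_distrib_left)

lemma dirv_sum: "(\<And>a. a \<in> A \<Longrightarrow> f a differentiable at x) \<Longrightarrow>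
    dirv v (\<lambda>x. \<Sum>a\<in>A. f a x) x = (\<Sum>a\<in>A. dirv v (f a) x)"
  by (simp add: dirv_def pd_sum sum_distrib_left) (rule sum.swap)

lemma dirv_compose:
  fixes F :: "real^'n::finite \<Rightarrow> real^'m::finite"
  assumes "f differentiable at (F x)" "\<And>a. (\<lambda>x. F x $ a) differentiable at x"
  shows "dirv v (\<lambda>x. f (F x)) x = (\<Sum>a\<in>UNIV. pd a f (F x) * dirv v (\<lambda>x. F x $ a) x)"
  unfolding dirv_def pd_compose(1)[OF assms] sum_distrib_left
  by (subst sum.swap) (simp add: mult_ac)

lemma cov_linear:
  "cov g (v + w) Y x = cov g v Y x + cov g w Y x" "cov g (v - w) Y x = cov g v Y x - cov g w Y x"
  "cov g (c *\<^sub>R v) Y x = c *\<^sub>R cov g v Y x"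
  by (simp_all add: cov_def vec_eq_iff dirv_linear algebra_simps sum.distrib sum_subtractf sum_distrib_left)

lemma cov_sum_left: "cov g (\<Sum>a\<in>I. h a) Y x = (\<Sum>a\<in>I. cov g (h a) Y x)"
proof (induction I rule: infinite_finite_induct)
  case (insert a I)
  then show ?case by (simp add: cov_linear)
qed (use cov_linear(3)[of g 0 0 Y x] in simp_all)

lemma cov_cong:
  assumes "open S" "x \<in> S" "\<And>y. y \<in> S \<Longrightarrow> Y y = Z y"
  shows "cov g v Y x = cov g v Z x"
proof -
  have "dirv v (\<lambda>y. Y y $ k) x = dirv v (\<lambda>y. Z y $ k) x" for k
    using assms by (intro dirv_cong[OF assms(1,2)]) simp
  then show ?thesis using assms by (simp add: cov_def)
qed

lemma cov_add:
  "Y differentiable at x \<Longrightarrow> Z differentiable at x \<Longrightarrow>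
    cov g v (\<lambda>y. Y y + Z y) x = cov g v Y x + cov g v Z x"
  by (simp add: cov_def vec_eq_iff dirv_add differentiable_vec_nth algebra_simps sum.distrib)

lemma cov_scale:
  "f differentiable at x \<Longrightarrow> Y differentiable at x \<Longrightarrow>
    cov g v (\<lambda>y. f y *\<^sub>R Y y) x = dirv v f x *\<^sub>R Y x + f x *\<^sub>R cov g v Y x"
  by (simp add: cov_def vec_eq_iff dirv_mult differentiable_vec_nth algebra_simps sum_distrib_left)

lemma cov_sum:
  assumes "\<And>a. a \<in> A \<Longrightarrow> Y a differentiable at x"
  shows "cov g v (\<lambda>y. \<Sum>a\<in>A. Y a y) x = (\<Sum>a\<in>A. cov g v (Y a) x)"
  using assms
proof (induction A rule: infinite_finite_induct)
  case (insert a A)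
  then show ?case by (simp add: cov_add differentiable_sum)
qed (simp_all add: cov_def vec_eq_iff)

lemma lie_bracket_eq_dirv:
  "lie_bracket X Y x $ k = dirv (X x) (\<lambda>y. Y y $ k) x - dirv (Y x) (\<lambda>y. X y $ k) x"
  by (simp add: lie_bracket_def dirv_def sum_subtractf)

lemma lie_bracket_const [simp]: "lie_bracket (\<lambda>_. v) (\<lambda>_. w) x = 0"
  by (simp add: vec_eq_iff lie_bracket_eq_dirv)

locale riemannian =
  fixes U :: "(real^'n::finite) set" and g :: "real^'n \<Rightarrow> real^'n^'n"
  assumes open_U: "open U" and metric: "riemannian_metric_on U g"
begin

abbreviation inn where "inn x \<equiv> bilin (g x)"

lemma g_sym: "x \<in> U \<Longrightarrow> g x $ i $ j = g x $ j $ i"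
proof -
  assume "x \<in> U"
  then have "transpose (g x) $ i $ j = g x $ i $ j"
    using metric by (simp add: riemannian_metric_on_def)
  then show ?thesis by (simp add: transpose_def)
qed

lemma inn_pos: "x \<in> U \<Longrightarrow> v \<noteq> 0 \<Longrightarrow> inn x v v > 0"
  using metric by (auto simp: riemannian_metric_on_def)

lemma inn_sym: "x \<in> U \<Longrightarrow> inn x v w = inn x w v"
  unfolding bilin_sum_def by (subst sum.swap) (simp add: g_sym[of x] mult_ac)

lemma inn_eqI: "x \<in> U \<Longrightarrow> (\<And>w. inn x v w = inn x v' w) \<Longrightarrow> v = v'"
  using inn_pos[of x "v - v'"] by (force simp: bilin_simps)

lemma det_g: "x \<in> U \<Longrightarrow> det (g x) \<noteq> 0"
proof
  assume x: "x \<in> U" and "det (g x) = 0"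
  then obtain v where "v \<noteq> 0" "g x *v v = 0"
    using invertible_det_nz[of "g x"] matrix_left_invertible_ker[of "g x"] invertible_left_inverse[of "g x"] by auto
  with inn_pos[OF x, of v] show False by (simp add: bilin_def)
qed

lemma ginv: "x \<in> U \<Longrightarrow> g x ** matrix_inv (g x) = mat 1" "x \<in> U \<Longrightarrow> matrix_inv (g x) ** g x = mat 1"
  using matrix_inv_left_right[OF det_g] by auto

lemma smooth_g: "smooth_on U (\<lambda>x. g x $ i $ j)"
  using metric by (auto simp: riemannian_metric_on_def smooth_mat_on_def)

lemma smooth_ginv: "smooth_on U (\<lambda>x. matrix_inv (g x) $ i $ j)"
  using smooth_on_matrix_inv[OF open_U, of g] det_g smooth_g by (auto simp: smooth_mat_on_def)

lemma smooth_christoffel: "smooth_on U (christoffel g l i j)"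
  unfolding christoffel_def[abs_def]
  by (intro smooth_intros smooth_on_divide open_U smooth_ginv smooth_g) auto

lemma smooth_curvature_up: "smooth_on U (curvature_up g i j k l)"
  unfolding curvature_up_def[abs_def]
  by (intro smooth_intros open_U smooth_christoffel)

lemma smooth_riemann: "smooth_on U (riemann g i j k l)"
  unfolding riemann_def[abs_def]
  by (intro smooth_intros open_U smooth_curvature_up smooth_g)

lemma smooth_ricci: "smooth_on U (\<lambda>x. ricci g x $ i $ j)"
  unfolding ricci_def[abs_def] vec_lambda_beta
  by (intro smooth_intros open_U smooth_ginv smooth_riemann)

lemma smooth_scalar: "smooth_on U (scalar_curvature g)"
  unfolding scalar_curvature_def[abs_def]
  by (intro smooth_intros open_U smooth_ginv smooth_ricci)

lemma pd_g_sym: "x \<in> U \<Longrightarrow> pd k (\<lambda>y. g y $ i $ j) x = pd k (\<lambda>y. g y $ j $ i) x"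
  by (rule pd_cong[OF open_U]) (auto simp: g_sym)

lemma christoffel_sym: "x \<in> U \<Longrightarrow> christoffel g l i j x = christoffel g l j i x"
  by (simp add: christoffel_def pd_g_sym[of x _ i j] add.commute)

lemma christoffel_lower:
  assumes "x \<in> U"
  shows "(\<Sum>l\<in>UNIV. g x $ k $ l * christoffel g l i j x) =
    (pd i (\<lambda>y. g y $ j $ k) x + pd j (\<lambda>y. g y $ i $ k) x - pd k (\<lambda>y. g y $ i $ j) x) / 2"
proof -
  let ?G = "\<lambda>m. pd i (\<lambda>y. g y $ j $ m) x + pd j (\<lambda>y. g y $ i $ m) x - pd m (\<lambda>y. g y $ i $ j) x"
  have "(\<Sum>l\<in>UNIV. g x $ k $ l * christoffel g l i j x) =
      (\<Sum>l\<in>UNIV. \<Sum>m\<in>UNIV. g x $ k $ l * matrix_inv (g x) $ l $ m * ?G m) / 2"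
    by (simp add: christoffel_def sum_distrib_left mult.assoc flip: sum_divide_distrib)
  also have "\<dots> = (\<Sum>m\<in>UNIV. (g x ** matrix_inv (g x)) $ k $ m * ?G m) / 2"
    by (subst sum.swap) (simp add: matrix_matrix_mult_def sum_distrib_right)
  also have "\<dots> = ?G k / 2"
    by (simp add: ginv[OF assms] mat_def if_distrib if_distribR cong: if_cong)
  finally show ?thesis .
qed

text \<open>Metric compatibility in components: in the sum of the two lowered Christoffel symbols
  every derivative except the one in direction \<open>i\<close> cancels.\<close>

lemma pd_g:
  assumes "x \<in> U"
  shows "pd i (\<lambda>y. g y $ j $ k) x =
    (\<Sum>l\<in>UNIV. g x $ l $ k * christoffel g l i j x) + (\<Sum>l\<in>UNIV. g x $ j $ l * christoffel g l i k x)"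
proof -
  have "(\<Sum>l\<in>UNIV. g x $ l $ k * christoffel g l i j x) = (\<Sum>l\<in>UNIV. g x $ k $ l * christoffel g l i j x)"
    by (intro sum.cong refl arg_cong2[where f = "(*)"] g_sym[OF assms])
  then show ?thesis
    unfolding christoffel_lower[OF assms]
    by (simp add: pd_g_sym[OF assms, of _ k j] pd_g_sym[OF assms, of _ j i]
        pd_g_sym[OF assms, of _ k i] christoffel_lower[OF assms] field_simps)
qed

lemma dirv_inn:
  assumes x: "x \<in> U" and Y: "Y differentiable at x" and Z: "Z differentiable at x"
  shows "dirv v (\<lambda>y. inn y (Y y) (Z y)) x = inn x (cov g v Y x) (Z x) + inn x (Y x) (cov g v Z x)"
proof -
  note d = differentiable_vec_nth[OF Y] differentiable_vec_nth[OF Z]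
    smooth_on_imp_differentiable[OF smooth_g open_U x]
  have "dirv v (\<lambda>y. inn y (Y y) (Z y)) x = (\<Sum>j\<in>UNIV. \<Sum>k\<in>UNIV.
      dirv v (\<lambda>y. Y y $ j) x * g x $ j $ k * Z x $ k + Y x $ j * dirv v (\<lambda>y. g y $ j $ k) x * Z x $ k
      + Y x $ j * g x $ j $ k * dirv v (\<lambda>y. Z y $ k) x)"
    unfolding bilin_sum_def
    by (simp add: dirv_sum dirv_mult d differentiable_sum algebra_simps)
  also have "\<dots> = (\<Sum>j\<in>UNIV. \<Sum>k\<in>UNIV. dirv v (\<lambda>y. Y y $ j) x * g x $ j $ k * Z x $ k)
      + (\<Sum>j\<in>UNIV. \<Sum>k\<in>UNIV. Y x $ j * dirv v (\<lambda>y. g y $ j $ k) x * Z x $ k)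
      + (\<Sum>j\<in>UNIV. \<Sum>k\<in>UNIV. Y x $ j * g x $ j $ k * dirv v (\<lambda>y. Z y $ k) x)"
    by (simp add: sum.distrib)
  \<comment> \<open>The derivative of the metric splits by \<open>pd_g\<close> into two Christoffel
    sums; one is absorbed by the derivative of \<open>Y\<close>, the other by that of
    \<open>Z\<close>.\<close>
  also have "(\<Sum>j\<in>UNIV. \<Sum>k\<in>UNIV. Y x $ j * dirv v (\<lambda>y. g y $ j $ k) x * Z x $ k) =
      (\<Sum>j\<in>UNIV. \<Sum>k\<in>UNIV. \<Sum>i\<in>UNIV. \<Sum>l\<in>UNIV. Y x $ j * v $ i * g x $ l $ k * christoffel g l i j x * Z x $ k)
      + (\<Sum>j\<in>UNIV. \<Sum>k\<in>UNIV. \<Sum>i\<in>UNIV. \<Sum>l\<in>UNIV. Y x $ j * v $ i * g x $ j $ l * christoffel g l i k x * Z x $ k)"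
    by (simp add: dirv_def pd_g[OF x] sum.distrib sum_distrib_left sum_distrib_right algebra_simps)
  also have "(\<Sum>j\<in>UNIV. \<Sum>k\<in>UNIV. \<Sum>i\<in>UNIV. \<Sum>l\<in>UNIV. Y x $ j * v $ i * g x $ l $ k * christoffel g l i j x * Z x $ k) =
      (\<Sum>l\<in>UNIV. \<Sum>k\<in>UNIV. (\<Sum>i\<in>UNIV. \<Sum>j\<in>UNIV. christoffel g l i j x * v $ i * Y x $ j) * g x $ l $ k * Z x $ k)"
    by (subst sum_swap_ends) (simp add: sum_distrib_left sum_distrib_right mult_ac)
  also have "(\<Sum>j\<in>UNIV. \<Sum>k\<in>UNIV. \<Sum>i\<in>UNIV. \<Sum>l\<in>UNIV. Y x $ j * v $ i * g x $ j $ l * christoffel g l i k x * Z x $ k) =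
      (\<Sum>j\<in>UNIV. \<Sum>l\<in>UNIV. Y x $ j * g x $ j $ l * (\<Sum>i\<in>UNIV. \<Sum>k\<in>UNIV. christoffel g l i k x * v $ i * Z x $ k))"
    by (rule sum.cong[OF refl], subst sum_reverse3) (simp add: sum_distrib_left sum_distrib_right mult_ac)
  finally show ?thesis
    unfolding bilin_sum_def cov_def
    by (simp add: algebra_simps sum.distrib)
qed

lemma cov_torsion_free:
  assumes "x \<in> U"
  shows "cov g (X x) Y x - cov g (Y x) X x = lie_bracket X Y x"
proof -
  have "(\<Sum>i\<in>UNIV. \<Sum>m\<in>UNIV. christoffel g k i m x * X x $ i * Y x $ m) =
     (\<Sum>i\<in>UNIV. \<Sum>m\<in>UNIV. christoffel g k i m x * Y x $ i * X x $ m)" for k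
    by (subst sum.swap) (simp add: christoffel_sym[OF assms, of k] mult_ac)
  then show ?thesis
    by (simp add: vec_eq_iff cov_def lie_bracket_eq_dirv)
qed

lemma cov_const_sym: "x \<in> U \<Longrightarrow> cov g v (\<lambda>_. w) x = cov g w (\<lambda>_. v) x"
  using cov_torsion_free[of x "\<lambda>_. v" "\<lambda>_. w"] by simp

end

section \<open>Curvature as a commutator, and its algebraic symmetries\<close>

lemma smooth_vec_intros:
  assumes "open S"
  shows "smooth_vec_on S (\<lambda>_. c)"
    and "smooth_vec_on S Y \<Longrightarrow> smooth_vec_on S Z \<Longrightarrow> smooth_vec_on S (\<lambda>x. Y x + Z x)"
    and "smooth_vec_on S Y \<Longrightarrow> smooth_vec_on S Z \<Longrightarrow> smooth_vec_on S (\<lambda>x. Y x - Z x)"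
    and "smooth_on S f \<Longrightarrow> smooth_vec_on S Y \<Longrightarrow> smooth_vec_on S (\<lambda>x. f x *\<^sub>R Y x)"
    and "smooth_mat_on S A \<Longrightarrow> smooth_vec_on S Y \<Longrightarrow> smooth_vec_on S (\<lambda>x. A x *v Y x)"
  using assms by (auto simp: smooth_vec_on_def smooth_mat_on_def matrix_vector_mult_def
      intro!: smooth_on_const smooth_on_add smooth_on_mult smooth_on_diff smooth_on_sum)

lemma dirv_commute:
  assumes "open S" "x \<in> S" "smooth_on S f"
  shows "dirv v (dirv w f) x = dirv w (dirv v f) x"
proof -
  have d: "pd i f differentiable at x" for i
    using assms by (auto intro: smooth_on_imp_differentiable smooth_on_pd)
  have "dirv v (dirv w f) x = (\<Sum>i\<in>UNIV. \<Sum>j\<in>UNIV. v $ i * w $ j * pd i (pd j f) x)" for v w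
    unfolding dirv_def[of v] unfolding dirv_def
    by (simp add: pd_sum pd_cmult d sum_distrib_left mult.assoc)
  then show ?thesis
    by (simp add: pd_commute[OF assms]) (subst sum.swap, simp add: pd_commute[OF assms] mult_ac)
qed

lemma cov_axis_nth: "cov g (axis i 1) Y x $ k =
    pd i (\<lambda>y. Y y $ k) x + (\<Sum>m\<in>UNIV. christoffel g k i m x * Y x $ m)"
  by (simp add: cov_def axis_def if_distrib if_distribR sum.delta cong: if_cong)
     (subst sum.swap, simp add: if_distrib if_distribR sum.delta dirv_axis[unfolded axis_def] cong: if_cong)

lemma cov_eq_sum_axis: "cov g v Y x = (\<Sum>i\<in>UNIV. v $ i *\<^sub>R cov g (axis i 1) Y x)"
  by (subst vec_eq_sum_axis[of v]) (simp only: cov_sum_left cov_linear)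

lemma curv_add: "curv g (v + v') w z x = curv g v w z x + curv g v' w z x"
    "curv g v (w + w') z x = curv g v w z x + curv g v w' z x"
    "curv g v w (z + z') x = curv g v w z x + curv g v w z' x"
  and curv_scale: "curv g (c *\<^sub>R v) w z x = c *\<^sub>R curv g v w z x"
    "curv g v (c *\<^sub>R w) z x = c *\<^sub>R curv g v w z x"
    "curv g v w (c *\<^sub>R z) x = c *\<^sub>R curv g v w z x"
  and curv_0: "curv g 0 w z x = 0" "curv g v 0 z x = 0" "curv g v w 0 x = 0"
  by (simp_all add: curv_def vec_eq_iff algebra_simps sum.distrib sum_distrib_left)

lemma curv_sum:
    "curv g (\<Sum>a\<in>I. f a) w z x = (\<Sum>a\<in>I. curv g (f a) w z x)"
    "curv g v (\<Sum>a\<in>I. f a) z x = (\<Sum>a\<in>I. curv g v (f a) z x)"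
    "curv g v w (\<Sum>a\<in>I. f a) x = (\<Sum>a\<in>I. curv g v w (f a) x)"
  by (induction I rule: infinite_finite_induct; simp add: curv_add curv_0)+

lemma curv_minus: "curv g (- v) w z x = - curv g v w z x"
    "curv g v (- w) z x = - curv g v w z x"
    "curv g v w (- z) x = - curv g v w z x"
  by (metis curv_scale scaleR_minus1_left)+

definition Rm :: "(real^'n::finite \<Rightarrow> real^'n^'n) \<Rightarrow> real^'n \<Rightarrow> real^'n \<Rightarrow> real^'n \<Rightarrow> real^'n \<Rightarrow> real^'n \<Rightarrow> real" where
  "Rm g x v w z t = bilin (g x) (curv g v w z x) t"

lemmas Rm_simps = curv_add curv_scale curv_sum curv_minus bilin_simps

lemma sum_axis_mult: "(\<Sum>i\<in>UNIV. axis a (1::real) $ i * f i) = f a"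
  by (simp add: axis_def if_distrib if_distribR cong: if_cong)

lemma curv_axis: "curv g (axis i 1) (axis j 1) (axis k 1) x $ l = curvature_up g i j k l x"
  by (simp only: curv_def vec_lambda_beta mult.assoc sum_distrib_left[symmetric] sum_axis_mult)

context riemannian
begin

lemma Rm_axis: "x \<in> U \<Longrightarrow> Rm g x (axis i 1) (axis j 1) (axis k 1) (axis l 1) = riemann g i j k l x"
  unfolding Rm_def
  by (subst inn_sym) (simp_all only: riemann_def bilin_sum_def curv_axis
      mult.assoc sum_distrib_left[symmetric] sum_axis_mult)

lemma Rm_sum:
  assumes "x \<in> U"
  shows "Rm g x v w z t = (\<Sum>i\<in>UNIV. \<Sum>j\<in>UNIV. \<Sum>k\<in>UNIV. \<Sum>l\<in>UNIV. v $ i * w $ j * z $ k * t $ l * riemann g i j k l x)"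
proof -
  have 1: "Rm g x v w z t = (\<Sum>i\<in>UNIV. v $ i * Rm g x (axis i 1) w z t)" for v w z t
    unfolding Rm_def by (subst vec_eq_sum_axis[of v]) (simp only: Rm_simps)
  have 2: "Rm g x v w z t = (\<Sum>i\<in>UNIV. w $ i * Rm g x v (axis i 1) z t)" for v w z t
    unfolding Rm_def by (subst vec_eq_sum_axis[of w]) (simp only: Rm_simps)
  have 3: "Rm g x v w z t = (\<Sum>i\<in>UNIV. z $ i * Rm g x v w (axis i 1) t)" for v w z t
    unfolding Rm_def by (subst vec_eq_sum_axis[of z]) (simp only: Rm_simps)
  have 4: "Rm g x v w z t = (\<Sum>i\<in>UNIV. t $ i * Rm g x v w z (axis i 1))" for v w z t
    unfolding Rm_def by (subst vec_eq_sum_axis[of t]) (simp only: Rm_simps)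
  show ?thesis
    unfolding 1[of v w z t] unfolding 2[of _ w z t] unfolding 3[of _ _ z t] unfolding 4[of _ _ _ t] Rm_axis[OF assms]
    by (simp add: sum_distrib_left mult.assoc)
qed

lemma smooth_vec_cov_axis: "smooth_vec_on U Y \<Longrightarrow> smooth_vec_on U (cov g (axis i 1) Y)"
  unfolding smooth_vec_on_def cov_axis_nth
  by (intro allI smooth_intros open_U smooth_christoffel) auto

lemma smooth_vec_cov: "smooth_vec_on U X \<Longrightarrow> smooth_vec_on U Y \<Longrightarrow> smooth_vec_on U (\<lambda>y. cov g (X y) Y y)"
  using smooth_vec_cov_axis[of Y]
  by (subst cov_eq_sum_axis) (auto simp: smooth_vec_on_def intro!: smooth_intros open_U)

lemma diff_at: "x \<in> U \<Longrightarrow> smooth_vec_on U Y \<Longrightarrow> Y differentiable at x"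
  by (rule smooth_vec_on_imp_differentiable[OF _ open_U])

lemma smooth_inn: "smooth_vec_on U Y \<Longrightarrow> smooth_vec_on U Z \<Longrightarrow> smooth_on U (\<lambda>y. inn y (Y y) (Z y))"
  unfolding bilin_sum_def by (intro smooth_intros open_U smooth_g) (auto simp: smooth_vec_on_def)

text \<open>The Christoffel symbols are the components of the derivatives of constant coordinate
  fields, so on these fields the commutator is literally the coordinate formula.\<close>

lemma cov_axis_axis:
  assumes x: "x \<in> U"
  shows "cov g (axis i 1) (cov g (axis j 1) (\<lambda>_. axis k 1)) x
     - cov g (axis j 1) (cov g (axis i 1) (\<lambda>_. axis k 1)) x = (\<chi> l. curvature_up g i j k l x)"
proof -
  have "cov g (axis j 1) (\<lambda>_. axis k 1) y $ m = christoffel g m j k y" for j m y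
    by (simp add: cov_axis_nth) (simp add: axis_def if_distrib cong: if_cong)
  then show ?thesis
    by (simp add: vec_eq_iff cov_axis_nth[of g _ "cov g _ _"] curvature_up_def sum_subtractf mult.commute)
qed

text \<open>Writing \<open>Z\<close> as a combination of constant coordinate fields reduces to
  \<open>cov_axis_axis\<close>: the terms with first derivatives of the coefficients are symmetric
  in \<open>i\<close> and \<open>j\<close>, and those with second derivatives cancel by
  \<open>pd_commute\<close>.\<close>

lemma cov_comm_axis:
  assumes x: "x \<in> U" and Z: "smooth_vec_on U Z"
  shows "cov g (axis i 1) (cov g (axis j 1) Z) x - cov g (axis j 1) (cov g (axis i 1) Z) x
    = (\<Sum>k\<in>UNIV. Z x $ k *\<^sub>R (\<chi> l. curvature_up g i j k l x))"
proof -
  have sZ: "smooth_on U (\<lambda>y. Z y $ k)" for k using Z by (simp add: smooth_vec_on_def)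
  have dZ: "(\<lambda>y. Z y $ k) differentiable at y" "pd i (\<lambda>y. Z y $ k) differentiable at y" if "y \<in> U" for k y i
    using sZ open_U that by (auto intro: smooth_on_imp_differentiable smooth_on_pd)
  have ax: "cov g (axis j 1) (\<lambda>_. axis k 1) differentiable at x" for j k
    by (intro diff_at x smooth_vec_cov_axis smooth_vec_intros open_U)
  have 1: "cov g (axis j 1) Z y = (\<Sum>k\<in>UNIV. pd j (\<lambda>y. Z y $ k) y *\<^sub>R axis k 1
       + Z y $ k *\<^sub>R cov g (axis j 1) (\<lambda>_. axis k 1) y)" if y: "y \<in> U" for j y
  proof -
    have "cov g (axis j 1) Z y = cov g (axis j 1) (\<lambda>y. \<Sum>k\<in>UNIV. Z y $ k *\<^sub>R axis k 1) y"
      by (simp only: vec_eq_sum_axis[symmetric])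
    also have "\<dots> = (\<Sum>k\<in>UNIV. cov g (axis j 1) (\<lambda>y. Z y $ k *\<^sub>R axis k 1) y)"
      by (rule cov_sum) (use dZ y in auto)
    also have "\<dots> = (\<Sum>k\<in>UNIV. pd j (\<lambda>y. Z y $ k) y *\<^sub>R axis k 1
       + Z y $ k *\<^sub>R cov g (axis j 1) (\<lambda>_. axis k 1) y)"
      by (intro sum.cong refl, subst cov_scale) (use dZ y in auto)
    finally show ?thesis .
  qed
  have 2: "cov g (axis i 1) (cov g (axis j 1) Z) x = (\<Sum>k\<in>UNIV. pd i (pd j (\<lambda>y. Z y $ k)) x *\<^sub>R axis k 1
      + pd j (\<lambda>y. Z y $ k) x *\<^sub>R cov g (axis i 1) (\<lambda>_. axis k 1) x
      + pd i (\<lambda>y. Z y $ k) x *\<^sub>R cov g (axis j 1) (\<lambda>_. axis k 1) x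
      + Z x $ k *\<^sub>R cov g (axis i 1) (cov g (axis j 1) (\<lambda>_. axis k 1)) x)" for i j
  proof -
    have "cov g (axis i 1) (cov g (axis j 1) Z) x = cov g (axis i 1) (\<lambda>y. \<Sum>k\<in>UNIV. pd j (\<lambda>y. Z y $ k) y *\<^sub>R axis k 1
       + Z y $ k *\<^sub>R cov g (axis j 1) (\<lambda>_. axis k 1) y) x"
      by (rule cov_cong[OF open_U x 1])
    also have "\<dots> = (\<Sum>k\<in>UNIV. cov g (axis i 1) (\<lambda>y. pd j (\<lambda>y. Z y $ k) y *\<^sub>R axis k 1
       + Z y $ k *\<^sub>R cov g (axis j 1) (\<lambda>_. axis k 1) y) x)"
      by (rule cov_sum) (use dZ ax x in \<open>auto intro!: differentiable_add differentiable_scaleR\<close>)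
    also have "\<dots> = (\<Sum>k\<in>UNIV. pd i (pd j (\<lambda>y. Z y $ k)) x *\<^sub>R axis k 1
      + pd j (\<lambda>y. Z y $ k) x *\<^sub>R cov g (axis i 1) (\<lambda>_. axis k 1) x
      + pd i (\<lambda>y. Z y $ k) x *\<^sub>R cov g (axis j 1) (\<lambda>_. axis k 1) x
      + Z x $ k *\<^sub>R cov g (axis i 1) (cov g (axis j 1) (\<lambda>_. axis k 1)) x)"
      using dZ ax x by (intro sum.cong refl) (subst cov_add; auto simp: cov_scale intro!: differentiable_scaleR)
    finally show ?thesis .
  qed
  show ?thesis
    unfolding 2 cov_axis_axis[OF x, symmetric]
    by (simp add: pd_commute[OF open_U x sZ, of i j] scaleR_diff_right algebra_simps flip: sum_subtractf)
qed

text \<open>The bridge between the component formula and invariant calculus: derivatives of the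
  coefficients of \<open>X\<close> and \<open>Y\<close> are exactly what the bracket term removes.
  It is applied to gradient frames and to Killing fields.\<close>

lemma cov_comm:
  assumes x: "x \<in> U" and X: "smooth_vec_on U X" and Y: "smooth_vec_on U Y" and Z: "smooth_vec_on U Z"
  shows "cov g (X x) (\<lambda>y. cov g (Y y) Z y) x - cov g (Y x) (\<lambda>y. cov g (X y) Z y) x
     - cov g (lie_bracket X Y x) Z x = curv g (X x) (Y x) (Z x) x"
proof -
  have d: "(\<lambda>y. W y $ k) differentiable at x" if "smooth_vec_on U W" for W :: "real^'n \<Rightarrow> real^'n" and k
    using that x open_U by (auto simp: smooth_vec_on_def intro: smooth_on_imp_differentiable)
  have 1: "cov g v (\<lambda>y. cov g (Y y) Z y) x = (\<Sum>j\<in>UNIV. dirv v (\<lambda>y. Y y $ j) x *\<^sub>R cov g (axis j 1) Z x)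
      + (\<Sum>j\<in>UNIV. Y x $ j *\<^sub>R cov g v (cov g (axis j 1) Z) x)" if Y: "smooth_vec_on U Y" for v Y
  proof -
    have "cov g v (\<lambda>y. cov g (Y y) Z y) x = cov g v (\<lambda>y. \<Sum>j\<in>UNIV. Y y $ j *\<^sub>R cov g (axis j 1) Z y) x"
      by (simp only: cov_eq_sum_axis[symmetric])
    also have "\<dots> = (\<Sum>j\<in>UNIV. cov g v (\<lambda>y. Y y $ j *\<^sub>R cov g (axis j 1) Z y) x)"
      using d[OF Y] diff_at[OF x smooth_vec_cov_axis[OF Z]] by (intro cov_sum differentiable_scaleR) auto
    also have "\<dots> = (\<Sum>j\<in>UNIV. dirv v (\<lambda>y. Y y $ j) x *\<^sub>R cov g (axis j 1) Z x
      + Y x $ j *\<^sub>R cov g v (cov g (axis j 1) Z) x)"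
      using d[OF Y] diff_at[OF x smooth_vec_cov_axis[OF Z]] by (intro sum.cong refl cov_scale) auto
    finally show ?thesis by (simp add: sum.distrib)
  qed
  have 2: "(\<Sum>j\<in>UNIV. Y x $ j *\<^sub>R cov g (X x) (cov g (axis j 1) Z) x) =
      (\<Sum>i\<in>UNIV. \<Sum>j\<in>UNIV. (X x $ i * Y x $ j) *\<^sub>R cov g (axis i 1) (cov g (axis j 1) Z) x)" for X Y
    by (subst cov_eq_sum_axis[of g "X x"], subst sum.swap)
       (simp add: scaleR_sum_right mult.commute)
  have 3: "cov g (lie_bracket X Y x) Z x = (\<Sum>j\<in>UNIV. dirv (X x) (\<lambda>y. Y y $ j) x *\<^sub>R cov g (axis j 1) Z x)
     - (\<Sum>j\<in>UNIV. dirv (Y x) (\<lambda>y. X y $ j) x *\<^sub>R cov g (axis j 1) Z x)"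
    by (subst cov_eq_sum_axis) (simp add: lie_bracket_eq_dirv scaleR_diff_left sum_subtractf)
  have "cov g (X x) (\<lambda>y. cov g (Y y) Z y) x - cov g (Y x) (\<lambda>y. cov g (X y) Z y) x
     - cov g (lie_bracket X Y x) Z x =
     (\<Sum>i\<in>UNIV. \<Sum>j\<in>UNIV. (X x $ i * Y x $ j) *\<^sub>R cov g (axis i 1) (cov g (axis j 1) Z) x)
     - (\<Sum>i\<in>UNIV. \<Sum>j\<in>UNIV. (Y x $ i * X x $ j) *\<^sub>R cov g (axis i 1) (cov g (axis j 1) Z) x)"
    unfolding 1[OF X] 1[OF Y] 2 3 by simp
  also have "(\<Sum>i\<in>UNIV. \<Sum>j\<in>UNIV. (Y x $ i * X x $ j) *\<^sub>R cov g (axis i 1) (cov g (axis j 1) Z) x)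
     = (\<Sum>i\<in>UNIV. \<Sum>j\<in>UNIV. (X x $ i * Y x $ j) *\<^sub>R cov g (axis j 1) (cov g (axis i 1) Z) x)"
    by (subst sum.swap) (simp add: mult.commute)
  also have "(\<Sum>i\<in>UNIV. \<Sum>j\<in>UNIV. (X x $ i * Y x $ j) *\<^sub>R cov g (axis i 1) (cov g (axis j 1) Z) x) - \<dots>
     = (\<Sum>i\<in>UNIV. \<Sum>j\<in>UNIV. (X x $ i * Y x $ j) *\<^sub>R (\<Sum>k\<in>UNIV. Z x $ k *\<^sub>R (\<chi> l. curvature_up g i j k l x)))"
    by (simp only: sum_subtractf[symmetric] scaleR_diff_right[symmetric] cov_comm_axis[OF x Z])
  also have "\<dots> = curv g (X x) (Y x) (Z x) x"
    by (simp add: curv_def vec_eq_iff sum_distrib_left mult.assoc)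
  finally show ?thesis .
qed

text \<open>Constant fields have zero bracket, so on them the curvature is a plain commutator. The
  symmetries below are all derived in this form.\<close>

lemma curv_const:
  assumes x: "x \<in> U"
  shows "curv g v w z x = cov g v (cov g w (\<lambda>_. z)) x - cov g w (cov g v (\<lambda>_. z)) x"
  using cov_comm[OF x smooth_vec_intros(1)[OF open_U] smooth_vec_intros(1)[OF open_U]
      smooth_vec_intros(1)[OF open_U], of v w z] cov_linear(3)[of g 0 0] by simp

lemma smooth_vec_cov_const: "smooth_vec_on U (cov g v (\<lambda>_. z))"
  by (intro smooth_vec_cov smooth_vec_intros open_U)

lemma curv_skew: "x \<in> U \<Longrightarrow> curv g v w z x = - curv g w v z x"
  by (simp add: curv_const)

lemma Rm_skew12: "x \<in> U \<Longrightarrow> Rm g x v w z t = - Rm g x w v z t"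
  unfolding Rm_def by (subst curv_skew) (auto simp: bilin_simps)

text \<open>The second derivatives of the function \<open>inn y z t\<close> along \<open>v\<close>
  and \<open>w\<close> commute. Expanding both by metric compatibility, the products of first
  derivatives cancel, and what remains is the sum of the two curvature terms.\<close>

lemma Rm_skew34:
  assumes x: "x \<in> U"
  shows "Rm g x v w z t = - Rm g x v w t z"
proof -
  note dc = diff_at[OF _ smooth_vec_intros(1)[OF open_U]]
  note ds = diff_at[OF x smooth_vec_cov_const]
  have 1: "dirv v (dirv w (\<lambda>y. inn y z t)) x = inn x (cov g v (cov g w (\<lambda>_. z)) x) t
      + inn x (cov g w (\<lambda>_. z) x) (cov g v (\<lambda>_. t) x)
      + (inn x (cov g v (\<lambda>_. z) x) (cov g w (\<lambda>_. t) x) + inn x z (cov g v (cov g w (\<lambda>_. t)) x))" for v w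
  proof -
    have "dirv v (dirv w (\<lambda>y. inn y z t)) x = dirv v (\<lambda>y. inn y (cov g w (\<lambda>_. z) y) t + inn y z (cov g w (\<lambda>_. t) y)) x"
      by (rule dirv_cong[OF open_U x]) (simp add: dirv_inn dc)
    also have "\<dots> = dirv v (\<lambda>y. inn y (cov g w (\<lambda>_. z) y) t) x + dirv v (\<lambda>y. inn y z (cov g w (\<lambda>_. t) y)) x"
      by (rule dirv_add; rule smooth_on_imp_differentiable[OF smooth_inn open_U x])
         (intro smooth_vec_cov_const smooth_vec_intros open_U)+
    finally show ?thesis by (simp add: dirv_inn x ds)
  qed
  have "dirv v (dirv w (\<lambda>y. inn y z t)) x = dirv w (dirv v (\<lambda>y. inn y z t)) x"
    by (rule dirv_commute[OF open_U x]) (intro smooth_inn smooth_vec_intros open_U)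
  then have "inn x (curv g v w z x) t + inn x z (curv g v w t x) = 0"
    unfolding 1 by (simp add: curv_const[OF x] bilin_simps)
  then show ?thesis by (simp add: Rm_def inn_sym[OF x, of z])
qed

text \<open>For constant fields torsion-freeness gives \<open>cov g w z = cov g z w\<close>, so the
  six second derivatives in the cyclic sum cancel in pairs.\<close>

lemma curv_bianchi:
  assumes x: "x \<in> U"
  shows "curv g v w z x + curv g w z v x + curv g z v w x = 0"
proof -
  have "cov g v (cov g w (\<lambda>_. z)) x = cov g v (cov g z (\<lambda>_. w)) x" for v w z
    by (rule cov_cong[OF open_U x]) (rule cov_const_sym)
  from this[of v w z] this[of w z v] this[of z v w] show ?thesis
    by (simp add: curv_const[OF x])
qed

lemma Rm_bianchi: "x \<in> U \<Longrightarrow> Rm g x v w z t + Rm g x w z v t + Rm g x z v w t = 0"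
  using curv_bianchi[of x v w z] by (simp add: Rm_def bilin_simps flip: bilin_add(1))

text \<open>The classical octahedron argument: four instances of the Bianchi identity combined with
  the two skew symmetries.\<close>

lemma Rm_pair:
  assumes x: "x \<in> U"
  shows "Rm g x v w z t = Rm g x z t v w"
  using Rm_bianchi[OF x, of v w z t] Rm_bianchi[OF x, of w z t v] Rm_bianchi[OF x, of z t v w]
    Rm_bianchi[OF x, of t v w z] Rm_skew12[OF x] Rm_skew34[OF x]
  by (smt (verit))

section \<open>Gradients and Hessians\<close>

lemma inn_grad:
  assumes x: "x \<in> U"
  shows "inn x (grad g f x) w = dirv w f x"
proof -
  have "inn x (grad g f x) w = inn x w (grad g f x)" by (rule inn_sym[OF x])
  also have "\<dots> = w \<bullet> differential f x"
    by (simp add: bilin_def grad_def matrix_vector_mul_assoc ginv[OF x])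
  finally show ?thesis by (simp add: inner_vec_def differential_def dirv_def)
qed

lemma smooth_vec_grad: "smooth_on U f \<Longrightarrow> smooth_vec_on U (grad g f)"
  unfolding smooth_vec_on_def grad_def[abs_def] matrix_vector_mult_def differential_def
  by (simp, intro allI smooth_intros open_U smooth_ginv)

text \<open>The Hessian differs from the second derivative of \<open>f\<close> along constant fields
  by \<open>df\<close> of \<open>cov g v w\<close>; both are symmetric, the first by equality of
  mixed partials and the second by torsion-freeness.\<close>

lemma hess_sym:
  assumes x: "x \<in> U" and f: "smooth_on U f"
  shows "inn x (cov g v (grad g f) x) w = inn x (cov g w (grad g f) x) v"
proof -
  have 1: "dirv v (dirv w f) x = inn x (cov g v (grad g f) x) w + inn x (grad g f x) (cov g v (\<lambda>_. w) x)" for v w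
  proof -
    have "dirv v (dirv w f) x = dirv v (\<lambda>y. inn y (grad g f y) w) x"
      by (rule dirv_cong[OF open_U x]) (simp add: inn_grad)
    then show ?thesis
      by (simp add: dirv_inn[OF x diff_at[OF x smooth_vec_grad[OF f]] diff_at[OF x smooth_vec_intros(1)[OF open_U]]])
  qed
  show ?thesis
    using dirv_commute[OF open_U x f, of v w] cov_const_sym[OF x, of v w] unfolding 1 by simp
qed

text \<open>On a frame of gradients the Levi-Civita connection is determined by the Gram matrix alone, which
  is why it descends to quotients.\<close>

lemma koszul_grad:
  assumes x: "x \<in> U" and f: "smooth_on U f1" "smooth_on U f2" "smooth_on U f3"
  shows "2 * inn x (cov g (grad g f1 x) (grad g f2) x) (grad g f3 x) =
      dirv (grad g f1 x) (\<lambda>y. inn y (grad g f2 y) (grad g f3 y)) x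
    + dirv (grad g f3 x) (\<lambda>y. inn y (grad g f1 y) (grad g f2 y)) x
    - dirv (grad g f2 x) (\<lambda>y. inn y (grad g f1 y) (grad g f3 y)) x"
  using f[THEN smooth_vec_grad, THEN diff_at[OF x]] hess_sym[OF x] f
  by (simp add: dirv_inn[OF x] inn_sym[OF x, of "grad g _ x"])

end

text \<open>Structure functions of a frame \<open>E\<close>: \<open>H a m\<close> is the derivative
  of the coordinate \<open>F m\<close> along \<open>E a\<close>, and \<open>S a b d\<close> are the
  connection coefficients. The last product comes from the bracket of \<open>E a\<close> and
  \<open>E b\<close>, whose coefficients are \<open>S a b d - S b a d\<close>.\<close>

definition frame_curvature ::
  "('m \<Rightarrow> 'm \<Rightarrow> real^'m::finite \<Rightarrow> real) \<Rightarrow> ('m \<Rightarrow> 'm \<Rightarrow> 'm \<Rightarrow> real^'m \<Rightarrow> real) \<Rightarrow>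
    'm \<Rightarrow> 'm \<Rightarrow> 'm \<Rightarrow> 'm \<Rightarrow> real^'m \<Rightarrow> real" where
  "frame_curvature H S a b c e w =
     (\<Sum>m\<in>UNIV. H a m w * pd m (S b c e) w - H b m w * pd m (S a c e) w) +
     (\<Sum>d\<in>UNIV. S b c d w * S a d e w - S a c d w * S b d e w - (S a b d w - S b a d w) * S d c e w)"

text \<open>The Koszul formula of \<open>koszul_grad\<close> for the gradients of the components of
  a map \<open>F\<close>, with Gram matrix \<open>H\<close> and inverse Gram matrix
  \<open>h\<close>. A derivative along \<open>E a\<close> of a pulled-back function is the sum over
  \<open>m\<close> of \<open>H a m\<close> times its partial derivatives.\<close>

definition frame_connection ::
  "('m \<Rightarrow> 'm \<Rightarrow> real^'m::finite \<Rightarrow> real) \<Rightarrow> ('m \<Rightarrow> 'm \<Rightarrow> real^'m \<Rightarrow> real) \<Rightarrow>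
    'm \<Rightarrow> 'm \<Rightarrow> 'm \<Rightarrow> real^'m \<Rightarrow> real" where
  "frame_connection h H a b d w = (\<Sum>c\<in>UNIV. h d c w * (\<Sum>m\<in>UNIV.
     H a m w * pd m (H b c) w + H c m w * pd m (H a b) w - H b m w * pd m (H a c) w)) / 2"

section \<open>Connection and curvature of frames whose structure functions are pulled back along a
  map\<close>

context riemannian
begin

text \<open>The right-hand side sees the metric only through \<open>H\<close> and \<open>S\<close>.
  Two metrics that possess frames with the same structure functions thus have the same curvature
  coefficients, and this is how the base and the total space are compared.\<close>

lemma frame_curv:
  fixes F :: "real^'n \<Rightarrow> real^'m::finite"
  assumes x: "x \<in> U" and E: "\<And>a. smooth_vec_on U (E a)" and F: "smooth_vec_on U F"
    and S: "\<And>a b d. S a b d differentiable at (F x)"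
    and dF: "\<And>a m. dirv (E a x) (\<lambda>y. F y $ m) x = H a m (F x)"
    and cov: "\<And>y a b. y \<in> U \<Longrightarrow> cov g (E a y) (E b) y = (\<Sum>d\<in>UNIV. S a b d (F y) *\<^sub>R E d y)"
  shows "curv g (E a x) (E b x) (E c x) x = (\<Sum>e\<in>UNIV. frame_curvature H S a b c e (F x) *\<^sub>R E e x)"
proof -
  have dFx: "(\<lambda>y. F y $ m) differentiable at x" for m
    using F x open_U by (auto simp: smooth_vec_on_def intro: smooth_on_imp_differentiable)
  note SF = pd_compose(2)[of "S _ _ _", OF S dFx] and Ex = diff_at[OF x E]
  have 1: "cov g (E a x) (\<lambda>y. cov g (E b y) (E c) y) x =
      (\<Sum>e\<in>UNIV. (\<Sum>m\<in>UNIV. H a m (F x) * pd m (S b c e) (F x)) *\<^sub>R E e x) +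
      (\<Sum>e\<in>UNIV. (\<Sum>d\<in>UNIV. S b c d (F x) * S a d e (F x)) *\<^sub>R E e x)" for a b c
  proof -
    have "cov g (E a x) (\<lambda>y. cov g (E b y) (E c) y) x = cov g (E a x) (\<lambda>y. \<Sum>d\<in>UNIV. S b c d (F y) *\<^sub>R E d y) x"
      by (rule cov_cong[OF open_U x cov])
    also have "\<dots> = (\<Sum>d\<in>UNIV. dirv (E a x) (\<lambda>y. S b c d (F y)) x *\<^sub>R E d x + S b c d (F x) *\<^sub>R cov g (E a x) (E d) x)"
      by (subst cov_sum) (auto simp: cov_scale SF Ex intro!: differentiable_scaleR)
    also have "\<dots> = (\<Sum>d\<in>UNIV. (\<Sum>m\<in>UNIV. H a m (F x) * pd m (S b c d) (F x)) *\<^sub>R E d x) +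
        (\<Sum>d\<in>UNIV. \<Sum>e\<in>UNIV. (S b c d (F x) * S a d e (F x)) *\<^sub>R E e x)"
      by (simp add: sum.distrib dirv_compose[OF S dFx] dF cov[OF x] scaleR_sum_right mult.commute)
    also have "(\<Sum>d\<in>UNIV. \<Sum>e\<in>UNIV. (S b c d (F x) * S a d e (F x)) *\<^sub>R E e x) =
        (\<Sum>e\<in>UNIV. (\<Sum>d\<in>UNIV. S b c d (F x) * S a d e (F x)) *\<^sub>R E e x)"
      by (subst sum.swap) (simp add: scaleR_sum_left)
    finally show ?thesis .
  qed
  \<comment> \<open>Torsion-freeness supplies the bracket coefficients, so no assumption about
    brackets of the frame is required.\<close>
  have 2: "cov g (lie_bracket (E a) (E b) x) (E c) x =
     (\<Sum>e\<in>UNIV. (\<Sum>d\<in>UNIV. (S a b d (F x) - S b a d (F x)) * S d c e (F x)) *\<^sub>R E e x)"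
  proof -
    have "lie_bracket (E a) (E b) x = (\<Sum>d\<in>UNIV. (S a b d (F x) - S b a d (F x)) *\<^sub>R E d x)"
      by (simp add: cov_torsion_free[OF x, symmetric] cov[OF x] sum_subtractf scaleR_diff_left)
    then have "cov g (lie_bracket (E a) (E b) x) (E c) x =
       (\<Sum>d\<in>UNIV. \<Sum>e\<in>UNIV. ((S a b d (F x) - S b a d (F x)) * S d c e (F x)) *\<^sub>R E e x)"
      by (simp add: cov_sum_left cov_linear cov[OF x] scaleR_sum_right)
    also have "\<dots> = (\<Sum>e\<in>UNIV. (\<Sum>d\<in>UNIV. (S a b d (F x) - S b a d (F x)) * S d c e (F x)) *\<^sub>R E e x)"
      by (subst sum.swap) (simp add: scaleR_sum_left)
    finally show ?thesis .
  qed
  show ?thesis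
    unfolding cov_comm[OF x E E E, symmetric] 1 2 frame_curvature_def
    by (simp add: sum.distrib sum_subtractf scaleR_add_left scaleR_diff_left)
qed

text \<open>The gradients need not span: \<open>N\<close> collects vectors normal to the frame, to
  which \<open>cov g (E a x) (E b) x\<close> is assumed orthogonal, and \<open>full\<close> says
  that frame and normals together separate vectors. On the base \<open>N\<close> is empty; on the
  total space it consists of the Killing vectors.\<close>

lemma frame_cov:
  fixes F :: "real^'n \<Rightarrow> real^'m::finite" and H :: "'m \<Rightarrow> 'm \<Rightarrow> real^'m \<Rightarrow> real"
  defines "E \<equiv> \<lambda>a. grad g (\<lambda>y. F y $ a)"
  assumes x: "x \<in> U" and F: "smooth_vec_on U F"
    and H: "\<And>a b. H a b differentiable at (F x)"
    and EE: "\<And>y a b. y \<in> U \<Longrightarrow> inn y (E a y) (E b y) = H a b (F y)"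
    and h: "\<And>a b. (\<Sum>d\<in>UNIV. h d a (F x) * H d b (F x)) = (if a = b then 1 else 0)"
    and normal: "\<And>n d. n \<in> N \<Longrightarrow> inn x (E d x) n = 0" "\<And>n. n \<in> N \<Longrightarrow> inn x (cov g (E a x) (E b) x) n = 0"
    and full: "\<And>v. (\<And>c. inn x v (E c x) = 0) \<Longrightarrow> (\<And>n. n \<in> N \<Longrightarrow> inn x v n = 0) \<Longrightarrow> v = 0"
  shows "cov g (E a x) (E b) x = (\<Sum>d\<in>UNIV. frame_connection h H a b d (F x) *\<^sub>R E d x)"
proof -
  have Fs: "smooth_on U (\<lambda>y. F y $ m)" for m using F by (simp add: smooth_vec_on_def)
  have dFx: "(\<lambda>y. F y $ m) differentiable at x" for m
    using Fs x open_U by (auto intro: smooth_on_imp_differentiable)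
  let ?L = "\<lambda>a b c. (\<Sum>m\<in>UNIV. H a m (F x) * pd m (H b c) (F x) + H c m (F x) * pd m (H a b) (F x)
      - H b m (F x) * pd m (H a c) (F x))"
  have dEH: "dirv (E a x) (\<lambda>y. inn y (E b y) (E c y)) x = (\<Sum>m\<in>UNIV. H a m (F x) * pd m (H b c) (F x))" for a b c
  proof -
    have "dirv (E a x) (\<lambda>y. inn y (E b y) (E c y)) x = dirv (E a x) (\<lambda>y. H b c (F y)) x"
      by (rule dirv_cong[OF open_U x EE])
    also have "\<dots> = (\<Sum>m\<in>UNIV. pd m (H b c) (F x) * dirv (E a x) (\<lambda>y. F y $ m) x)"
      by (rule dirv_compose[OF H dFx])
    also have "\<dots> = (\<Sum>m\<in>UNIV. pd m (H b c) (F x) * inn x (E m x) (E a x))"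
      by (simp add: E_def inn_grad[OF x])
    also have "\<dots> = (\<Sum>m\<in>UNIV. H a m (F x) * pd m (H b c) (F x))"
    proof -
      have "inn x (E m x) (E a x) = H a m (F x)" for m by (subst inn_sym[OF x]) (rule EE[OF x])
      then show ?thesis by (simp add: mult.commute)
    qed
    finally show ?thesis .
  qed
  have L: "2 * inn x (cov g (E a x) (E b) x) (E c x) = ?L a b c" for c
    using koszul_grad[OF x Fs Fs Fs, of a b c]
    unfolding E_def[symmetric] dEH[unfolded E_def] by (simp add: E_def dEH[unfolded E_def] sum.distrib sum_subtractf)
  \<comment> \<open>The difference is tested against the frame, where the Koszul formula applies,
    and against the normals, where both terms vanish.\<close>
  have "cov g (E a x) (E b) x - (\<Sum>d\<in>UNIV. frame_connection h H a b d (F x) *\<^sub>R E d x) = 0"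
  proof (rule full)
    fix e
    have "(\<Sum>d\<in>UNIV. frame_connection h H a b d (F x) * H d e (F x)) =
        (\<Sum>d\<in>UNIV. \<Sum>c\<in>UNIV. h d c (F x) * H d e (F x) * ?L a b c) / 2"
      by (simp add: frame_connection_def sum_distrib_right sum_distrib_left sum_divide_distrib mult_ac)
    also have "\<dots> = (\<Sum>c\<in>UNIV. (\<Sum>d\<in>UNIV. h d c (F x) * H d e (F x)) * ?L a b c) / 2"
      by (subst sum.swap) (simp only: sum_distrib_right)
    also have "\<dots> = ?L a b e / 2"
      by (simp add: h if_distrib if_distribR cong: if_cong)
    finally have "(\<Sum>d\<in>UNIV. frame_connection h H a b d (F x) * H d e (F x)) = ?L a b e / 2" .
    then show "inn x (cov g (E a x) (E b) x - (\<Sum>d\<in>UNIV. frame_connection h H a b d (F x) *\<^sub>R E d x)) (E e x) = 0"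
      using L[of e] by (simp add: bilin_simps EE[OF x])
  next
    fix n assume "n \<in> N"
    then show "inn x (cov g (E a x) (E b) x - (\<Sum>d\<in>UNIV. frame_connection h H a b d (F x) *\<^sub>R E d x)) n = 0"
      using normal by (simp add: bilin_simps)
  qed
  then show ?thesis by simp
qed

end

lemma Rm_dim2:
  fixes h :: "real^2 \<Rightarrow> real^2^2"
  assumes "riemannian W h" "w \<in> W"
  shows "Rm h w p q q p = (p $ 1 * q $ 2 - p $ 2 * q $ 1)\<^sup>2 * riemann h 1 2 2 1 w"
proof -
  interpret riemannian W h by fact
  have 12: "riemann h i j k l w = - riemann h j i k l w" for i j k l
    unfolding Rm_axis[OF assms(2), symmetric] by (rule Rm_skew12[OF assms(2)])
  have 34: "riemann h i j k l w = - riemann h i j l k w" for i j k l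
    unfolding Rm_axis[OF assms(2), symmetric] by (rule Rm_skew34[OF assms(2)])
  have s: "riemann h i i k l w = 0" "riemann h i j k k w = 0" "riemann h 2 1 k l w = - riemann h 1 2 k l w"
    "riemann h 1 2 1 2 w = - riemann h 1 2 2 1 w" for i j k l
    using 12[of i i k l] 34[of i j k k] 12[of 2 1 k l] 34[of 1 2 1 2] by simp_all
  show ?thesis
    unfolding Rm_sum[OF assms(2)] sum_2 s
    by (simp add: power2_eq_square algebra_simps)
qed

text \<open>The base is treated as a quotient of itself: \<open>F\<close> is the identity, the frame
  consists of the coordinate gradients, and there are no normals. The curvature coefficients are
  thereby tied to the Gaussian curvature of \<open>h\<close>.\<close>

lemma frame_gauss_curvature:
  fixes h :: "real^2 \<Rightarrow> real^2^2"
  defines "H \<equiv> \<lambda>a b w. matrix_inv (h w) $ a $ b"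
  defines "S \<equiv> frame_connection (\<lambda>a b w. h w $ a $ b) H"
  assumes h: "riemannian W h" and w: "w \<in> W"
  shows "(\<Sum>e\<in>UNIV. frame_curvature H S 1 2 2 e w * H e 1 w) =
      gauss_curvature h w * (H 1 1 w * H 2 2 w - H 1 2 w * H 1 2 w)" (is ?P1)
    and "S a b d differentiable at w"
proof -
  interpret riemannian W h by fact
  define E where "E a = grad h (\<lambda>y. y $ a)" for a :: 2
  have Hs: "smooth_on W (H a b)" for a b using smooth_ginv by (simp add: H_def)
  have Ss: "smooth_on W (S a b d)" for a b d
    unfolding S_def frame_connection_def[abs_def]
    by (intro smooth_intros smooth_on_divide open_U Hs smooth_g) auto
  then show "S a b d differentiable at w"
    using open_U w by (auto intro: smooth_on_imp_differentiable)
  have sid: "smooth_vec_on W (\<lambda>y::real^2. y)" by (simp add: smooth_vec_on_def smooth_on_nth)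
  have dnth: "dirv v (\<lambda>y. y $ a) y = v $ a" for v a and y :: "real^2"
    by (simp add: dirv_def if_distrib cong: if_cong)
  have Hsym: "H a b y = H b a y" if "y \<in> W" for a b y
  proof -
    have "transpose (matrix_inv (h y)) = matrix_inv (h y)"
    proof -
      have "transpose (h y) = h y" using that metric by (simp add: riemannian_metric_on_def)
      then have "transpose (matrix_inv (h y)) ** h y = mat 1"
        using arg_cong[OF ginv(1)[OF that], of transpose] by (simp add: matrix_transpose_mul transpose_mat)
      then have "transpose (matrix_inv (h y)) ** h y ** matrix_inv (h y) = matrix_inv (h y)" by simp
      then show ?thesis by (simp add: matrix_mul_assoc[symmetric] ginv[OF that])
    qed
    then show ?thesis unfolding H_def by (simp add: transpose_def vec_eq_iff)
  qed
  have E_nth: "E a y $ b = H b a y" if "y \<in> W" for a b y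
    by (simp add: E_def grad_def H_def matrix_vector_mult_def differential_def if_distrib cong: if_cong)
  have EE: "inn y (E a y) (E b y) = H a b y" if "y \<in> W" for y a b
    by (simp add: E_def inn_grad[OF that] dnth) (simp add: flip: E_def, simp add: E_nth that)
  have hH: "(\<Sum>d\<in>UNIV. h y $ d $ a * H d b y) = (if a = b then 1 else 0)" if "y \<in> W" for y a b
  proof -
    have "(h y ** matrix_inv (h y)) $ a $ b = (if a = b then 1 else 0)"
      by (simp add: ginv[OF that] mat_def)
    then show ?thesis by (simp add: matrix_matrix_mult_def H_def g_sym[OF that, of _ a])
  qed
  have covE: "cov h (E a y) (E b) y = (\<Sum>d\<in>UNIV. S a b d y *\<^sub>R E d y)" if "y \<in> W" for y a b
    unfolding S_def E_def
  proof (rule frame_cov[where N = "{}", OF that sid])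
    show "H a b differentiable at y" for a b
      using Hs open_U that by (auto intro: smooth_on_imp_differentiable)
    show "inn y (grad h (\<lambda>y. y $ a) y) (grad h (\<lambda>y. y $ b) y) = H a b y" if "y \<in> W" for y a b
      using EE[OF that] by (simp add: E_def)
    show "(\<Sum>d\<in>UNIV. h y $ d $ a * H d b y) = (if a = b then 1 else 0)" for a b
      by (rule hH[OF that])
    show "v = 0" if v: "\<And>c. inn y v (grad h (\<lambda>y. y $ c) y) = 0" for v
      using v \<open>y \<in> W\<close> by (simp add: inn_sym[of y v] inn_grad dnth vec_eq_iff)
  qed auto
  have "curv h (E 1 w) (E 2 w) (E 2 w) w = (\<Sum>e\<in>UNIV. frame_curvature H S 1 2 2 e w *\<^sub>R E e w)"
    by (rule frame_curv[OF w _ sid _ _ covE])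
       (use \<open>\<And>a b d. smooth_on W (S a b d)\<close> open_U w in \<open>auto simp: dnth E_nth E_def intro!: smooth_vec_grad smooth_on_nth intro: smooth_on_imp_differentiable\<close>,
        simp add: flip: E_def, simp add: E_nth w Hsym[OF w])
  then have "(\<Sum>e\<in>UNIV. frame_curvature H S 1 2 2 e w * H e 1 w) = Rm h w (E 1 w) (E 2 w) (E 2 w) (E 1 w)"
    by (simp add: Rm_def bilin_simps EE[OF w])
  also have "\<dots> = (H 1 1 w * H 2 2 w - H 2 1 w * H 1 2 w)\<^sup>2 * riemann h 1 2 2 1 w"
    by (simp add: Rm_dim2[OF h w] E_nth[OF w])
  \<comment> \<open>The components of \<open>E a\<close> are entries of the inverse metric, so
    \<open>Rm_dim2\<close> produces the squared determinant of the inverse; one factor is cancelled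
    by the determinant of \<open>h\<close> in the definition of the Gaussian curvature.\<close>
  also have "\<dots> = gauss_curvature h w * (H 1 1 w * H 2 2 w - H 1 2 w * H 1 2 w)"
  proof -
    have "det (h w) * det (matrix_inv (h w)) = 1"
      by (simp add: ginv[OF w] flip: det_mul)
    then have d: "(h w $ 1 $ 1 * h w $ 2 $ 2 - h w $ 1 $ 2 * h w $ 1 $ 2) * (H 1 1 w * H 2 2 w - H 1 2 w * H 1 2 w) = 1"
      by (simp add: det_2 H_def Hsym[OF w, of 2 1, unfolded H_def] g_sym[OF w, of 2 1])
    have "gauss_curvature h w = riemann h 1 2 2 1 w * (H 1 1 w * H 2 2 w - H 1 2 w * H 1 2 w)"
      using inverse_unique[OF d] by (simp add: gauss_curvature_def divide_inverse)
    then show ?thesis by (simp add: power2_eq_square Hsym[OF w, of 2 1])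
  qed
  finally show ?P1 .
qed

lemma inner_transpose_mult:
  fixes A :: "real^'n::finite^'m::finite"
  shows "v \<bullet> (transpose A *v y) = (A *v v) \<bullet> y"
  by (metis dot_lmul_matrix inner_commute transpose_matrix_vector)

section \<open>Kaehler metrics\<close>

locale kahler = riemannian U g for U :: "(real^'n::finite) set" and g +
  fixes J :: "real^'n \<Rightarrow> real^'n^'n"
  assumes kahler: "kahler_on U g J"
begin

lemma J_J: "x \<in> U \<Longrightarrow> J x *v (J x *v v) = - v"
proof -
  assume "x \<in> U"
  then have "J x ** J x = - mat 1" using kahler by (simp add: kahler_on_def)
  moreover have "(- mat 1) *v v = - v"
    by (simp add: matrix_vector_mult_def mat_def vec_eq_iff if_distrib if_distribR sum_negf cong: if_cong)
  ultimately show ?thesis by (simp add: matrix_vector_mul_assoc)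
qed

lemma inn_J_J: "x \<in> U \<Longrightarrow> inn x (J x *v v) (J x *v w) = inn x v w"
proof -
  assume "x \<in> U"
  then have "transpose (J x) ** g x ** J x = g x" using kahler by (simp add: kahler_on_def)
  then have "inn x v w = v \<bullet> (transpose (J x) *v (g x *v (J x *v w)))"
    by (simp add: bilin_def matrix_vector_mul_assoc matrix_mul_assoc)
  also have "\<dots> = inn x (J x *v v) (J x *v w)"
    unfolding inner_transpose_mult bilin_def ..
  finally show ?thesis by simp
qed

lemma inn_J: "x \<in> U \<Longrightarrow> inn x (J x *v v) w = - inn x v (J x *v w)"
  using inn_J_J[of x v "J x *v w"] J_J[of x w] by (simp add: bilin_simps)

lemma smooth_J: "smooth_on U (\<lambda>x. J x $ i $ j)"
  using kahler by (auto simp: kahler_on_def smooth_mat_on_def)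

lemma smooth_vec_J: "smooth_vec_on U Y \<Longrightarrow> smooth_vec_on U (\<lambda>x. J x *v Y x)"
  by (intro smooth_vec_intros open_U) (simp_all add: smooth_mat_on_def smooth_J)

lemma pd_J: "x \<in> U \<Longrightarrow> pd i (\<lambda>y. J y $ k $ j) x =
    (\<Sum>m\<in>UNIV. christoffel g m i j x * J x $ k $ m) - (\<Sum>m\<in>UNIV. christoffel g k i m x * J x $ m $ j)"
proof -
  assume "x \<in> U"
  then have "cov_deriv_endo g J i x $ k $ j = 0" using kahler by (simp add: kahler_on_def)
  then show ?thesis by (simp add: cov_deriv_endo_def sum_subtractf)
qed

lemma cov_J:
  assumes x: "x \<in> U" and Y: "Y differentiable at x"
  shows "cov g v (\<lambda>y. J y *v Y y) x = J x *v cov g v Y x"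
proof -
  note d = differentiable_vec_nth[OF Y] smooth_on_imp_differentiable[OF smooth_J open_U x]
  have 1: "cov g (axis i 1) (\<lambda>y. J y *v Y y) x = J x *v cov g (axis i 1) Y x" for i
  proof (rule vec_eq_iff[THEN iffD2], rule allI)
    fix k
    have "pd i (\<lambda>y. (J y *v Y y) $ k) x = (\<Sum>j\<in>UNIV. pd i (\<lambda>y. J y $ k $ j) x * Y x $ j + J x $ k $ j * pd i (\<lambda>y. Y y $ j) x)"
      by (simp add: matrix_vector_mult_def pd_sum pd_mult d)
    also have "\<dots> = (\<Sum>j\<in>UNIV. \<Sum>m\<in>UNIV. christoffel g m i j x * J x $ k $ m * Y x $ j)
       - (\<Sum>j\<in>UNIV. \<Sum>m\<in>UNIV. christoffel g k i m x * J x $ m $ j * Y x $ j)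
       + (\<Sum>j\<in>UNIV. J x $ k $ j * pd i (\<lambda>y. Y y $ j) x)"
      by (simp add: pd_J[OF x] left_diff_distrib sum.distrib sum_subtractf sum_distrib_right)
    also have "(\<Sum>j\<in>UNIV. \<Sum>m\<in>UNIV. christoffel g k i m x * J x $ m $ j * Y x $ j) =
       (\<Sum>m\<in>UNIV. christoffel g k i m x * (J x *v Y x) $ m)"
      by (subst sum.swap) (simp add: matrix_vector_mult_def sum_distrib_left mult.assoc)
    also have "(\<Sum>j\<in>UNIV. \<Sum>m\<in>UNIV. christoffel g m i j x * J x $ k $ m * Y x $ j) =
       (\<Sum>m\<in>UNIV. J x $ k $ m * (\<Sum>j\<in>UNIV. christoffel g m i j x * Y x $ j))"
      by (subst sum.swap) (simp add: sum_distrib_left mult_ac)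
    finally show "cov g (axis i 1) (\<lambda>y. J y *v Y y) x $ k = (J x *v cov g (axis i 1) Y x) $ k"
      by (simp add: cov_axis_nth matrix_vector_mult_def distrib_left sum.distrib)
  qed
  show ?thesis
    by (subst (1 2) cov_eq_sum_axis)
       (simp add: 1 linear_sum[OF matrix_vector_mul_linear] matrix_vector_mult_scaleR)
qed

text \<open>A parallel \<open>J\<close> passes through both covariant derivatives of a constant
  field and hence through their commutator.\<close>

lemma curv_J:
  assumes x: "x \<in> U"
  shows "curv g v w (J x *v z) x = J x *v curv g v w z x"
proof -
  note c = smooth_vec_intros(1)[OF open_U]
  have 1: "cov g v (cov g w (\<lambda>y. J y *v z)) x = J x *v cov g v (cov g w (\<lambda>_. z)) x" for v w
  proof -
    have "cov g v (cov g w (\<lambda>y. J y *v z)) x = cov g v (\<lambda>y. J y *v cov g w (\<lambda>_. z) y) x"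
      by (rule cov_cong[OF open_U x]) (rule cov_J, auto)
    then show ?thesis by (simp add: cov_J[OF x diff_at[OF x smooth_vec_cov_const]])
  qed
  show ?thesis
    using cov_comm[OF x c c smooth_vec_J[OF c], of v w z] cov_linear(3)[of g 0 0]
    by (simp add: 1 curv_const[OF x] matrix_vector_mult_diff_distrib)
qed

lemma Rm_J34: "x \<in> U \<Longrightarrow> Rm g x v w (J x *v z) (J x *v t) = Rm g x v w z t"
  by (simp add: Rm_def curv_J inn_J_J)

lemma Rm_J12: "x \<in> U \<Longrightarrow> Rm g x (J x *v v) (J x *v w) z t = Rm g x v w z t"
  using Rm_J34[of x z t v w] Rm_pair[of x] by simp

end

section \<open>Local geometry of toric Kaehler surfaces\<close>

context riemannian
begin

lemma inn_eq_0D: "x \<in> U \<Longrightarrow> inn x v v = 0 \<Longrightarrow> v = 0"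
  using inn_pos by (metis less_irrefl)

text \<open>Evaluated on constant fields, the Lie derivative of \<open>g\<close> is a derivative of
  \<open>inn y v w\<close> along \<open>X\<close> plus coordinate derivatives of \<open>X\<close>.
  Metric compatibility and torsion-freeness turn this into the symmetrized covariant derivative of
  \<open>X\<close>.\<close>

lemma killing:
  assumes x: "x \<in> U" and X: "smooth_vec_on U X" and lie: "lie_cov2 X g x = 0"
  shows "inn x (cov g v X x) w = - inn x v (cov g w X x)"
proof -
  have dX: "dirv u (\<lambda>y. X y $ m) x = (\<Sum>i\<in>UNIV. u $ i * pd i (\<lambda>y. X y $ m) x)" for u m
    by (simp add: dirv_def)
  note dc = diff_at[OF x smooth_vec_intros(1)[OF open_U]]
  have "0 = (\<Sum>i\<in>UNIV. \<Sum>j\<in>UNIV. v $ i * w $ j * lie_cov2 X g x $ i $ j)" by (simp add: lie)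
  also have "\<dots> = (\<Sum>i\<in>UNIV. \<Sum>j\<in>UNIV. \<Sum>m\<in>UNIV. v $ i * w $ j * (X x $ m * pd m (\<lambda>y. g y $ i $ j) x))
     + ((\<Sum>i\<in>UNIV. \<Sum>j\<in>UNIV. \<Sum>m\<in>UNIV. v $ i * w $ j * (g x $ m $ j * pd i (\<lambda>y. X y $ m) x))
     + (\<Sum>i\<in>UNIV. \<Sum>j\<in>UNIV. \<Sum>m\<in>UNIV. v $ i * w $ j * (g x $ i $ m * pd j (\<lambda>y. X y $ m) x)))"
    by (simp add: lie_cov2_def sum.distrib sum_distrib_left distrib_left add.assoc)
  also have "(\<Sum>i\<in>UNIV. \<Sum>j\<in>UNIV. \<Sum>m\<in>UNIV. v $ i * w $ j * (X x $ m * pd m (\<lambda>y. g y $ i $ j) x))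
      = dirv (X x) (\<lambda>y. inn y v w) x"
  proof -
    have "dirv (X x) (\<lambda>y. inn y v w) x = (\<Sum>i\<in>UNIV. \<Sum>j\<in>UNIV. dirv (X x) (\<lambda>y. v $ i * g y $ i $ j * w $ j) x)"
      unfolding bilin_sum_def using smooth_on_imp_differentiable[OF smooth_g open_U x]
      by (subst dirv_sum; (subst dirv_sum)?) (auto intro!: differentiable_sum differentiable_mult)
    also have "\<dots> = (\<Sum>i\<in>UNIV. \<Sum>j\<in>UNIV. \<Sum>m\<in>UNIV. v $ i * w $ j * (X x $ m * pd m (\<lambda>y. g y $ i $ j) x))"
      using smooth_on_imp_differentiable[OF smooth_g open_U x]
      by (simp add: dirv_mult differentiable_mult) (simp add: dirv_def sum_distrib_left sum_distrib_right mult_ac)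
    finally show ?thesis by simp
  qed
  also have "(\<Sum>i\<in>UNIV. \<Sum>j\<in>UNIV. \<Sum>m\<in>UNIV. v $ i * w $ j * (g x $ m $ j * pd i (\<lambda>y. X y $ m) x))
      = inn x (\<chi> m. dirv v (\<lambda>y. X y $ m) x) w"
    by (subst sum_reverse3) (simp add: bilin_sum_def dX sum_distrib_left sum_distrib_right mult_ac)
  also have "(\<Sum>i\<in>UNIV. \<Sum>j\<in>UNIV. \<Sum>m\<in>UNIV. v $ i * w $ j * (g x $ i $ m * pd j (\<lambda>y. X y $ m) x))
      = inn x v (\<chi> m. dirv w (\<lambda>y. X y $ m) x)"
    by (rule trans[OF sum.cong[OF refl sum.swap]]) (simp add: bilin_sum_def dX sum_distrib_left sum_distrib_right mult_ac)
  also have "dirv (X x) (\<lambda>y. inn y v w) x = inn x (cov g (X x) (\<lambda>_. v) x) w + inn x v (cov g (X x) (\<lambda>_. w) x)"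
    by (rule dirv_inn[OF x dc dc])
  finally have "inn x (cov g (X x) (\<lambda>_. v) x) w + inn x v (cov g (X x) (\<lambda>_. w) x)
    + (inn x (\<chi> m. dirv v (\<lambda>y. X y $ m) x) w + inn x v (\<chi> m. dirv w (\<lambda>y. X y $ m) x)) = 0" by simp
  \<comment> \<open>The coordinate derivative of \<open>X\<close> along \<open>v\<close> is the
    bracket of the constant field \<open>v\<close> with \<open>X\<close>.\<close>
  moreover have "(\<chi> m. dirv v (\<lambda>y. X y $ m) x) = cov g v X x - cov g (X x) (\<lambda>_. v) x" for v
    using cov_torsion_free[OF x, of "\<lambda>_. v" X] by (simp add: vec_eq_iff lie_bracket_eq_dirv)
  ultimately show ?thesis by (simp add: bilin_simps)
qed

text \<open>An isometric flow that preserves \<open>f\<close> preserves its gradient. Here: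
  differentiate the identity \<open>inn y (grad g f y) (X y) = 0\<close> and use symmetry of the
  Hessian and skew-symmetry of the derivative of \<open>X\<close>.\<close>

lemma killing_grad_commute:
  assumes x: "x \<in> U" and X: "smooth_vec_on U X" and lie: "lie_cov2 X g x = 0"
    and f: "smooth_on U f" and inv: "\<And>y. y \<in> U \<Longrightarrow> dirv (X y) f y = 0"
  shows "cov g (X x) (grad g f) x = cov g (grad g f x) X x"
proof (rule inn_eqI[OF x])
  fix w
  have "0 = dirv w (\<lambda>y. inn y (grad g f y) (X y)) x"
  proof -
    have "dirv w (\<lambda>y. inn y (grad g f y) (X y)) x = dirv w (\<lambda>y. 0) x"
      by (rule dirv_cong[OF open_U x]) (simp add: inn_grad inv)
    then show ?thesis by simp
  qed
  also have "\<dots> = inn x (cov g w (grad g f) x) (X x) + inn x (grad g f x) (cov g w X x)"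
    by (rule dirv_inn[OF x diff_at[OF x smooth_vec_grad[OF f]] diff_at[OF x X]])
  finally show "inn x (cov g (X x) (grad g f) x) w = inn x (cov g (grad g f x) X x) w"
    using hess_sym[OF x f, of "X x" w] killing[OF x X lie, of "grad g f x" w] by simp
qed

end

section \<open>Horizontal and vertical directions on the regular set\<close>

locale toric_local = kahler U g J for U :: "(real^4) set" and g J +
  fixes X :: "2 \<Rightarrow> real^4 \<Rightarrow> real^4" and \<phi> :: "2 \<Rightarrow> real^4 \<Rightarrow> real"
  assumes smooth_X: "smooth_vec_on U (X i)" and smooth_\<phi>: "smooth_on U (\<phi> i)"
    and lie_X: "x \<in> U \<Longrightarrow> lie_cov2 (X i) g x = 0"
    and X_eq: "x \<in> U \<Longrightarrow> X i x = J x *v grad g (\<phi> i) x"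
    and bracket: "x \<in> U \<Longrightarrow> lie_bracket (grad g (\<phi> 1)) (grad g (\<phi> 2)) x = 0"
    and inv_\<phi>: "x \<in> U \<Longrightarrow> dirv (X j x) (\<phi> i) x = 0"
    and indep: "x \<in> U \<Longrightarrow> a *\<^sub>R X 1 x + b *\<^sub>R X 2 x = 0 \<Longrightarrow> a = 0 \<and> b = 0"
begin

text \<open>Two independent pairs that are orthogonal to each other give four independent vectors,
  so the map of coefficients is injective and therefore onto.\<close>

lemma span_four:
  fixes a1 a2 b1 b2 :: "real^4"
  assumes x: "x \<in> U"
    and ab: "inn x a1 b1 = 0" "inn x a1 b2 = 0" "inn x a2 b1 = 0" "inn x a2 b2 = 0"
    and a: "\<And>s t. s *\<^sub>R a1 + t *\<^sub>R a2 = 0 \<Longrightarrow> s = 0 \<and> t = 0"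
    and b: "\<And>s t. s *\<^sub>R b1 + t *\<^sub>R b2 = 0 \<Longrightarrow> s = 0 \<and> t = 0"
  obtains s t s' t' where "v = s *\<^sub>R a1 + t *\<^sub>R a2 + (s' *\<^sub>R b1 + t' *\<^sub>R b2)"
proof -
  define f :: "real^4 \<Rightarrow> real^4" where
    "f c = c $ 1 *\<^sub>R a1 + c $ 2 *\<^sub>R a2 + (c $ 3 *\<^sub>R b1 + c $ 4 *\<^sub>R b2)" for c
  have l: "linear f"
    by (rule linearI) (simp_all add: f_def algebra_simps)
  have "c = 0" if "f c = 0" for c
  proof -
    let ?P = "c $ 1 *\<^sub>R a1 + c $ 2 *\<^sub>R a2" and ?Q = "c $ 3 *\<^sub>R b1 + c $ 4 *\<^sub>R b2"
    have "inn x ?P ?Q = 0" using ab by (simp add: bilin_simps)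
    moreover have PQ: "?Q = - ?P" using that unfolding f_def by (metis add.commute eq_neg_iff_add_eq_0)
    ultimately have "inn x ?P ?P = 0" unfolding PQ by (simp only: bilin_minus neg_equal_0_iff_equal)
    then have "?P = 0" by (rule inn_eq_0D[OF x])
    then have "c $ 1 = 0 \<and> c $ 2 = 0" "c $ 3 = 0 \<and> c $ 4 = 0"
      using PQ a b by (metis neg_equal_0_iff_equal)+
    then show ?thesis by (simp add: vec_eq_iff forall_4)
  qed
  then have "inj f" using linear_injective_0[OF l] by blast
  then have "surj f"
    using l linear_injective_imp_surjective by blast
  then obtain c where "f c = v" by (metis surjD)
  then show ?thesis using that by (auto simp: f_def)
qed

abbreviation V where "V i \<equiv> grad g (\<phi> i)"

definition hor where "hor x v \<longleftrightarrow> (\<forall>i. inn x v (X i x) = 0)"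

lemma smooth_V: "smooth_vec_on U (V i)"
  by (rule smooth_vec_grad[OF smooth_\<phi>])

lemma inn_V_X: "x \<in> U \<Longrightarrow> inn x (V i x) (X j x) = 0"
  by (simp add: inn_grad inv_\<phi>)

lemma hor_V: "x \<in> U \<Longrightarrow> hor x (V i x)"
  by (simp add: hor_def inn_V_X)

lemma hor_lin: "hor x v \<Longrightarrow> hor x w \<Longrightarrow> hor x (v + w)" "hor x v \<Longrightarrow> hor x (c *\<^sub>R v)"
  "hor x v \<Longrightarrow> hor x w \<Longrightarrow> hor x (v - w)"
  by (simp_all add: hor_def bilin_simps)

lemma indep_V: "x \<in> U \<Longrightarrow> s *\<^sub>R V 1 x + t *\<^sub>R V 2 x = 0 \<Longrightarrow> s = 0 \<and> t = 0"
proof -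
  assume x: "x \<in> U" and "s *\<^sub>R V 1 x + t *\<^sub>R V 2 x = 0"
  then have "J x *v (s *\<^sub>R V 1 x + t *\<^sub>R V 2 x) = 0" by simp
  then have "s *\<^sub>R X 1 x + t *\<^sub>R X 2 x = 0"
    by (simp add: X_eq[OF x] matrix_vector_right_distrib matrix_vector_mult_scaleR)
  then show ?thesis using indep[OF x] by blast
qed

text \<open>Expanding \<open>v\<close> by \<open>span_four\<close>, the part along the Killing
  vectors is orthogonal to all of them, hence to itself.\<close>

lemma hor_span:
  assumes x: "x \<in> U" and v: "hor x v" and ab: "hor x a1" "hor x a2"
    and a: "\<And>s t. s *\<^sub>R a1 + t *\<^sub>R a2 = 0 \<Longrightarrow> s = 0 \<and> t = 0"
  obtains s t where "v = s *\<^sub>R a1 + t *\<^sub>R a2"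
proof -
  obtain s t s' t' where v': "v = s *\<^sub>R a1 + t *\<^sub>R a2 + (s' *\<^sub>R X 1 x + t' *\<^sub>R X 2 x)"
    by (rule span_four[OF x, of a1 "X 1 x" "X 2 x" a2])
       (use ab a indep[OF x] in \<open>auto simp: hor_def\<close>)
  let ?Q = "s' *\<^sub>R X 1 x + t' *\<^sub>R X 2 x"
  have "hor x (v - (s *\<^sub>R a1 + t *\<^sub>R a2))" by (intro hor_lin v ab)
  then have "hor x ?Q" using v' by simp
  then have "inn x ?Q ?Q = 0" by (simp add: hor_def bilin_add(2) bilin_scale(2))
  then have "?Q = 0" by (rule inn_eq_0D[OF x])
  then show ?thesis using that v' by simp
qed

lemma hor_full:
  assumes x: "x \<in> U" and ab: "hor x a1" "hor x a2"
    and a: "\<And>s t. s *\<^sub>R a1 + t *\<^sub>R a2 = 0 \<Longrightarrow> s = 0 \<and> t = 0"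
    and v: "hor x v" "inn x v a1 = 0" "inn x v a2 = 0"
  shows "v = 0"
proof -
  obtain s t where st: "v = s *\<^sub>R a1 + t *\<^sub>R a2" by (rule hor_span[OF x v(1) ab a])
  have "inn x v v = s * inn x v a1 + t * inn x v a2"
    by (subst (2) st) (simp add: bilin_simps)
  then show ?thesis using v by (intro inn_eq_0D[OF x]) simp
qed

text \<open>The horizontal planes are Lagrangian: they are spanned by the gradients
  \<open>V i\<close>, and \<open>J\<close> sends these to the Killing vectors.\<close>

lemma hor_J: "x \<in> U \<Longrightarrow> hor x v \<Longrightarrow> hor x w \<Longrightarrow> inn x v (J x *v w) = 0"
proof -
  assume x: "x \<in> U" and v: "hor x v" and w: "hor x w"
  obtain s t where "w = s *\<^sub>R V 1 x + t *\<^sub>R V 2 x"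
    by (rule hor_span[OF x w hor_V[OF x] hor_V[OF x] indep_V[OF x]])
  then show ?thesis
    using v by (simp add: hor_def matrix_vector_right_distrib matrix_vector_mult_scaleR X_eq[OF x, symmetric] bilin_simps)
qed

text \<open>Integrability of the horizontal distribution, in the form that the second fundamental form of
  its leaves vanishes.\<close>

lemma cov_X_hor:
  assumes x: "x \<in> U" and v: "hor x v" and w: "hor x w"
  shows "inn x (cov g v (X i) x) w = 0"
proof -
  let ?\<tau> = "\<lambda>v w. inn x (cov g v (X i) x) w"
  have skew: "?\<tau> v w = - ?\<tau> w v" for v w
    using killing[OF x smooth_X lie_X[OF x], of v i w] inn_sym[OF x] by simp
  have 1: "?\<tau> (V a x) (V b x) = - inn x (X i x) (cov g (V a x) (V b) x)" for a b
  proof -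
    have "dirv (V a x) (\<lambda>y. inn y (X i y) (V b y)) x = dirv (V a x) (\<lambda>y. 0) x"
      by (rule dirv_cong[OF open_U x]) (simp add: inn_sym[of _ "X i _"] inn_V_X)
    then show ?thesis
      by (simp add: dirv_inn[OF x diff_at[OF x smooth_X] diff_at[OF x smooth_V]])
  qed
  \<comment> \<open>The form \<open>?\<tau>\<close> is skew by the Killing equation, while its
    antisymmetrization on the gradients is their bracket paired with \<open>X i\<close>, which
    vanishes. In a two-dimensional plane this leaves nothing.\<close>
  have "?\<tau> (V 1 x) (V 2 x) - ?\<tau> (V 2 x) (V 1 x) = - inn x (X i x) (lie_bracket (V 1) (V 2) x)"
    unfolding 1 cov_torsion_free[OF x, symmetric] by (simp add: bilin_simps)
  then have 12: "?\<tau> (V 1 x) (V 2 x) = 0"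
    using skew[of "V 1 x" "V 2 x"] by (simp add: bracket[OF x] bilin_simps)
  have "?\<tau> v v = 0" for v using skew[of v v] by simp
  moreover obtain s t where "v = s *\<^sub>R V 1 x + t *\<^sub>R V 2 x"
    by (rule hor_span[OF x v hor_V[OF x] hor_V[OF x] indep_V[OF x]])
  moreover obtain s' t' where "w = s' *\<^sub>R V 1 x + t' *\<^sub>R V 2 x"
    by (rule hor_span[OF x w hor_V[OF x] hor_V[OF x] indep_V[OF x]])
  ultimately show ?thesis
    using 12 skew[of "V 2 x" "V 1 x"] by (simp add: cov_linear bilin_simps)
qed

text \<open>Pairing with a Killing field: Hessian symmetry moves the derivative onto
  \<open>X\<close>, \<open>killing_grad_commute\<close> turns it into a derivative of
  \<open>X\<close> along a horizontal vector, and \<open>cov_X_hor\<close> annihilates it.\<close>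

lemma invariant_grad:
  assumes f: "smooth_on U f1" "smooth_on U f2"
    and inv: "\<And>y i. y \<in> U \<Longrightarrow> dirv (X i y) f1 y = 0" "\<And>y i. y \<in> U \<Longrightarrow> dirv (X i y) f2 y = 0"
    and x: "x \<in> U"
  shows "hor x (grad g f1 x)" "hor x (cov g (grad g f1 x) (grad g f2) x)"
proof -
  have h: "hor x (grad g f1 x)" "hor x (grad g f2 x)"
    using inv x by (simp_all add: hor_def inn_grad)
  then show "hor x (grad g f1 x)" by simp
  show "hor x (cov g (grad g f1 x) (grad g f2) x)"
    unfolding hor_def
    by (simp add: hess_sym[OF x f(2), of _ "X _ x"] killing_grad_commute[OF x smooth_X lie_X[OF x] f(2) inv(2)]
        cov_X_hor[OF x h(2) h(1)])
qed

end

text \<open>The submersion enters in dual form: \<open>inn_F\<close> says that gradients of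
  pulled-back coordinates have the inverse base metric as Gram matrix. It is obtained in
  \<open>quotient_gram\<close> from the isometry condition on horizontal vectors.\<close>

locale toric_quotient = toric_local U g J X \<phi> for U g J X \<phi> +
  fixes F :: "real^4 \<Rightarrow> real^2" and W :: "(real^2) set" and h :: "real^2 \<Rightarrow> real^2^2"
  assumes smooth_F: "smooth_vec_on U F" and F_W: "x \<in> U \<Longrightarrow> F x \<in> W"
    and base: "riemannian W h"
    and inv_F: "x \<in> U \<Longrightarrow> dirv (X i x) (\<lambda>y. F y $ a) x = 0"
    and inn_F: "x \<in> U \<Longrightarrow> inn x (grad g (\<lambda>y. F y $ a) x) (grad g (\<lambda>y. F y $ b) x) = matrix_inv (h (F x)) $ a $ b"
begin

definition E where "E a = grad g (\<lambda>y. F y $ a)"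

abbreviation H where "H \<equiv> \<lambda>a b w. matrix_inv (h w) $ a $ b"
abbreviation S where "S \<equiv> frame_connection (\<lambda>a b w. h w $ a $ b) H"

lemma smooth_E: "smooth_vec_on U (E a)"
  unfolding E_def by (rule smooth_vec_grad) (use smooth_F in \<open>simp add: smooth_vec_on_def\<close>)

lemma hH: "w \<in> W \<Longrightarrow> (\<Sum>d\<in>UNIV. h w $ d $ a * H d b w) = (if a = b then 1 else 0)"
proof -
  assume w: "w \<in> W"
  interpret B: riemannian W h by (rule base)
  have "(h w ** matrix_inv (h w)) $ a $ b = (if a = b then 1 else 0)"
    by (simp add: B.ginv[OF w] mat_def)
  then show ?thesis by (simp add: matrix_matrix_mult_def B.g_sym[OF w, of _ a])
qed

lemma inn_E: "x \<in> U \<Longrightarrow> inn x (E a x) (E b x) = H a b (F x)"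
  by (simp add: E_def inn_F)

lemma hor_E: "x \<in> U \<Longrightarrow> hor x (E a x)"
  unfolding E_def using smooth_F
  by (intro invariant_grad(1)[where ?f2.0 = "\<lambda>y. F y $ a"]) (auto simp: smooth_vec_on_def inv_F)

lemma hor_cov_E: "x \<in> U \<Longrightarrow> hor x (cov g (E a x) (E b) x)"
  unfolding E_def
proof (rule invariant_grad(2))
  show "smooth_on U (\<lambda>y. F y $ a)" "smooth_on U (\<lambda>y. F y $ b)"
    using smooth_F by (simp_all add: smooth_vec_on_def)
qed (simp_all add: inv_F)

lemma indep_E:
  assumes x: "x \<in> U" and eq: "s *\<^sub>R E 1 x + t *\<^sub>R E 2 x = 0"
  shows "s = 0 \<and> t = 0"
proof -
  have 0: "s * H 1 b (F x) + t * H 2 b (F x) = 0" for b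
    using arg_cong[OF eq, of "\<lambda>v. inn x v (E b x)"] by (simp add: bilin_simps inn_E[OF x])
  have "s * (matrix_inv (h (F x)) ** h (F x)) $ 1 $ a + t * (matrix_inv (h (F x)) ** h (F x)) $ 2 $ a = 0" for a
  proof -
    have "s * (matrix_inv (h (F x)) ** h (F x)) $ 1 $ a + t * (matrix_inv (h (F x)) ** h (F x)) $ 2 $ a =
      (\<Sum>b\<in>UNIV. (s * H 1 b (F x) + t * H 2 b (F x)) * h (F x) $ b $ a)"
      by (simp add: matrix_matrix_mult_def sum_2 algebra_simps)
    then show ?thesis by (simp only: 0) simp
  qed
  from this[of 1] this[of 2] show ?thesis
    by (simp add: riemannian.ginv(2)[OF base F_W[OF x]] mat_def)
qed

text \<open>An instance of \<open>frame_cov\<close> with the Killing vectors as normals: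
  \<open>hor_cov_E\<close> excludes components along them, so the connection coefficients are those
  of the base.\<close>

lemma cov_E:
  assumes x: "x \<in> U"
  shows "cov g (E a x) (E b) x = (\<Sum>d\<in>UNIV. S a b d (F x) *\<^sub>R E d x)"
  unfolding E_def
proof (rule frame_cov[where N = "range (\<lambda>i. X i x)", OF x smooth_F])
  interpret B: riemannian W h by (rule base)
  have Fs: "smooth_on U (\<lambda>y. F y $ a)" for a using smooth_F by (simp add: smooth_vec_on_def)
  show "H a b differentiable at (F x)" for a b
    using B.smooth_ginv B.open_U F_W[OF x] by (rule smooth_on_imp_differentiable)
  show "inn y (grad g (\<lambda>y. F y $ a) y) (grad g (\<lambda>y. F y $ b) y) = H a b (F y)" if "y \<in> U" for y a b
    by (rule inn_F[OF that])
  show "(\<Sum>d\<in>UNIV. h (F x) $ d $ a * H d b (F x)) = (if a = b then 1 else 0)" for a b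
    by (rule hH[OF F_W[OF x]])
  show "inn x (grad g (\<lambda>y. F y $ d) x) n = 0" if "n \<in> range (\<lambda>i. X i x)" for n d
    using that hor_E[OF x, of d] by (auto simp: hor_def E_def)
  show "inn x (cov g (grad g (\<lambda>y. F y $ a) x) (grad g (\<lambda>y. F y $ b)) x) n = 0" if "n \<in> range (\<lambda>i. X i x)" for n
    using that hor_cov_E[OF x, of a b, unfolded E_def] by (auto simp: hor_def)
  show "v = 0" if "\<And>c. inn x v (grad g (\<lambda>y. F y $ c) x) = 0" "\<And>n. n \<in> range (\<lambda>i. X i x) \<Longrightarrow> inn x v n = 0" for v
  proof (rule hor_full[OF x hor_E[OF x] hor_E[OF x] indep_E[OF x]])
    show "hor x v" unfolding hor_def using that(2) by blast
    show "inn x v (E 1 x) = 0" "inn x v (E 2 x) = 0" unfolding E_def by (rule that(1))+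
  qed
qed

lemma curv_E:
  assumes x: "x \<in> U"
  shows "curv g (E a x) (E b x) (E c x) x = (\<Sum>e\<in>UNIV. frame_curvature H S a b c e (F x) *\<^sub>R E e x)"
proof (rule frame_curv[OF x smooth_E smooth_F _ _ cov_E])
  show "S a b d differentiable at (F x)" for a b d
    by (rule frame_gauss_curvature(2)[OF base F_W[OF x]])
  show "dirv (E a x) (\<lambda>y. F y $ m) x = H a m (F x)" for a m
    using inn_E[OF x, of m a] inn_E[OF x, of a m] by (simp add: inn_grad[OF x, symmetric] E_def[symmetric] inn_sym[OF x])
qed

lemma curv_hor:
  assumes x: "x \<in> U" and v: "hor x v" and w: "hor x w" and z: "hor x z"
  shows "hor x (curv g v w z x)"
proof -
  have 1: "hor x (curv g (E a x) (E b x) (E c x) x)" for a b c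
    by (simp add: curv_E[OF x] sum_2 hor_lin hor_E[OF x])
  note sp = hor_span[OF x _ hor_E[OF x] hor_E[OF x] indep_E[OF x]]
  obtain s1 t1 s2 t2 s3 t3 where "v = s1 *\<^sub>R E 1 x + t1 *\<^sub>R E 2 x" "w = s2 *\<^sub>R E 1 x + t2 *\<^sub>R E 2 x"
     "z = s3 *\<^sub>R E 1 x + t3 *\<^sub>R E 2 x"
    using sp[OF v] sp[OF w] sp[OF z] by metis
  then show ?thesis by (simp add: curv_add curv_scale hor_lin 1)
qed

text \<open>By \<open>curv_E\<close> the curvature coefficients agree with those of the base, which
  \<open>frame_gauss_curvature\<close> evaluates. There is no correction term, and both sides scale
  with the squared determinant when the horizontal pair is changed.\<close>

lemma Rm_hor:
  assumes x: "x \<in> U" and v: "hor x v" and w: "hor x w"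
  shows "Rm g x v w w v = gauss_curvature h (F x) * (inn x v v * inn x w w - (inn x v w)\<^sup>2)"
proof -
  note sp = hor_span[OF x _ hor_E[OF x] hor_E[OF x] indep_E[OF x]]
  obtain s1 t1 s2 t2 where vw: "v = s1 *\<^sub>R E 1 x + t1 *\<^sub>R E 2 x" "w = s2 *\<^sub>R E 1 x + t2 *\<^sub>R E 2 x"
    using sp[OF v] sp[OF w] by metis
  have z: "Rm g x a a c d = 0" "Rm g x c d a a = 0" for a c d
    using Rm_skew12[OF x, of a a c d] Rm_skew34[OF x, of c d a a] by simp_all
  have sk: "Rm g x (E 2 x) (E 1 x) c d = - Rm g x (E 1 x) (E 2 x) c d"
     "Rm g x c d (E 1 x) (E 2 x) = - Rm g x c d (E 2 x) (E 1 x)" for c d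
    by (rule Rm_skew12[OF x], rule Rm_skew34[OF x])
  have "Rm g x v w w v = (s1 * t2 - t1 * s2)\<^sup>2 * Rm g x (E 1 x) (E 2 x) (E 2 x) (E 1 x)"
    unfolding vw using z sk unfolding Rm_def
    by (simp add: Rm_simps algebra_simps power2_eq_square)
  also have "Rm g x (E 1 x) (E 2 x) (E 2 x) (E 1 x) =
      gauss_curvature h (F x) * (H 1 1 (F x) * H 2 2 (F x) - H 1 2 (F x) * H 1 2 (F x))"
    unfolding frame_gauss_curvature(1)[OF base F_W[OF x], symmetric]
    by (simp add: Rm_def curv_E[OF x] bilin_simps inn_E[OF x])
  also have "\<dots> = gauss_curvature h (F x) * (inn x (E 1 x) (E 1 x) * inn x (E 2 x) (E 2 x) - (inn x (E 1 x) (E 2 x))\<^sup>2)"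
    by (simp add: inn_E[OF x] power2_eq_square)
  also have "(s1 * t2 - t1 * s2)\<^sup>2 * \<dots> = gauss_curvature h (F x) * (inn x v v * inn x w w - (inn x v w)\<^sup>2)"
    unfolding vw by (simp add: bilin_simps inn_sym[OF x, of "E 2 x" "E 1 x"] algebra_simps power2_eq_square)
  finally show ?thesis .
qed

text \<open>Since \<open>[X\<^sub>i, E\<^sub>a] = 0\<close>, the curvature in the direction of a Killing field reduces to a third
  covariant derivative of its moment function.\<close>

lemma curv_E_X:
  assumes x: "x \<in> U"
  shows "curv g (E a x) (X i x) (E b x) x = J x *v
    (cov g (E a x) (\<lambda>y. cov g (E b y) (V i) y) x - (\<Sum>d\<in>UNIV. S a b d (F x) *\<^sub>R cov g (E d x) (V i) x))"
proof -
  have Fs: "smooth_on U (\<lambda>y. F y $ a)" for a using smooth_F by (simp add: smooth_vec_on_def)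
  have dFx: "(\<lambda>y. F y $ m) differentiable at x" for m
    using Fs x open_U by (auto intro: smooth_on_imp_differentiable)
  \<comment> \<open>The functions \<open>F b\<close> are invariant, so their gradients commute with
    the Killing fields.\<close>
  have com: "cov g (X i y) (E b) y = cov g (E b y) (X i) y" if "y \<in> U" for b y
    unfolding E_def by (rule killing_grad_commute[OF that smooth_X lie_X[OF that] Fs inv_F])
  have covX: "cov g v (X i) y = J y *v cov g v (V i) y" if y: "y \<in> U" for v y
  proof -
    have "cov g v (X i) y = cov g v (\<lambda>y. J y *v V i y) y"
      by (rule cov_cong[OF open_U y X_eq])
    then show ?thesis by (simp add: cov_J[OF y diff_at[OF y smooth_V]])
  qed
  have "lie_bracket (E a) (X i) x = 0"
    by (simp add: cov_torsion_free[OF x, symmetric] com[OF x])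
  then have "curv g (E a x) (X i x) (E b x) x =
     cov g (E a x) (\<lambda>y. cov g (X i y) (E b) y) x - cov g (X i x) (\<lambda>y. cov g (E a y) (E b) y) x"
    using cov_comm[OF x smooth_E smooth_X smooth_E, of a i b] cov_linear(3)[of g 0 0] by simp
  also have "cov g (E a x) (\<lambda>y. cov g (X i y) (E b) y) x = cov g (E a x) (\<lambda>y. J y *v cov g (E b y) (V i) y) x"
    by (rule cov_cong[OF open_U x]) (simp add: com covX)
  also have "\<dots> = J x *v cov g (E a x) (\<lambda>y. cov g (E b y) (V i) y) x"
    by (rule cov_J[OF x diff_at[OF x smooth_vec_cov[OF smooth_E smooth_V]]])
  also have "cov g (X i x) (\<lambda>y. cov g (E a y) (E b) y) x = cov g (X i x) (\<lambda>y. \<Sum>d\<in>UNIV. S a b d (F y) *\<^sub>R E d y) x"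
    by (rule cov_cong[OF open_U x cov_E])
  also have "\<dots> = (\<Sum>d\<in>UNIV. S a b d (F x) *\<^sub>R cov g (X i x) (E d) x)"
  proof -
    note SF = pd_compose(2)[of "S _ _ _", OF frame_gauss_curvature(2)[OF base F_W[OF x]] dFx]
    \<comment> \<open>Connection coefficients are pulled back from the base and so constant along
      the orbits.\<close>
    have "dirv (X i x) (\<lambda>y. S a b d (F y)) x = 0" for d
      unfolding dirv_compose[of "S _ _ _", OF frame_gauss_curvature(2)[OF base F_W[OF x]] dFx]
      by (simp add: inv_F[OF x])
    then show ?thesis
      by (subst cov_sum) (auto simp: cov_scale SF diff_at[OF x smooth_E] intro!: differentiable_scaleR)
  qed
  also have "\<dots> = J x *v (\<Sum>d\<in>UNIV. S a b d (F x) *\<^sub>R cov g (E d x) (V i) x)"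
    by (simp add: com[OF x] covX[OF x] linear_sum[OF matrix_vector_mul_linear] matrix_vector_mult_scaleR)
  finally show ?thesis by (simp add: matrix_vector_mult_diff_distrib)
qed

end

section \<open>Curvature of a Kaehler surface in a unitary frame\<close>

definition multilin :: "(4 \<Rightarrow> 4 \<Rightarrow> 4 \<Rightarrow> 4 \<Rightarrow> real) \<Rightarrow> real^4 \<Rightarrow> real^4 \<Rightarrow> real^4 \<Rightarrow> real^4 \<Rightarrow> real" where
  "multilin F v w z t = (\<Sum>i\<in>UNIV. \<Sum>j\<in>UNIV. \<Sum>k\<in>UNIV. \<Sum>l\<in>UNIV. v $ i * w $ j * z $ k * t $ l * F i j k l)"

lemma multilin_linear:
  "multilin (\<lambda>i j k l. F i j k l + G i j k l) v w z t = multilin F v w z t + multilin G v w z t"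
  "multilin (\<lambda>i j k l. F i j k l - G i j k l) v w z t = multilin F v w z t - multilin G v w z t"
  "multilin (\<lambda>i j k l. c * F i j k l) v w z t = c * multilin F v w z t"
  "multilin (\<lambda>i j k l. F i j k l / d) v w z t = multilin F v w z t / d"
  by (simp_all add: multilin_def algebra_simps sum.distrib sum_subtractf sum_distrib_left sum_divide_distrib)

lemma multilin_prod:
  "multilin (\<lambda>i j k l. A $ i $ j * B $ k $ l) v w z t = bilin A v w * bilin B z t" (is ?P1)
  "multilin (\<lambda>i j k l. A $ i $ k * B $ j $ l) v w z t = bilin A v z * bilin B w t" (is ?P2)
  "multilin (\<lambda>i j k l. A $ i $ l * B $ j $ k) v w z t = bilin A v t * bilin B w z" (is ?P3)
proof -
  show ?P1
    unfolding multilin_def bilin_sum_def unfolding sum_distrib_right unfolding sum_distrib_left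
    by (simp only: mult_ac)
  have "multilin (\<lambda>i j k l. A $ i $ k * B $ j $ l) v w z t =
     (\<Sum>i\<in>UNIV. \<Sum>k\<in>UNIV. \<Sum>j\<in>UNIV. \<Sum>l\<in>UNIV. v $ i * w $ j * z $ k * t $ l * (A $ i $ k * B $ j $ l))"
    unfolding multilin_def by (intro sum.cong refl sum.swap)
  then show ?P2
    unfolding bilin_sum_def unfolding sum_distrib_right unfolding sum_distrib_left
    by (simp only: mult_ac)
  have "multilin (\<lambda>i j k l. A $ i $ l * B $ j $ k) v w z t =
     (\<Sum>i\<in>UNIV. \<Sum>j\<in>UNIV. \<Sum>l\<in>UNIV. \<Sum>k\<in>UNIV. v $ i * w $ j * z $ k * t $ l * (A $ i $ l * B $ j $ k))"
    unfolding multilin_def by (intro sum.cong refl sum.swap)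
  also have "\<dots> = (\<Sum>i\<in>UNIV. \<Sum>l\<in>UNIV. \<Sum>j\<in>UNIV. \<Sum>k\<in>UNIV. v $ i * w $ j * z $ k * t $ l * (A $ i $ l * B $ j $ k))"
    by (intro sum.cong refl sum.swap)
  finally show ?P3
    unfolding bilin_sum_def unfolding sum_distrib_right unfolding sum_distrib_left
    by (simp only: mult_ac)
qed

lemma bilin_mat_linear:
  "bilin (A + B) v w = bilin A v w + bilin B v w" "bilin (A - B) v w = bilin A v w - bilin B v w"
  "bilin (c *\<^sub>R A) v w = c * bilin A v w" "bilin (- A) v w = - bilin A v w" "bilin 0 v w = 0"
  by (simp_all add: bilin_sum_def algebra_simps sum.distrib sum_subtractf sum_distrib_left sum_negf)

lemma bilin_transpose: "bilin (transpose A) v w = bilin A w v"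
  unfolding bilin_sum_def by (subst sum.swap) (simp add: transpose_def mult_ac)

lemma bilin_transpose_mult: "bilin (transpose A ** B) v w = bilin B (A *v v) w"
  by (simp only: bilin_def matrix_vector_mul_assoc[symmetric] inner_transpose_mult)

lemma bilin_wedge: "bilin (wedge \<alpha> \<beta>) v w = (v \<bullet> \<alpha>) * (w \<bullet> \<beta>) - (w \<bullet> \<alpha>) * (v \<bullet> \<beta>)"
proof -
  have "bilin (wedge \<alpha> \<beta>) v w = (\<Sum>i\<in>UNIV. \<Sum>j\<in>UNIV. (v $ i * \<alpha> $ i) * (w $ j * \<beta> $ j))
     - (\<Sum>i\<in>UNIV. \<Sum>j\<in>UNIV. (v $ i * \<beta> $ i) * (w $ j * \<alpha> $ j))"
    by (simp add: bilin_sum_def wedge_def algebra_simps sum_subtractf)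
  then show ?thesis
    unfolding sum_product[symmetric] by (simp add: inner_vec_def mult.commute)
qed

text \<open>The order \<open>e 1, e 2, J e 1, J e 2\<close> keeps room for a horizontal pair in
  front. The complex orientation is that of \<open>e 1, e 3, e 2, e 4\<close>, the opposite of the
  numbering, which accounts for the signs in \<open>hodge_table\<close>.\<close>

locale kahler_frame = kahler U g J for U :: "(real^4) set" and g J +
  fixes x :: "real^4" and e :: "4 \<Rightarrow> real^4"
  assumes x: "x \<in> U" and orthonormal: "inn x (e a) (e b) = (if a = b then 1 else 0)"
    and e3: "e 3 = J x *v e 1" and e4: "e 4 = J x *v e 2"
begin

lemma J_e: "J x *v e 1 = e 3" "J x *v e 2 = e 4" "J x *v e 3 = - e 1" "J x *v e 4 = - e 2"
  by (simp_all add: e3 e4 J_J[OF x])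

lemma expand: "(\<Sum>a\<in>UNIV. inn x v (e a) *\<^sub>R e a) = v"
proof -
  define f where "f c = (\<Sum>a\<in>UNIV. c $ a *\<^sub>R e a)" for c :: "real^4"
  have fe: "inn x (f c) (e b) = c $ b" for c b
    by (simp add: f_def bilin_simps orthonormal if_distrib cong: if_cong)
  have l: "linear f"
    by (rule linearI) (simp_all add: f_def algebra_simps sum.distrib scaleR_sum_right)
  have "inj f" by (rule injI) (metis fe vec_eq_iff)
  then have "surj f" using l linear_injective_imp_surjective by blast
  then obtain c where c: "v = f c" by (metis surjD)
  show ?thesis unfolding c fe by (simp add: f_def)
qed

lemma bilin_expand: "bilin A v w = (\<Sum>a\<in>UNIV. \<Sum>b\<in>UNIV. inn x v (e a) * inn x w (e b) * bilin A (e a) (e b))"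
proof -
  have 1: "bilin A v w = (\<Sum>a\<in>UNIV. inn x v (e a) * bilin A (e a) w)" for v w
    by (subst expand[of v, symmetric]) (simp only: bilin_simps)
  have 2: "bilin A v w = (\<Sum>b\<in>UNIV. inn x w (e b) * bilin A v (e b))" for v w
    by (subst expand[of w, symmetric]) (simp only: bilin_simps)
  show ?thesis
    unfolding 1[of v w] unfolding 2[of _ w] by (simp add: sum_distrib_left mult.assoc)
qed

lemma frame_eqI:
  assumes "\<And>a b. bilin A (e a) (e b) = bilin B (e a) (e b)"
  shows "A = B"
proof -
  have "bilin A v w = bilin B v w" for v w
    by (subst (1 2) bilin_expand) (simp add: assms)
  then show ?thesis by (simp add: vec_eq_iff flip: bilin_axis)
qed

lemma ginv_frame: "matrix_inv (g x) $ i $ j = (\<Sum>a\<in>UNIV. e a $ i * e a $ j)"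
proof -
  define P where "P = (\<chi> i j. \<Sum>a\<in>UNIV. e a $ i * e a $ j)"
  have "(P ** g x) *v v = v" for v
  proof -
    have "((P ** g x) *v v) $ i = (\<Sum>a\<in>UNIV. inn x v (e a) *\<^sub>R e a) $ i" for i
    proof -
      have "((P ** g x) *v v) $ i = (\<Sum>k\<in>UNIV. \<Sum>a\<in>UNIV. e a $ i * (e a $ k * (g x *v v) $ k))"
        unfolding matrix_vector_mul_assoc[symmetric] matrix_vector_mult_def[of P] vec_lambda_beta
        by (simp add: P_def sum_distrib_right mult.assoc)
      also have "\<dots> = (\<Sum>a\<in>UNIV. e a $ i * inn x (e a) v)"
        by (subst sum.swap) (simp add: bilin_def inner_vec_def sum_distrib_left)
      finally show ?thesis by (simp add: inn_sym[OF x, of v] mult.commute)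
    qed
    then show ?thesis unfolding expand vec_eq_iff by blast
  qed
  then have "P ** g x = mat 1" by (metis matrix_eq matrix_vector_mul_lid)
  then have "P ** g x ** matrix_inv (g x) = matrix_inv (g x)" by simp
  then have "P = matrix_inv (g x)" by (simp add: matrix_mul_assoc[symmetric] ginv[OF x])
  then show ?thesis by (simp add: P_def vec_eq_iff)
qed

lemma contract_frame: "(\<Sum>i\<in>UNIV. \<Sum>l\<in>UNIV. matrix_inv (g x) $ i $ l * A i l) =
    (\<Sum>a\<in>UNIV. \<Sum>i\<in>UNIV. \<Sum>l\<in>UNIV. e a $ i * e a $ l * A i l)"
proof -
  have "(\<Sum>i\<in>UNIV. \<Sum>l\<in>UNIV. matrix_inv (g x) $ i $ l * A i l) =
      (\<Sum>i\<in>UNIV. \<Sum>a\<in>UNIV. \<Sum>l\<in>UNIV. e a $ i * e a $ l * A i l)"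
    by (simp add: ginv_frame sum_distrib_right) (intro sum.cong refl sum.swap)
  also have "\<dots> = (\<Sum>a\<in>UNIV. \<Sum>i\<in>UNIV. \<Sum>l\<in>UNIV. e a $ i * e a $ l * A i l)"
    by (rule sum.swap)
  finally show ?thesis .
qed

lemma raise2_frame: "raise2 (g x) \<zeta> $ k $ l = (\<Sum>a\<in>UNIV. \<Sum>b\<in>UNIV. bilin \<zeta> (e a) (e b) * (e a $ k * e b $ l))"
proof -
  have "raise2 (g x) \<zeta> $ k $ l = (\<Sum>q\<in>UNIV. \<Sum>p\<in>UNIV. \<Sum>a\<in>UNIV. \<Sum>b\<in>UNIV. e a $ k * e a $ p * \<zeta> $ p $ q * (e b $ q * e b $ l))"
    unfolding raise2_def matrix_matrix_mult_def vec_lambda_beta ginv_frame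
    unfolding sum_distrib_right unfolding sum_distrib_left ..
  also have "\<dots> = (\<Sum>a\<in>UNIV. \<Sum>b\<in>UNIV. \<Sum>q\<in>UNIV. \<Sum>p\<in>UNIV. e a $ k * e a $ p * \<zeta> $ p $ q * (e b $ q * e b $ l))"
    by (rule sum_swap_pairs)
  also have "\<dots> = (\<Sum>a\<in>UNIV. \<Sum>b\<in>UNIV. bilin \<zeta> (e a) (e b) * (e a $ k * e b $ l))"
    unfolding bilin_sum_def by (intro sum.cong refl, subst sum.swap) (simp add: sum_distrib_left sum_distrib_right mult_ac)
  finally show ?thesis .
qed

lemma contract_raise2:
  "(\<Sum>k\<in>UNIV. \<Sum>l\<in>UNIV. A k l * raise2 (g x) \<zeta> $ k $ l) =
    (\<Sum>a\<in>UNIV. \<Sum>b\<in>UNIV. bilin \<zeta> (e a) (e b) * (\<Sum>k\<in>UNIV. \<Sum>l\<in>UNIV. e a $ k * e b $ l * A k l))"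
proof -
  have "(\<Sum>k\<in>UNIV. \<Sum>l\<in>UNIV. A k l * raise2 (g x) \<zeta> $ k $ l) =
     (\<Sum>k\<in>UNIV. \<Sum>l\<in>UNIV. \<Sum>a\<in>UNIV. \<Sum>b\<in>UNIV. bilin \<zeta> (e a) (e b) * (e a $ k * e b $ l * A k l))"
    by (simp add: raise2_frame sum_distrib_left mult_ac)
  also have "\<dots> = (\<Sum>a\<in>UNIV. \<Sum>b\<in>UNIV. \<Sum>k\<in>UNIV. \<Sum>l\<in>UNIV. bilin \<zeta> (e a) (e b) * (e a $ k * e b $ l * A k l))"
    by (rule sum_swap_pairs)
  finally show ?thesis by (simp add: sum_distrib_left)
qed

lemma contract_raise2_frame:
  "bilin (\<chi> i j. (\<Sum>k\<in>UNIV. \<Sum>l\<in>UNIV. F i j k l * raise2 (g x) \<zeta> $ k $ l) / 2) v w =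
    (\<Sum>a\<in>UNIV. \<Sum>b\<in>UNIV. bilin \<zeta> (e a) (e b) * multilin F v w (e a) (e b)) / 2"
proof -
  have "bilin (\<chi> i j. (\<Sum>k\<in>UNIV. \<Sum>l\<in>UNIV. F i j k l * raise2 (g x) \<zeta> $ k $ l) / 2) v w =
     (\<Sum>i\<in>UNIV. \<Sum>j\<in>UNIV. \<Sum>a\<in>UNIV. \<Sum>b\<in>UNIV. bilin \<zeta> (e a) (e b) *
        (\<Sum>k\<in>UNIV. \<Sum>l\<in>UNIV. v $ i * w $ j * e a $ k * e b $ l * F i j k l)) / 2"
    by (simp add: contract_raise2 bilin_sum_def[where A = "vec_lambda _"] sum_distrib_left sum_divide_distrib mult_ac)
  also have "(\<Sum>i\<in>UNIV. \<Sum>j\<in>UNIV. \<Sum>a\<in>UNIV. \<Sum>b\<in>UNIV. bilin \<zeta> (e a) (e b) *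
        (\<Sum>k\<in>UNIV. \<Sum>l\<in>UNIV. v $ i * w $ j * e a $ k * e b $ l * F i j k l)) =
     (\<Sum>a\<in>UNIV. \<Sum>b\<in>UNIV. \<Sum>i\<in>UNIV. \<Sum>j\<in>UNIV. bilin \<zeta> (e a) (e b) *
        (\<Sum>k\<in>UNIV. \<Sum>l\<in>UNIV. v $ i * w $ j * e a $ k * e b $ l * F i j k l))"
    by (rule sum_swap_pairs)
  finally show ?thesis by (simp add: multilin_def sum_distrib_left)
qed

lemma form_inner_frame:
  "form_inner (g x) \<alpha> \<beta> = (\<Sum>a\<in>UNIV. \<Sum>b\<in>UNIV. bilin \<alpha> (e a) (e b) * bilin \<beta> (e a) (e b)) / 2"
  unfolding form_inner_def contract_raise2 by (simp add: bilin_sum_def[of \<alpha>] mult_ac)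

definition \<omega> where "\<omega> a b = bilin (transpose (J x) ** g x) (e a) (e b)"

lemma \<omega>: "\<omega> a b = (if a = 1 \<and> b = 3 \<or> a = 2 \<and> b = 4 then 1 else if a = 3 \<and> b = 1 \<or> a = 4 \<and> b = 2 then -1 else 0)"
proof -
  have "\<forall>a b. \<omega> a b = (if a = 1 \<and> b = 3 \<or> a = 2 \<and> b = 4 then 1 else if a = 3 \<and> b = 1 \<or> a = 4 \<and> b = 2 then -1 else 0)"
    by (simp add: \<omega>_def bilin_transpose_mult forall_4 J_e bilin_simps orthonormal)
  then show ?thesis by blast
qed

lemma hodge_frame: "bilin (hodge_star (g x) (J x) \<zeta>) (e a) (e b) =
    (\<Sum>c\<in>UNIV. \<Sum>d\<in>UNIV. bilin \<zeta> (e c) (e d) * (\<omega> a b * \<omega> c d - \<omega> a c * \<omega> b d + \<omega> a d * \<omega> b c)) / 2"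
  unfolding hodge_star_def contract_raise2_frame complex_volume_def Let_def
  by (simp add: multilin_linear multilin_prod \<omega>_def)

section \<open>Curvature and Ricci components in a unitary frame\<close>

definition r where "r a b c d = Rm g x (e a) (e b) (e c) (e d)"
definition ric where "ric a b = bilin (ricci g x) (e a) (e b)"

lemma ric_eq: "ric a b = (\<Sum>c\<in>UNIV. r c a b c)"
proof -
  have "ric a b = (\<Sum>j\<in>UNIV. \<Sum>k\<in>UNIV. \<Sum>c\<in>UNIV. \<Sum>i\<in>UNIV. \<Sum>l\<in>UNIV. e c $ i * e a $ j * e b $ k * e c $ l * riemann g i j k l x)"
    unfolding ric_def bilin_sum_def ricci_def vec_lambda_beta contract_frame
    by (simp add: sum_distrib_left sum_distrib_right mult_ac)
  also have "\<dots> = (\<Sum>c\<in>UNIV. \<Sum>i\<in>UNIV. \<Sum>j\<in>UNIV. \<Sum>k\<in>UNIV. \<Sum>l\<in>UNIV. e c $ i * e a $ j * e b $ k * e c $ l * riemann g i j k l x)"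
    by (rule sum_swap_pairs)
  finally show ?thesis by (simp add: r_def Rm_sum[OF x])
qed

lemma scalar_eq: "scalar_curvature g x = (\<Sum>a\<in>UNIV. ric a a)"
  unfolding scalar_curvature_def contract_frame ric_def bilin_sum_def by (simp add: mult_ac)

lemma weyl_op_frame: "bilin (weyl_op g x \<zeta>) (e a) (e b) =
  (\<Sum>c\<in>UNIV. \<Sum>d\<in>UNIV. bilin \<zeta> (e c) (e d) * (r a b d c
     - (ric a c * inn x (e b) (e d) + inn x (e a) (e c) * ric b d
        - ric a d * inn x (e b) (e c) - inn x (e a) (e d) * ric b c) / 2
     + scalar_curvature g x * (inn x (e a) (e c) * inn x (e b) (e d) - inn x (e a) (e d) * inn x (e b) (e c)) / 6)) / 2"
proof -
  have "multilin (\<lambda>i j k l. riemann g i j k l x) v w z t = Rm g x v w z t" for v w z t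
    by (simp add: multilin_def Rm_sum[OF x])
  then have "multilin (\<lambda>i j k l. weyl g i j k l x) v w z t = Rm g x v w z t
    - (bilin (ricci g x) v t * inn x w z + inn x v t * bilin (ricci g x) w z
       - bilin (ricci g x) v z * inn x w t - inn x v z * bilin (ricci g x) w t) / 2
    + scalar_curvature g x * (inn x v t * inn x w z - inn x v z * inn x w t) / 6" for v w z t
    by (simp add: weyl_def multilin_linear multilin_prod)
  moreover have "weyl_op g x \<zeta> = (\<chi> i j. (\<Sum>k\<in>UNIV. \<Sum>l\<in>UNIV. weyl g i j l k x * raise2 (g x) \<zeta> $ k $ l) / 2)"
    unfolding weyl_op_def tensor_act_def by (subst sum.swap) (rule refl)
  moreover have "multilin (\<lambda>i j k l. weyl g i j l k x) v w z t = multilin (\<lambda>i j k l. weyl g i j k l x) v w t z" for v w z t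
    unfolding multilin_def by (rule sum.cong[OF refl], rule sum.cong[OF refl], subst sum.swap) (simp add: mult_ac)
  ultimately show ?thesis
    by (simp add: contract_raise2_frame r_def ric_def)
qed

lemma ricci_form_frame: "bilin (ricci_form g J x) (e a) (e b) = bilin (ricci g x) (J x *v e a) (e b)"
  by (simp only: ricci_form_def bilin_transpose_mult)

lemma r_skew: "r a b c d = - r b a c d" "r a b c d = - r a b d c"
  unfolding r_def by (rule Rm_skew12[OF x], rule Rm_skew34[OF x])

lemma r_pair: "r a b c d = r c d a b"
  unfolding r_def by (rule Rm_pair[OF x])

lemma r_zero: "r a a c d = 0" "r a b c c = 0"
  using r_skew(1)[of a a c d] r_skew(2)[of a b c c] by simp_all

lemma r_flip:
  "r 2 1 c d = - r 1 2 c d" "r 3 1 c d = - r 1 3 c d" "r 4 1 c d = - r 1 4 c d"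
  "r 3 2 c d = - r 2 3 c d" "r 4 2 c d = - r 2 4 c d" "r 4 3 c d = - r 3 4 c d"
  "r c d 2 1 = - r c d 1 2" "r c d 3 1 = - r c d 1 3" "r c d 4 1 = - r c d 1 4"
  "r c d 3 2 = - r c d 2 3" "r c d 4 2 = - r c d 2 4" "r c d 4 3 = - r c d 3 4"
  by (rule r_skew(1))+ (rule r_skew(2))+

lemma r_J: "r 3 4 c d = r 1 2 c d" "r 2 3 c d = r 1 4 c d" "r c d 3 4 = r c d 1 2" "r c d 2 3 = r c d 1 4"
proof -
  have 1: "r 3 4 c d = r 1 2 c d" for c d
    unfolding r_def e3 e4 by (rule Rm_J12[OF x])
  \<comment> \<open>\<open>J\<close> carries the pair \<open>e 2, e 3\<close> to
    \<open>e 4, - e 1\<close>; exchanging the two vectors absorbs the sign.\<close>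
  have 2: "r 2 3 c d = r 1 4 c d" for c d
    using Rm_J12[OF x, of "e 2" "e 3" "e c" "e d"] r_flip(3)[of c d]
    by (simp add: r_def J_e Rm_simps Rm_def)
  show "r 3 4 c d = r 1 2 c d" "r 2 3 c d = r 1 4 c d" "r c d 3 4 = r c d 1 2" "r c d 2 3 = r c d 1 4"
    using 1 2 r_pair by metis+
qed

lemma r_order: "r 1 3 1 2 = r 1 2 1 3" "r 2 4 1 2 = r 1 2 2 4" "r 1 4 1 2 = r 1 2 1 4"
  "r 2 4 1 3 = r 1 3 2 4" "r 1 4 1 3 = r 1 3 1 4" "r 1 4 2 4 = r 2 4 1 4"
  by (rule r_pair)+

lemma r_bianchi: "r 1 3 2 4 = r 1 2 1 2 + r 1 4 1 4"
  using Rm_bianchi[OF x, of "e 1" "e 2" "e 3" "e 4"]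
  by (simp add: r_def[symmetric] r_flip r_J r_order)

text \<open>As rewrite rules these leave nine components: 1212, 1213, 1214, 1224, 1313, 1314, 1414,
  2414 and 2424. Nine is the dimension of the space of Kaehler curvature tensors in complex
  dimension two.\<close>

lemmas r_table = r_zero r_flip r_J r_order r_bianchi

lemma ric_table:
  "ric 1 1 = - (r 1 2 1 2 + r 1 4 1 4 + r 1 3 1 3)" "ric 3 3 = ric 1 1"
  "ric 2 2 = - (r 1 2 1 2 + r 1 4 1 4 + r 2 4 2 4)" "ric 4 4 = ric 2 2"
  "ric 1 2 = - (r 1 3 1 4 + r 2 4 1 4)" "ric 2 1 = ric 1 2" "ric 3 4 = ric 1 2" "ric 4 3 = ric 1 2"
  "ric 1 3 = 0" "ric 3 1 = 0" "ric 2 4 = 0" "ric 4 2 = 0"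
  "ric 1 4 = r 1 2 2 4 + r 1 2 1 3" "ric 4 1 = ric 1 4" "ric 2 3 = - ric 1 4" "ric 3 2 = - ric 1 4"
  by (simp_all add: ric_eq sum_4 r_table)

lemma scalar_table: "scalar_curvature g x = - 2 * (2 * r 1 2 1 2 + 2 * r 1 4 1 4 + r 1 3 1 3 + r 2 4 2 4)"
  by (simp add: scalar_eq sum_4 ric_table)

section \<open>Two-forms, the Hodge star and the Weyl operator in the frame\<close>

lemma two_form_iff: "two_form \<zeta> \<longleftrightarrow> (\<forall>a b. bilin \<zeta> (e a) (e b) = - bilin \<zeta> (e b) (e a))"
proof
  assume "two_form \<zeta>"
  then have "bilin (transpose \<zeta>) (e b) (e a) = bilin (- \<zeta>) (e b) (e a)" for a b
    by (simp add: two_form_def)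
  then show "\<forall>a b. bilin \<zeta> (e a) (e b) = - bilin \<zeta> (e b) (e a)"
    unfolding bilin_transpose bilin_mat_linear by blast
next
  assume *: "\<forall>a b. bilin \<zeta> (e a) (e b) = - bilin \<zeta> (e b) (e a)"
  show "two_form \<zeta>"
    unfolding two_form_def
    by (rule frame_eqI) (unfold bilin_transpose bilin_mat_linear, rule *[rule_format])
qed

lemma two_form_table:
  assumes "two_form \<zeta>"
  shows "bilin \<zeta> (e a) (e a) = 0" "bilin \<zeta> (e 2) (e 1) = - bilin \<zeta> (e 1) (e 2)"
    "bilin \<zeta> (e 3) (e 1) = - bilin \<zeta> (e 1) (e 3)" "bilin \<zeta> (e 4) (e 1) = - bilin \<zeta> (e 1) (e 4)"
    "bilin \<zeta> (e 3) (e 2) = - bilin \<zeta> (e 2) (e 3)" "bilin \<zeta> (e 4) (e 2) = - bilin \<zeta> (e 2) (e 4)"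
    "bilin \<zeta> (e 4) (e 3) = - bilin \<zeta> (e 3) (e 4)"
proof -
  note * = assms[unfolded two_form_iff, rule_format]
  show "bilin \<zeta> (e a) (e a) = 0" using *[of a a] by simp
qed (use assms[unfolded two_form_iff] in blast)+

lemma two_form_eq_iff:
  assumes "two_form A" "two_form B"
  shows "A = B \<longleftrightarrow> bilin A (e 1) (e 2) = bilin B (e 1) (e 2) \<and> bilin A (e 1) (e 3) = bilin B (e 1) (e 3)
    \<and> bilin A (e 1) (e 4) = bilin B (e 1) (e 4) \<and> bilin A (e 2) (e 3) = bilin B (e 2) (e 3)
    \<and> bilin A (e 2) (e 4) = bilin B (e 2) (e 4) \<and> bilin A (e 3) (e 4) = bilin B (e 3) (e 4)"
    (is "_ \<longleftrightarrow> ?R")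
proof
  assume R: ?R
  have "\<forall>a b. bilin A (e a) (e b) = bilin B (e a) (e b)"
    unfolding forall_4 two_form_table[OF assms(1)] two_form_table[OF assms(2)] using R by simp
  then show "A = B" using frame_eqI by blast
qed simp

lemma two_form_linear:
  "two_form A \<Longrightarrow> two_form B \<Longrightarrow> two_form (A + B)" "two_form A \<Longrightarrow> two_form B \<Longrightarrow> two_form (A - B)"
  "two_form A \<Longrightarrow> two_form (c *\<^sub>R A)" "two_form A \<Longrightarrow> two_form (- A)" "two_form 0"
proof -
  have "transpose (A + B) = transpose A + transpose B" "transpose (A - B) = transpose A - transpose B"
    "transpose (c *\<^sub>R A) = c *\<^sub>R transpose A" "transpose (- A) = - transpose A" "transpose 0 = (0 :: real^4^4)" for A B :: "real^4^4"
    by (simp_all add: transpose_def vec_eq_iff)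
  then show "two_form A \<Longrightarrow> two_form B \<Longrightarrow> two_form (A + B)" "two_form A \<Longrightarrow> two_form B \<Longrightarrow> two_form (A - B)"
    "two_form A \<Longrightarrow> two_form (c *\<^sub>R A)" "two_form A \<Longrightarrow> two_form (- A)" "two_form 0"
    by (simp_all add: two_form_def)
qed

lemma hodge_table:
  assumes "two_form \<zeta>"
  shows "bilin (hodge_star (g x) (J x) \<zeta>) (e 1) (e 2) = - bilin \<zeta> (e 3) (e 4)"
    "bilin (hodge_star (g x) (J x) \<zeta>) (e 1) (e 3) = bilin \<zeta> (e 2) (e 4)"
    "bilin (hodge_star (g x) (J x) \<zeta>) (e 1) (e 4) = - bilin \<zeta> (e 2) (e 3)"
    "bilin (hodge_star (g x) (J x) \<zeta>) (e 2) (e 3) = - bilin \<zeta> (e 1) (e 4)"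
    "bilin (hodge_star (g x) (J x) \<zeta>) (e 2) (e 4) = bilin \<zeta> (e 1) (e 3)"
    "bilin (hodge_star (g x) (J x) \<zeta>) (e 3) (e 4) = - bilin \<zeta> (e 1) (e 2)"
  by (simp_all add: hodge_frame sum_4 \<omega> two_form_table[OF assms])

lemma sum_skew:
  fixes z f f' :: "4 \<Rightarrow> 4 \<Rightarrow> real"
  assumes "\<And>c d. f c d = - f' c d"
  shows "(\<Sum>c\<in>UNIV. \<Sum>d\<in>UNIV. z c d * f c d) / 2 = - ((\<Sum>c\<in>UNIV. \<Sum>d\<in>UNIV. z c d * f' c d) / 2)"
  by (simp add: assms sum_negf)

lemma two_form_hodge: "two_form (hodge_star (g x) (J x) \<zeta>)"
proof -
  have "\<omega> b a * \<omega> c d - \<omega> b c * \<omega> a d + \<omega> b d * \<omega> a c = - (\<omega> a b * \<omega> c d - \<omega> a c * \<omega> b d + \<omega> a d * \<omega> b c)" for a b c d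
  proof -
    have "\<omega> b a = - \<omega> a b" by (auto simp: \<omega>)
    then show ?thesis by simp
  qed
  then show ?thesis
    unfolding two_form_iff hodge_frame by (intro allI sum_skew)
qed

lemma asd_iff: "\<zeta> \<in> anti_self_dual (g x) (J x) \<longleftrightarrow> two_form \<zeta> \<and> bilin \<zeta> (e 3) (e 4) = bilin \<zeta> (e 1) (e 2)
    \<and> bilin \<zeta> (e 2) (e 4) = - bilin \<zeta> (e 1) (e 3) \<and> bilin \<zeta> (e 2) (e 3) = bilin \<zeta> (e 1) (e 4)"
proof (cases "two_form \<zeta>")
  case True
  show ?thesis
    unfolding anti_self_dual_def mem_Collect_eq two_form_eq_iff[OF two_form_hodge two_form_linear(4)[OF True]]
      hodge_table[OF True] bilin_mat_linear
    by auto
qed (simp add: anti_self_dual_def)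

lemma sd_iff: "\<zeta> \<in> self_dual (g x) (J x) \<longleftrightarrow> two_form \<zeta> \<and> bilin \<zeta> (e 3) (e 4) = - bilin \<zeta> (e 1) (e 2)
    \<and> bilin \<zeta> (e 2) (e 4) = bilin \<zeta> (e 1) (e 3) \<and> bilin \<zeta> (e 2) (e 3) = - bilin \<zeta> (e 1) (e 4)"
proof (cases "two_form \<zeta>")
  case True
  show ?thesis
    unfolding self_dual_def mem_Collect_eq two_form_eq_iff[OF two_form_hodge True]
      hodge_table[OF True] bilin_mat_linear
    by auto
qed (simp add: self_dual_def)

lemma two_form_parts:
  "two_form \<zeta> \<Longrightarrow> two_form (asd_part (g x) (J x) \<zeta>)" "two_form \<zeta> \<Longrightarrow> two_form (sd_part (g x) (J x) \<zeta>)"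
  unfolding asd_part_def sd_part_def by (intro two_form_linear two_form_hodge; assumption)+

lemma asd_part_in: "two_form \<zeta> \<Longrightarrow> asd_part (g x) (J x) \<zeta> \<in> anti_self_dual (g x) (J x)"
  unfolding asd_iff
  by (intro conjI two_form_parts(1)) (simp_all add: asd_part_def bilin_mat_linear hodge_table field_simps)

lemma asd_part_id: "\<zeta> \<in> anti_self_dual (g x) (J x) \<Longrightarrow> asd_part (g x) (J x) \<zeta> = \<zeta>"
  by (simp add: asd_part_def anti_self_dual_def scaleR_2[symmetric])

lemma sd_part_id: "\<zeta> \<in> self_dual (g x) (J x) \<Longrightarrow> sd_part (g x) (J x) \<zeta> = \<zeta>"
  by (simp add: sd_part_def self_dual_def scaleR_2[symmetric])

lemma asd_eqI:
  assumes "\<alpha> \<in> anti_self_dual (g x) (J x)" "\<beta> \<in> anti_self_dual (g x) (J x)"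
    and "bilin \<alpha> (e 1) (e 2) = bilin \<beta> (e 1) (e 2)" "bilin \<alpha> (e 1) (e 3) = bilin \<beta> (e 1) (e 3)"
      "bilin \<alpha> (e 1) (e 4) = bilin \<beta> (e 1) (e 4)"
  shows "\<alpha> = \<beta>"
  using assms unfolding asd_iff by (simp add: two_form_eq_iff)

lemma weyl_op_two_form: "two_form (weyl_op g x \<zeta>)"
proof -
  have "r b a d c
     - (ric b c * inn x (e a) (e d) + inn x (e b) (e c) * ric a d
        - ric b d * inn x (e a) (e c) - inn x (e b) (e d) * ric a c) / 2
     + scalar_curvature g x * (inn x (e b) (e c) * inn x (e a) (e d) - inn x (e b) (e d) * inn x (e a) (e c)) / 6
     = - (r a b d c
     - (ric a c * inn x (e b) (e d) + inn x (e a) (e c) * ric b d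
        - ric a d * inn x (e b) (e c) - inn x (e a) (e d) * ric b c) / 2
     + scalar_curvature g x * (inn x (e a) (e c) * inn x (e b) (e d) - inn x (e a) (e d) * inn x (e b) (e c)) / 6)" for a b c d
    by (subst r_skew(1)) (simp add: field_simps)
  then show ?thesis
    unfolding two_form_iff weyl_op_frame by (intro allI sum_skew)
qed

text \<open>On a Kaehler surface W^+ is determined by the scalar curvature. Here the scalar-flat
  condition eliminates \<open>r 2 4 2 4\<close>, after which every entry cancels.\<close>

lemma weyl_plus_eq_0:
  assumes flat: "scalar_curvature g x = 0" and \<zeta>: "\<zeta> \<in> self_dual (g x) (J x)"
  shows "weyl_plus g J x \<zeta> = 0"
proof -
  have z: "two_form \<zeta>" and *: "bilin \<zeta> (e 3) (e 4) = - bilin \<zeta> (e 1) (e 2)"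
    "bilin \<zeta> (e 2) (e 4) = bilin \<zeta> (e 1) (e 3)" "bilin \<zeta> (e 2) (e 3) = - bilin \<zeta> (e 1) (e 4)"
    using \<zeta> unfolding sd_iff by auto
  have s: "r 2 4 2 4 = - (2 * r 1 2 1 2 + 2 * r 1 4 1 4 + r 1 3 1 3)"
    using scalar_table flat by simp
  note w = weyl_op_frame[of \<zeta>, unfolded flat]
  show ?thesis
    unfolding weyl_plus_def sd_part_id[OF \<zeta>]
      two_form_eq_iff[OF two_form_parts(2)[OF weyl_op_two_form] two_form_linear(5)]
    by (simp add: sd_part_def bilin_mat_linear hodge_table[OF weyl_op_two_form] w sum_4 orthonormal two_form_table[OF z] * r_table ric_table s field_simps)
qed

lemma ricci_form_table:
  "bilin (ricci_form g J x) (e 1) (e 2) = - ric 1 4" "bilin (ricci_form g J x) (e 1) (e 3) = ric 1 1"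
  "bilin (ricci_form g J x) (e 1) (e 4) = ric 1 2"
  by (simp_all add: ricci_form_frame J_e bilin_simps ric_def[symmetric] ric_table)

text \<open>The Ricci tensor is \<open>J\<close>-invariant, so \<rho> is of type (1,1); its
  component along the Kaehler form is a multiple of the scalar curvature. Primitive (1,1)-forms on a
  complex surface are anti-self-dual.\<close>

lemma ricci_form_asd:
  assumes flat: "scalar_curvature g x = 0"
  shows "ricci_form g J x \<in> anti_self_dual (g x) (J x)"
proof -
  have s: "r 2 4 2 4 = - (2 * r 1 2 1 2 + 2 * r 1 4 1 4 + r 1 3 1 3)"
    using scalar_table flat by simp
  show ?thesis
    unfolding asd_iff two_form_iff forall_4
    by (simp add: ricci_form_frame J_e bilin_simps ric_def[symmetric] ric_table s)
qed

lemma form_inner_asd: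
  assumes "\<alpha> \<in> anti_self_dual (g x) (J x)" "\<beta> \<in> anti_self_dual (g x) (J x)"
  shows "form_inner (g x) \<alpha> \<beta> = 2 * (bilin \<alpha> (e 1) (e 2) * bilin \<beta> (e 1) (e 2) +
     bilin \<alpha> (e 1) (e 3) * bilin \<beta> (e 1) (e 3) + bilin \<alpha> (e 1) (e 4) * bilin \<beta> (e 1) (e 4))"
  using assms unfolding asd_iff form_inner_frame by (simp add: sum_4 two_form_table)

lemma weyl_minus_asd: "\<zeta> \<in> anti_self_dual (g x) (J x) \<Longrightarrow> weyl_minus g J x \<zeta> \<in> anti_self_dual (g x) (J x)"
  unfolding weyl_minus_def asd_part_id by (intro asd_part_in weyl_op_two_form)

text \<open>An anti-self-dual form is determined by its components 12, 13, 14, and this is the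
  matrix of W^- in them. The three vanishing components in \<open>hor\<close> separate the first
  coordinate from the other two. The diagonal sums to zero, as the trace of a Weyl operator
  must.\<close>

lemma weyl_minus_table:
  assumes flat: "scalar_curvature g x = 0" and \<zeta>: "\<zeta> \<in> anti_self_dual (g x) (J x)"
    and hor: "r 1 2 1 3 = 0" "r 1 2 1 4 = 0" "r 1 2 2 4 = 0"
  shows "bilin (weyl_minus g J x \<zeta>) (e 1) (e 2) = - 2 * r 1 2 1 2 * bilin \<zeta> (e 1) (e 2)" (is ?P1)
    "bilin (weyl_minus g J x \<zeta>) (e 1) (e 3) = 2 * (r 1 2 1 2 + r 1 4 1 4) * bilin \<zeta> (e 1) (e 3)
      + (r 2 4 1 4 - r 1 3 1 4) * bilin \<zeta> (e 1) (e 4)" (is ?P2)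
    "bilin (weyl_minus g J x \<zeta>) (e 1) (e 4) = (r 2 4 1 4 - r 1 3 1 4) * bilin \<zeta> (e 1) (e 3)
      - 2 * r 1 4 1 4 * bilin \<zeta> (e 1) (e 4)" (is ?P3)
proof -
  have z: "two_form \<zeta>" and *: "bilin \<zeta> (e 3) (e 4) = bilin \<zeta> (e 1) (e 2)"
    "bilin \<zeta> (e 2) (e 4) = - bilin \<zeta> (e 1) (e 3)" "bilin \<zeta> (e 2) (e 3) = bilin \<zeta> (e 1) (e 4)"
    using \<zeta> unfolding asd_iff by auto
  have s: "r 2 4 2 4 = - (2 * r 1 2 1 2 + 2 * r 1 4 1 4 + r 1 3 1 3)"
    using scalar_table flat by simp
  note w = weyl_op_frame[of \<zeta>, unfolded flat]
  note simps = asd_part_def bilin_mat_linear hodge_table[OF weyl_op_two_form] w sum_4 orthonormal two_form_table[OF z] * r_table ric_table s hor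
  show ?P1 ?P2 ?P3
    unfolding weyl_minus_def asd_part_id[OF \<zeta>]
    by (simp_all add: simps field_simps)
qed

end

context kahler_frame
begin

text \<open>The form has only a 12 component, so the decoupled first row of
  \<open>weyl_minus_table\<close> applies; its eigenvalue \<open>- 2 * r 1 2 1 2\<close> is twice
  the sectional curvature of the plane of \<open>e 1, e 2\<close>.\<close>

lemma r_horizontal_eigenform:
  assumes flat: "scalar_curvature g x = 0" and \<zeta>: "\<zeta> \<in> anti_self_dual (g x) (J x)"
    and hor: "r 1 2 1 3 = 0" "r 1 2 1 4 = 0" "r 1 2 2 4 = 0"
    and z: "bilin \<zeta> (e 1) (e 3) = 0" "bilin \<zeta> (e 1) (e 4) = 0"
  shows "weyl_minus g J x \<zeta> = (2 * r 1 2 2 1) *\<^sub>R \<zeta>"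
  by (rule asd_eqI[OF weyl_minus_asd[OF \<zeta>]])
     (use \<zeta> in \<open>auto simp: weyl_minus_table[OF flat \<zeta> hor] bilin_mat_linear z r_table asd_iff two_form_linear\<close>)

text \<open>Under these conditions \<rho> has only the component 13, and the matrix of W^- is
  diagonal with entries 2K, -4K, 2K, where K is \<open>r 1 2 2 1\<close>. It therefore equals 2K
  times the identity minus 6K times the projection onto the line of \<rho>.\<close>

lemma weyl_minus_rank_one:
  assumes flat: "scalar_curvature g x = 0" and \<zeta>: "\<zeta> \<in> anti_self_dual (g x) (J x)"
    and hor: "r 1 2 1 3 = 0" "r 1 2 1 4 = 0" "r 1 2 2 4 = 0"
    and r: "r 1 3 1 4 = 0" "r 2 4 1 4 = 0" "r 1 4 1 4 = r 1 2 1 2" and ne: "ric 1 1 \<noteq> 0"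
  defines "\<rho> \<equiv> ricci_form g J x"
  shows "weyl_minus g J x \<zeta> = (- r 1 2 2 1) *\<^sub>R
    ((6 / form_inner (g x) \<rho> \<rho> * form_inner (g x) \<rho> \<zeta>) *\<^sub>R \<rho> - 2 *\<^sub>R \<zeta>)"
proof (rule asd_eqI[OF weyl_minus_asd[OF \<zeta>]])
  have \<rho>: "\<rho> \<in> anti_self_dual (g x) (J x)"
    unfolding \<rho>_def by (rule ricci_form_asd[OF flat])
  have asd: "a *\<^sub>R (b *\<^sub>R \<alpha> - c *\<^sub>R \<beta>) \<in> anti_self_dual (g x) (J x)"
    if "\<alpha> \<in> anti_self_dual (g x) (J x)" "\<beta> \<in> anti_self_dual (g x) (J x)" for a b c \<alpha> \<beta>
    using that unfolding asd_iff by (auto simp: two_form_linear bilin_mat_linear algebra_simps)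
  show "(- r 1 2 2 1) *\<^sub>R ((6 / form_inner (g x) \<rho> \<rho> * form_inner (g x) \<rho> \<zeta>) *\<^sub>R \<rho> - 2 *\<^sub>R \<zeta>)
      \<in> anti_self_dual (g x) (J x)"
    by (rule asd[OF \<rho> \<zeta>])
  have \<rho>t: "bilin \<rho> (e 1) (e 2) = 0" "bilin \<rho> (e 1) (e 3) = ric 1 1" "bilin \<rho> (e 1) (e 4) = 0"
    unfolding \<rho>_def by (simp_all add: ricci_form_table ric_table hor r)
  show "bilin (weyl_minus g J x \<zeta>) (e 1) (e 2) = bilin ((- r 1 2 2 1) *\<^sub>R ((6 / form_inner (g x) \<rho> \<rho> * form_inner (g x) \<rho> \<zeta>) *\<^sub>R \<rho> - 2 *\<^sub>R \<zeta>)) (e 1) (e 2)"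
    "bilin (weyl_minus g J x \<zeta>) (e 1) (e 3) = bilin ((- r 1 2 2 1) *\<^sub>R ((6 / form_inner (g x) \<rho> \<rho> * form_inner (g x) \<rho> \<zeta>) *\<^sub>R \<rho> - 2 *\<^sub>R \<zeta>)) (e 1) (e 3)"
    "bilin (weyl_minus g J x \<zeta>) (e 1) (e 4) = bilin ((- r 1 2 2 1) *\<^sub>R ((6 / form_inner (g x) \<rho> \<rho> * form_inner (g x) \<rho> \<zeta>) *\<^sub>R \<rho> - 2 *\<^sub>R \<zeta>)) (e 1) (e 4)"
    unfolding weyl_minus_table[OF flat \<zeta> hor] bilin_mat_linear form_inner_asd[OF \<rho> \<zeta>] form_inner_asd[OF \<rho> \<rho>] \<rho>t r
    using ne by (simp_all add: r_table field_simps)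
qed

end

section \<open>Existence of unitary frames\<close>

locale kahler_surface = kahler U g J for U :: "(real^4) set" and g J
begin

lemma unitary_frame:
  assumes x: "x \<in> U" and "inn x e1 e1 = 1" "inn x e2 e2 = 1" "inn x e1 e2 = 0" "inn x e1 (J x *v e2) = 0"
  shows "kahler_frame U g J x (\<lambda>a. if a = 1 then e1 else if a = 2 then e2 else if a = 3 then J x *v e1 else J x *v e2)"
    (is "kahler_frame U g J x ?e")
proof
  have J0: "inn x v (J x *v v) = 0" for v
    using inn_J[OF x, of v v] inn_sym[OF x, of v "J x *v v"] by simp
  have "inn x e2 e1 = 0" "inn x (J x *v e2) e1 = 0" "inn x e2 (J x *v e1) = 0" "inn x (J x *v e1) e2 = 0"
    using assms inn_sym[OF x] inn_J[OF x, of e2 e1] inn_J[OF x, of e1 e2] by simp_all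
  then have "\<forall>a b. inn x (?e a) (?e b) = (if a = b then 1 else 0)"
    unfolding forall_4 using assms by (simp add: inn_J_J J0 inn_J[OF x, of e1 e1] inn_J[OF x, of e2 e2])
  then show "inn x (?e a) (?e b) = (if a = b then 1 else 0)" for a b by blast
qed (use x in auto)

lemma normalize:
  assumes x: "x \<in> U" and v: "v \<noteq> 0"
  obtains c where "c \<noteq> 0" "inn x (c *\<^sub>R v) (c *\<^sub>R v) = 1"
proof
  have p: "inn x v v > 0" by (rule inn_pos[OF x v])
  then show "inverse (sqrt (inn x v v)) \<noteq> 0" by simp
  show "inn x (inverse (sqrt (inn x v v)) *\<^sub>R v) (inverse (sqrt (inn x v v)) *\<^sub>R v) = 1"
    using p by (simp add: bilin_scale field_simps)
qed

text \<open>For the pointwise algebra at points outside the regular set, where no horizontal plane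
  is available.\<close>

lemma unitary_frame_exists:
  assumes x: "x \<in> U"
  obtains e where "kahler_frame U g J x e"
proof -
  have "axis 1 1 \<noteq> (0 :: real^4)" by (simp add: axis_eq_0_iff)
  then obtain c where c: "inn x (c *\<^sub>R axis 1 1) (c *\<^sub>R axis 1 1) = 1" using normalize[OF x] by metis
  let ?e1 = "c *\<^sub>R axis 1 1 :: real^4"
  \<comment> \<open>Euclidean orthogonality to these two vectors is \<open>g\<close>-orthogonality
    to \<open>?e1\<close> and to \<open>J ?e1\<close>; a nonzero solution exists because two vectors
    do not span four dimensions.\<close>
  let ?S = "{g x *v ?e1, g x *v (J x *v ?e1)}"
  have "dim ?S \<le> card ?S" by (rule dim_le_card) (auto intro: span_base)
  also have "\<dots> \<le> 2" by (simp add: card_insert_le_m1)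
  finally have "dim ?S < DIM(real^4)" by simp
  then obtain w where w: "w \<noteq> 0" "\<And>y. y \<in> span ?S \<Longrightarrow> orthogonal w y"
    using orthogonal_to_subspace_exists by blast
  then have w0: "inn x w ?e1 = 0" "inn x w (J x *v ?e1) = 0"
    using w(2)[of "g x *v ?e1"] w(2)[of "g x *v (J x *v ?e1)"]
    by (auto simp: orthogonal_def bilin_def span_base)
  obtain d where d: "inn x (d *\<^sub>R w) (d *\<^sub>R w) = 1" using normalize[OF x w(1)] by metis
  have "kahler_frame U g J x (\<lambda>a. if a = 1 then ?e1 else if a = 2 then d *\<^sub>R w else if a = 3 then J x *v ?e1 else J x *v (d *\<^sub>R w))"
  proof (rule unitary_frame[OF x c d])
    have "inn x ?e1 w = 0" using w0(1) by (simp only: inn_sym[OF x, of ?e1 w])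
    then show "inn x ?e1 (d *\<^sub>R w) = 0" unfolding bilin_scale(2) by (simp only: mult_zero_right)
    have "inn x ?e1 (J x *v w) = - inn x (J x *v ?e1) w" using inn_J[OF x, of ?e1 w] by linarith
    also have "\<dots> = 0" using w0(2) by (simp only: inn_sym[OF x, of "J x *v ?e1" w] neg_equal_0_iff_equal)
    finally show "inn x ?e1 (J x *v (d *\<^sub>R w)) = 0"
      unfolding matrix_vector_mult_scaleR bilin_scale(2)[of _ _ d] by (simp only: mult_zero_right)
  qed
  then show ?thesis using that by blast
qed

end

sublocale toric_local \<subseteq> kahler_surface ..

context toric_local
begin

text \<open>Gram-Schmidt applied to the two gradients; the remaining requirement, that
  \<open>e 1\<close> is orthogonal to \<open>J e 2\<close>, is \<open>hor_J\<close>.\<close>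

lemma hor_frame:
  assumes x: "x \<in> U"
  obtains e where "kahler_frame U g J x e" "hor x (e 1)" "hor x (e 2)"
proof -
  have V1: "V 1 x \<noteq> 0" using indep_V[OF x, of 1 0] by auto
  then obtain c where c: "c \<noteq> 0" "inn x (c *\<^sub>R V 1 x) (c *\<^sub>R V 1 x) = 1" using normalize[OF x] by metis
  let ?e1 = "c *\<^sub>R V 1 x"
  let ?w = "V 2 x - inn x (V 2 x) ?e1 *\<^sub>R ?e1"
  have "?w \<noteq> 0"
  proof
    assume "?w = 0"
    then have "(- inn x (V 2 x) ?e1 * c) *\<^sub>R V 1 x + 1 *\<^sub>R V 2 x = 0" by simp
    then show False using indep_V[OF x] by (metis zero_neq_one)
  qed
  then obtain d where d: "d \<noteq> 0" "inn x (d *\<^sub>R ?w) (d *\<^sub>R ?w) = 1" using normalize[OF x] by metis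
  have h: "hor x ?e1" "hor x (d *\<^sub>R ?w)" by (intro hor_lin hor_V x)+
  have "inn x ?e1 (d *\<^sub>R ?w) = d * (inn x ?e1 (V 2 x) - inn x (V 2 x) ?e1 * inn x ?e1 ?e1)"
    by (simp only: bilin_scale(2)[of _ _ d] bilin_diff(2) bilin_scale(2)[of _ _ "inn x (V 2 x) ?e1"])
  also have "\<dots> = 0" unfolding c(2) by (simp add: inn_sym[OF x, of "V 2 x"] bilin_scale)
  finally have o: "inn x ?e1 (d *\<^sub>R ?w) = 0" .
  show ?thesis
    by (rule that[OF unitary_frame[OF x c(2) d(2) o hor_J[OF x h]]]) (use h in auto)
qed

end

context toric_quotient
begin

text \<open>The curvature of horizontal vectors is horizontal, and \<open>e 3, e 4\<close> are
  \<open>J\<close>-images of horizontal vectors, hence orthogonal to it.\<close>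

lemma frame_curvature_hor:
  assumes x: "x \<in> U" and e: "kahler_frame U g J x e" and h: "hor x (e 1)" "hor x (e 2)"
  shows "kahler_frame.r g x e 1 2 1 3 = 0" "kahler_frame.r g x e 1 2 1 4 = 0" "kahler_frame.r g x e 1 2 2 4 = 0"
    "kahler_frame.r g x e 1 2 2 1 = gauss_curvature h (F x)"
proof -
  interpret f: kahler_frame U g J x e by fact
  show "f.r 1 2 1 3 = 0" "f.r 1 2 1 4 = 0" "f.r 1 2 2 4 = 0"
    unfolding f.r_def Rm_def f.e3 f.e4 by (intro hor_J x curv_hor h)+
  show "f.r 1 2 2 1 = gauss_curvature h (F x)"
    unfolding f.r_def using Rm_hor[OF x h] by (simp add: f.orthonormal)
qed

definition omega where "omega x = (let d1 = differential (\<phi> 1) x; d2 = differential (\<phi> 2) x; Jt = transpose (J x)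
      in wedge d1 d2 + wedge (Jt *v d1) (Jt *v d2))"

text \<open>The differentials of the moment functions vanish on \<open>e 3, e 4\<close>, and their
  compositions with \<open>J\<close> vanish on \<open>e 1, e 2\<close>. So the form is a multiple of
  the anti-self-dual form \<open>e1 e2 + e3 e4\<close>, the factor being the determinant of the
  gradients in the basis \<open>e 1, e 2\<close>.\<close>

lemma omega_eigenform:
  assumes x: "x \<in> U" and flat: "scalar_curvature g x = 0"
  shows "omega x \<in> anti_self_dual (g x) (J x)" "omega x \<noteq> 0"
    "weyl_minus g J x (omega x) = (2 * gauss_curvature h (F x)) *\<^sub>R omega x" (is ?P1)
proof -
  obtain e where e: "kahler_frame U g J x e" and h: "hor x (e 1)" "hor x (e 2)" by (rule hor_frame[OF x])
  interpret f: kahler_frame U g J x e by (rule e)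
  have d: "v \<bullet> differential (\<phi> i) x = inn x (V i x) v" for v i
    unfolding inn_grad[OF x] by (simp add: dirv_def differential_def inner_vec_def)
  have w: "bilin (omega x) v w = (inn x (V 1 x) v * inn x (V 2 x) w - inn x (V 1 x) w * inn x (V 2 x) v)
     + (inn x (V 1 x) (J x *v v) * inn x (V 2 x) (J x *v w) - inn x (V 1 x) (J x *v w) * inn x (V 2 x) (J x *v v))" for v w
    unfolding omega_def Let_def bilin_mat_linear bilin_wedge inner_transpose_mult d by simp
  have z: "inn x (V i x) (e 3) = 0" "inn x (V i x) (e 4) = 0" for i
    unfolding f.e3 f.e4 by (intro hor_J x hor_V h)+
  show asd: "omega x \<in> anti_self_dual (g x) (J x)"
    unfolding f.asd_iff f.two_form_iff w f.J_e by (simp add: f.J_e z bilin_simps)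
  show ?P1
    unfolding frame_curvature_hor(4)[OF x e h, symmetric]
    by (rule f.r_horizontal_eigenform[OF flat asd frame_curvature_hor(1-3)[OF x e h]])
       (simp_all add: w f.J_e z bilin_simps)
  have V: "V i x = inn x (V i x) (e 1) *\<^sub>R e 1 + inn x (V i x) (e 2) *\<^sub>R e 2" for i
    by (subst f.expand[of "V i x", symmetric]) (simp add: sum_4 z)
  show "omega x \<noteq> 0"
  proof
    assume 0: "omega x = 0"
    let ?a = "\<lambda>i j. inn x (V i x) (e j)"
    have det: "?a 1 1 * ?a 2 2 - ?a 1 2 * ?a 2 1 = 0"
      using w[of "e 1" "e 2"] unfolding 0 bilin_mat_linear f.J_e z by simp
    have "?a 2 j *\<^sub>R V 1 x + (- ?a 1 j) *\<^sub>R V 2 x = 0" if "j = 1 \<or> j = 2" for j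
    proof -
      have "?a 2 j *\<^sub>R (?a 1 1 *\<^sub>R e 1 + ?a 1 2 *\<^sub>R e 2) + (- ?a 1 j) *\<^sub>R (?a 2 1 *\<^sub>R e 1 + ?a 2 2 *\<^sub>R e 2) =
         (?a 2 j * ?a 1 1 - ?a 1 j * ?a 2 1) *\<^sub>R e 1 + (?a 2 j * ?a 1 2 - ?a 1 j * ?a 2 2) *\<^sub>R e 2"
        by (simp add: algebra_simps)
      also have "\<dots> = 0" using that det by (auto simp: algebra_simps)
      finally show ?thesis unfolding V[symmetric] .
    qed
    then have "?a 1 1 = 0" "?a 1 2 = 0" using indep_V[OF x] by (metis neg_equal_0_iff_equal)+
    then have "V 1 x = 0" using V[of 1] by simp
    then show False using indep_V[OF x, of 1 0] by simp
  qed
qed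

end

section \<open>Curvature of the generalized Taub-NUT metrics\<close>

text \<open>Below, \<open>\<alpha> = 1 + k\<close>, \<open>\<beta> = 1 - k\<close>, \<open>c = 2 / M\<close>, \<open>\<kappa> = 1 / (sqrt 2 * M)\<close>.  The functions
  \<open>hess11\<close>, \<open>hess12\<close>, \<open>hess22\<close> give the Hessian of the first moment function in the frame
  \<open>\<nabla>u, \<nabla>v\<close>; exchanging \<open>u, v\<close> and \<open>\<alpha>, \<beta>\<close> gives that of the second.\<close>

definition hess11 :: "real \<Rightarrow> real \<Rightarrow> real \<Rightarrow> real \<Rightarrow> real \<Rightarrow> real \<Rightarrow> real" where
  "hess11 \<alpha> \<beta> c \<kappa> u v = 2 * \<kappa> * v\<^sup>2 * (\<alpha> + \<beta> + \<alpha> * \<beta> * (u\<^sup>2 + v\<^sup>2)) / (c * (1 + \<alpha> * u\<^sup>2 + \<beta> * v\<^sup>2)\<^sup>2)"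
definition hess12 :: "real \<Rightarrow> real \<Rightarrow> real \<Rightarrow> real \<Rightarrow> real \<Rightarrow> real \<Rightarrow> real" where
  "hess12 \<alpha> \<beta> c \<kappa> u v = 2 * \<alpha> * \<kappa> * u * v / (c * (1 + \<alpha> * u\<^sup>2 + \<beta> * v\<^sup>2))"
definition hess22 :: "real \<Rightarrow> real \<Rightarrow> real \<Rightarrow> real \<Rightarrow> real \<Rightarrow> real \<Rightarrow> real" where
  "hess22 \<alpha> \<beta> c \<kappa> u v = 2 * \<kappa> * ((1 + \<alpha> * u\<^sup>2)\<^sup>2 + \<alpha>\<^sup>2 * u\<^sup>2 * v\<^sup>2) / (c * (1 + \<alpha> * u\<^sup>2 + \<beta> * v\<^sup>2)\<^sup>2)"

text \<open>Each left side is a component of the derivative of the first moment gradient as it comes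
  out of \<open>cov_frame_sum\<close>: \<open>1 / (c * L)\<close> is the Gram entry \<eta>, the
  fractions with \<open>L\<^sup>2\<close> are its partial derivatives, and the remaining factors are
  the components \<open>\<psi> 1 m\<close> and their derivatives.\<close>

lemma hess_eqs:
  fixes u v \<alpha> \<beta> c \<kappa> L :: real
  assumes L: "L = 1 + \<alpha> * u\<^sup>2 + \<beta> * v\<^sup>2" and L0: "L \<noteq> 0" and c: "c \<noteq> 0"
  shows "1 / (c * L) * (2 * \<alpha> * \<kappa> * v\<^sup>2)
       + (2 * \<alpha> * \<kappa> * u * v\<^sup>2 * (- 2 * \<alpha> * u / (c * L\<^sup>2)) - 2 * \<kappa> * v * (1 + \<alpha> * u\<^sup>2) * (- 2 * \<beta> * v / (c * L\<^sup>2))) / 2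
       = hess11 \<alpha> \<beta> c \<kappa> u v" (is ?P1)
    and "1 / (c * L) * (4 * \<alpha> * \<kappa> * u * v)
       + (2 * \<alpha> * \<kappa> * u * v\<^sup>2 * (- 2 * \<beta> * v / (c * L\<^sup>2)) + 2 * \<kappa> * v * (1 + \<alpha> * u\<^sup>2) * (- 2 * \<alpha> * u / (c * L\<^sup>2))) / 2
       = hess12 \<alpha> \<beta> c \<kappa> u v" (is ?P2)
    and "1 / (c * L) * (2 * \<kappa> * (1 + \<alpha> * u\<^sup>2))
       + (2 * \<kappa> * v * (1 + \<alpha> * u\<^sup>2) * (- 2 * \<beta> * v / (c * L\<^sup>2)) - 2 * \<alpha> * \<kappa> * u * v\<^sup>2 * (- 2 * \<alpha> * u / (c * L\<^sup>2))) / 2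
       = hess22 \<alpha> \<beta> c \<kappa> u v" (is ?P3)
proof -
  have a: "\<alpha> * u\<^sup>2 = L - 1 - \<beta> * v\<^sup>2" using L by simp
  have 1: "\<alpha> * L - \<alpha> * (\<alpha> * u\<^sup>2) + (1 + \<alpha> * u\<^sup>2) * \<beta> = \<alpha> + \<beta> + \<alpha> * \<beta> * (u\<^sup>2 + v\<^sup>2)"
    unfolding L by (simp add: algebra_simps power2_eq_square)
  have "1 / (c * L) * (2 * \<alpha> * \<kappa> * v\<^sup>2)
       + (2 * \<alpha> * \<kappa> * u * v\<^sup>2 * (- 2 * \<alpha> * u / (c * L\<^sup>2)) - 2 * \<kappa> * v * (1 + \<alpha> * u\<^sup>2) * (- 2 * \<beta> * v / (c * L\<^sup>2))) / 2
     = 2 * \<kappa> * v\<^sup>2 * (\<alpha> * L - \<alpha> * (\<alpha> * u\<^sup>2) + (1 + \<alpha> * u\<^sup>2) * \<beta>) / (c * L\<^sup>2)"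
    using L0 c by (simp add: field_simps power2_eq_square)
  then show ?P1
    unfolding 1 by (simp add: hess11_def L)
  have h12: "hess12 \<alpha> \<beta> c \<kappa> u v = 2 * \<alpha> * \<kappa> * u * v / (c * L)"
    by (simp add: hess12_def L)
  have 2: "2 * L - \<beta> * v\<^sup>2 - (1 + \<alpha> * u\<^sup>2) = L"
    unfolding L by simp
  have "1 / (c * L) * (4 * \<alpha> * \<kappa> * u * v)
       + (2 * \<alpha> * \<kappa> * u * v\<^sup>2 * (- 2 * \<beta> * v / (c * L\<^sup>2)) + 2 * \<kappa> * v * (1 + \<alpha> * u\<^sup>2) * (- 2 * \<alpha> * u / (c * L\<^sup>2))) / 2
     = 2 * \<alpha> * \<kappa> * u * v * (2 * L - \<beta> * v\<^sup>2 - (1 + \<alpha> * u\<^sup>2)) / (c * L\<^sup>2)"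
    using L0 c by (simp add: field_simps power2_eq_square)
  then show ?P2
    unfolding 2 h12 using L0 c by (simp add: field_simps power2_eq_square)
  have 3: "(1 + \<alpha> * u\<^sup>2) * (L - \<beta> * v\<^sup>2) + \<alpha>\<^sup>2 * u\<^sup>2 * v\<^sup>2 = (1 + \<alpha> * u\<^sup>2)\<^sup>2 + \<alpha>\<^sup>2 * u\<^sup>2 * v\<^sup>2"
    unfolding L by (simp add: algebra_simps power2_eq_square)
  have "1 / (c * L) * (2 * \<kappa> * (1 + \<alpha> * u\<^sup>2))
       + (2 * \<kappa> * v * (1 + \<alpha> * u\<^sup>2) * (- 2 * \<beta> * v / (c * L\<^sup>2)) - 2 * \<alpha> * \<kappa> * u * v\<^sup>2 * (- 2 * \<alpha> * u / (c * L\<^sup>2))) / 2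
     = 2 * \<kappa> * ((1 + \<alpha> * u\<^sup>2) * (L - \<beta> * v\<^sup>2) + \<alpha>\<^sup>2 * u\<^sup>2 * v\<^sup>2) / (c * L\<^sup>2)"
    using L0 c by (simp add: field_simps power2_eq_square)
  then show ?P3
    unfolding 3 by (simp add: hess22_def L)
qed

text \<open>The point is the factorization: every second covariant derivative is a component of the
  gradient times a factor. Exchanging \<open>u, v\<close> and \<open>\<alpha>, \<beta>\<close> only
  permutes these factors, so both moment functions yield the same ones, and these are curvature
  components.\<close>

lemma gtn_third_derivative:
  fixes u v \<alpha> \<beta> c \<kappa> L :: real
  assumes L: "L = 1 + \<alpha> * u\<^sup>2 + \<beta> * v\<^sup>2" and L0: "L \<noteq> 0" and c: "c \<noteq> 0"
  defines "N \<equiv> \<alpha> + \<beta> + \<alpha> * \<beta> * (u\<^sup>2 + v\<^sup>2)" and "Q \<equiv> (1 + \<alpha> * u\<^sup>2)\<^sup>2 + \<alpha>\<^sup>2 * u\<^sup>2 * v\<^sup>2"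
  defines "B \<equiv> (\<alpha> + \<beta> - \<alpha> * (\<alpha> - \<beta>) * u\<^sup>2 + \<beta> * (\<alpha> - \<beta>) * v\<^sup>2) / (c\<^sup>2 * L ^ 4)"
  shows "1 / (c * L) * (2 * \<kappa> * v\<^sup>2 * (2 * \<alpha> * \<beta> * u * L - 4 * \<alpha> * u * N) / (c * L ^ 3))
      - (- 2 * \<beta> * v / (c * L\<^sup>2)) * hess12 \<alpha> \<beta> c \<kappa> u v
      = 2 * \<alpha> * \<kappa> * u * v\<^sup>2 * ((- 4 * \<alpha> - 4 * \<beta> * (\<alpha> - \<beta>) * v\<^sup>2) / (c\<^sup>2 * L ^ 4))" (is ?A)
    and "1 / (c * L) * (2 * \<alpha> * \<kappa> * v * (L - 2 * \<alpha> * u\<^sup>2) / (c * L\<^sup>2))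
      + (- 2 * \<beta> * v / (c * L\<^sup>2)) * (hess11 \<alpha> \<beta> c \<kappa> u v - hess22 \<alpha> \<beta> c \<kappa> u v) / 2
      = 2 * \<kappa> * v * (1 + \<alpha> * u\<^sup>2) * B" (is ?B)
    and "1 / (c * L) * (2 * \<alpha> * \<kappa> * u * (L - 2 * \<beta> * v\<^sup>2) / (c * L\<^sup>2))
      + (- 2 * \<alpha> * u / (c * L\<^sup>2)) * (hess22 \<alpha> \<beta> c \<kappa> u v - hess11 \<alpha> \<beta> c \<kappa> u v) / 2
      = 2 * \<alpha> * \<kappa> * u * v\<^sup>2 * B" (is ?C)
    and "1 / (c * L) * (2 * \<kappa> * (2 * \<alpha>\<^sup>2 * u\<^sup>2 * v * L - 4 * \<beta> * v * Q) / (c * L ^ 3))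
      - (- 2 * \<alpha> * u / (c * L\<^sup>2)) * hess12 \<alpha> \<beta> c \<kappa> u v
      = 2 * \<kappa> * v * (1 + \<alpha> * u\<^sup>2) * ((- 4 * \<beta> + 4 * \<alpha> * (\<alpha> - \<beta>) * u\<^sup>2) / (c\<^sup>2 * L ^ 4))" (is ?D)
proof -
  have h: "hess11 \<alpha> \<beta> c \<kappa> u v = 2 * \<kappa> * v\<^sup>2 * N / (c * L\<^sup>2)" "hess12 \<alpha> \<beta> c \<kappa> u v = 2 * \<alpha> * \<kappa> * u * v / (c * L)"
    "hess22 \<alpha> \<beta> c \<kappa> u v = 2 * \<kappa> * Q / (c * L\<^sup>2)"
    by (simp_all add: hess11_def hess12_def hess22_def N_def Q_def L)
  have 1: "\<beta> * L - N = - \<alpha> - \<beta> * (\<alpha> - \<beta>) * v\<^sup>2"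
    unfolding L N_def by (simp add: algebra_simps power2_eq_square)
  have "1 / (c * L) * (2 * \<kappa> * v\<^sup>2 * (2 * \<alpha> * \<beta> * u * L - 4 * \<alpha> * u * N) / (c * L ^ 3))
      - (- 2 * \<beta> * v / (c * L\<^sup>2)) * hess12 \<alpha> \<beta> c \<kappa> u v
      = 8 * \<alpha> * \<kappa> * u * v\<^sup>2 * (\<beta> * L - N) / (c\<^sup>2 * L ^ 4)"
    unfolding h using L0 c by (simp add: field_simps power2_eq_square power3_eq_cube power4_eq_xxxx)
  then show ?A unfolding 1 by (simp add: algebra_simps)
  have 2: "\<alpha> * L * (L - 2 * \<alpha> * u\<^sup>2) - \<beta> * (v\<^sup>2 * N - Q)
     = (1 + \<alpha> * u\<^sup>2) * (\<alpha> + \<beta> - \<alpha> * (\<alpha> - \<beta>) * u\<^sup>2 + \<beta> * (\<alpha> - \<beta>) * v\<^sup>2)"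
    unfolding L N_def Q_def by (simp add: algebra_simps power2_eq_square)
  have "1 / (c * L) * (2 * \<alpha> * \<kappa> * v * (L - 2 * \<alpha> * u\<^sup>2) / (c * L\<^sup>2))
      + (- 2 * \<beta> * v / (c * L\<^sup>2)) * (hess11 \<alpha> \<beta> c \<kappa> u v - hess22 \<alpha> \<beta> c \<kappa> u v) / 2
     = 2 * \<kappa> * v * (\<alpha> * L * (L - 2 * \<alpha> * u\<^sup>2) - \<beta> * (v\<^sup>2 * N - Q)) / (c\<^sup>2 * L ^ 4)"
    unfolding h using L0 c by (simp add: field_simps power2_eq_square power3_eq_cube power4_eq_xxxx)
  then show ?B unfolding 2 B_def by simp
  have 3: "L * (L - 2 * \<beta> * v\<^sup>2) - (Q - v\<^sup>2 * N) = v\<^sup>2 * (\<alpha> + \<beta> - \<alpha> * (\<alpha> - \<beta>) * u\<^sup>2 + \<beta> * (\<alpha> - \<beta>) * v\<^sup>2)"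
    unfolding L N_def Q_def by (simp add: algebra_simps power2_eq_square)
  have "1 / (c * L) * (2 * \<alpha> * \<kappa> * u * (L - 2 * \<beta> * v\<^sup>2) / (c * L\<^sup>2))
      + (- 2 * \<alpha> * u / (c * L\<^sup>2)) * (hess22 \<alpha> \<beta> c \<kappa> u v - hess11 \<alpha> \<beta> c \<kappa> u v) / 2
      = 2 * \<alpha> * \<kappa> * u * (L * (L - 2 * \<beta> * v\<^sup>2) - (Q - v\<^sup>2 * N)) / (c\<^sup>2 * L ^ 4)"
    unfolding h using L0 c by (simp add: field_simps power2_eq_square power3_eq_cube power4_eq_xxxx)
  then show ?C unfolding 3 B_def by simp
  have 4: "2 * \<alpha>\<^sup>2 * u\<^sup>2 * L - 2 * \<beta> * Q = (1 + \<alpha> * u\<^sup>2) * (- 2 * \<beta> + 2 * \<alpha> * (\<alpha> - \<beta>) * u\<^sup>2)"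
    unfolding L Q_def by (simp add: algebra_simps power2_eq_square)
  have "1 / (c * L) * (2 * \<kappa> * (2 * \<alpha>\<^sup>2 * u\<^sup>2 * v * L - 4 * \<beta> * v * Q) / (c * L ^ 3))
      - (- 2 * \<alpha> * u / (c * L\<^sup>2)) * hess12 \<alpha> \<beta> c \<kappa> u v
      = 4 * \<kappa> * v * (2 * \<alpha>\<^sup>2 * u\<^sup>2 * L - 2 * \<beta> * Q) / (c\<^sup>2 * L ^ 4)"
    unfolding h using L0 c by (simp add: field_simps power2_eq_square power3_eq_cube power4_eq_xxxx)
  then show ?D unfolding 4 by (simp add: algebra_simps)
qed

lemma has_derivative_pd12:
  fixes f :: "real^2 \<Rightarrow> real"
  assumes "(f has_derivative (\<lambda>h. A * h $ 1 + B * h $ 2)) (at w)"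
  shows "f differentiable at w" "pd 1 f w = A" "pd 2 f w = B"
  using assms by (auto simp: differentiable_def has_derivative_pd[OF assms] axis_def)

lemma has_derivative_nth [derivative_intros]:
  "((\<lambda>w::real^'n::finite. w $ i) has_derivative (\<lambda>h. h $ i)) (at w)"
  by (rule bounded_linear_imp_has_derivative[OF bounded_linear_vec_nth])

text \<open>Formulated for arbitrary functions \<open>a, b\<close> in place of the coordinates, so
  that it applies in both orders of the coordinates and hence to both moment functions.\<close>

lemma has_derivative_hess:
  fixes \<alpha> \<beta> c \<kappa> :: real and a b :: "real^2 \<Rightarrow> real"
  assumes a: "(a has_derivative a') (at w)" and b: "(b has_derivative b') (at w)"
  defines "u \<equiv> a w" and "v \<equiv> b w"
  defines "L \<equiv> 1 + \<alpha> * u\<^sup>2 + \<beta> * v\<^sup>2"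
  defines "N \<equiv> \<alpha> + \<beta> + \<alpha> * \<beta> * (u\<^sup>2 + v\<^sup>2)" and "Q \<equiv> (1 + \<alpha> * u\<^sup>2)\<^sup>2 + \<alpha>\<^sup>2 * u\<^sup>2 * v\<^sup>2"
  assumes L0: "L \<noteq> 0" and c: "c \<noteq> 0"
  shows "((\<lambda>w. 1 / (c * (1 + \<alpha> * (a w)\<^sup>2 + \<beta> * (b w)\<^sup>2))) has_derivative
      (\<lambda>h. - 2 * \<alpha> * u / (c * L\<^sup>2) * a' h + - 2 * \<beta> * v / (c * L\<^sup>2) * b' h)) (at w)" (is ?P1)
    "((\<lambda>w. hess11 \<alpha> \<beta> c \<kappa> (a w) (b w)) has_derivative
      (\<lambda>h. 2 * \<kappa> * v\<^sup>2 * (2 * \<alpha> * \<beta> * u * L - 4 * \<alpha> * u * N) / (c * L ^ 3) * a' h +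
        2 * \<kappa> * ((2 * v * N + 2 * \<alpha> * \<beta> * v ^ 3) * L - 4 * \<beta> * v ^ 3 * N) / (c * L ^ 3) * b' h)) (at w)" (is ?P2)
    "((\<lambda>w. hess12 \<alpha> \<beta> c \<kappa> (a w) (b w)) has_derivative
      (\<lambda>h. 2 * \<alpha> * \<kappa> * v * (L - 2 * \<alpha> * u\<^sup>2) / (c * L\<^sup>2) * a' h +
        2 * \<alpha> * \<kappa> * u * (L - 2 * \<beta> * v\<^sup>2) / (c * L\<^sup>2) * b' h)) (at w)" (is ?P3)
    "((\<lambda>w. hess22 \<alpha> \<beta> c \<kappa> (a w) (b w)) has_derivative
      (\<lambda>h. 2 * \<kappa> * ((4 * \<alpha> * u * (1 + \<alpha> * u\<^sup>2) + 2 * \<alpha>\<^sup>2 * u * v\<^sup>2) * L - 4 * \<alpha> * u * Q) / (c * L ^ 3) * a' h +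
        2 * \<kappa> * (2 * \<alpha>\<^sup>2 * u\<^sup>2 * v * L - 4 * \<beta> * v * Q) / (c * L ^ 3) * b' h)) (at w)" (is ?P4)
proof -
  have dL: "((\<lambda>w. 1 + \<alpha> * (a w)\<^sup>2 + \<beta> * (b w)\<^sup>2) has_derivative (\<lambda>h. 2 * \<alpha> * u * a' h + 2 * \<beta> * v * b' h)) (at w)"
    unfolding u_def v_def by (auto intro!: derivative_eq_intros a b simp: algebra_simps)
  have L: "1 + \<alpha> * (a w)\<^sup>2 + \<beta> * (b w)\<^sup>2 = L" by (simp add: L_def u_def v_def)
  have L': "1 + \<alpha> * u\<^sup>2 + \<beta> * v\<^sup>2 = L" by (simp add: L_def)
  have N: "\<alpha> + \<beta> + \<alpha> * \<beta> * (u\<^sup>2 + v\<^sup>2) = N" by (simp add: N_def)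
  have Q: "(1 + \<alpha> * u\<^sup>2)\<^sup>2 + \<alpha>\<^sup>2 * u\<^sup>2 * v\<^sup>2 = Q" by (simp add: Q_def)
  note nz = L0 c
  show ?P1
    by (rule has_derivative_eq_rhs, (rule derivative_eq_intros dL refl)+; (simp add: L nz)?)
       (use nz in \<open>simp add: L fun_eq_iff field_simps power2_eq_square\<close>)
  show ?P2
  proof -
    have "((\<lambda>w. 2 * \<kappa> * (b w)\<^sup>2 * (\<alpha> + \<beta> + \<alpha> * \<beta> * ((a w)\<^sup>2 + (b w)\<^sup>2))) has_derivative
       (\<lambda>h. 4 * \<kappa> * \<alpha> * \<beta> * u * v\<^sup>2 * a' h + 2 * \<kappa> * (2 * v * N + 2 * \<alpha> * \<beta> * v ^ 3) * b' h)) (at w)"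
      unfolding u_def v_def N_def by (auto intro!: derivative_eq_intros a b simp: algebra_simps power2_eq_square power3_eq_cube)
    note d = has_derivative_divide[OF this has_derivative_mult_right[OF has_derivative_power[OF dL, of 2], of c]]
    show ?thesis
      unfolding hess11_def
      by (rule has_derivative_eq_rhs[OF d]; unfold u_def[symmetric] v_def[symmetric] L' N Q)
         (use nz in \<open>auto simp: fun_eq_iff field_simps power2_eq_square power3_eq_cube\<close>)
  qed
  show ?P3
  proof -
    have "((\<lambda>w. 2 * \<alpha> * \<kappa> * a w * b w) has_derivative (\<lambda>h. 2 * \<alpha> * \<kappa> * v * a' h + 2 * \<alpha> * \<kappa> * u * b' h)) (at w)"
      unfolding u_def v_def by (auto intro!: derivative_eq_intros a b simp: algebra_simps)
    note d = has_derivative_divide[OF this has_derivative_mult_right[OF dL, of c]]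
    show ?thesis
      unfolding hess12_def
      by (rule has_derivative_eq_rhs[OF d]; unfold u_def[symmetric] v_def[symmetric] L' N Q)
         (use nz in \<open>auto simp: fun_eq_iff field_simps power2_eq_square\<close>)
  qed
  show ?P4
  proof -
    have "((\<lambda>w. 2 * \<kappa> * ((1 + \<alpha> * (a w)\<^sup>2)\<^sup>2 + \<alpha>\<^sup>2 * (a w)\<^sup>2 * (b w)\<^sup>2)) has_derivative
       (\<lambda>h. 2 * \<kappa> * (4 * \<alpha> * u * (1 + \<alpha> * u\<^sup>2) + 2 * \<alpha>\<^sup>2 * u * v\<^sup>2) * a' h + 4 * \<kappa> * \<alpha>\<^sup>2 * u\<^sup>2 * v * b' h)) (at w)"
      unfolding u_def v_def by (auto intro!: derivative_eq_intros a b simp: algebra_simps power2_eq_square power3_eq_cube)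
    note d = has_derivative_divide[OF this has_derivative_mult_right[OF has_derivative_power[OF dL, of 2], of c]]
    show ?thesis
      unfolding hess22_def
      by (rule has_derivative_eq_rhs[OF d]; unfold u_def[symmetric] v_def[symmetric] L' N Q)
         (use nz in \<open>auto simp: fun_eq_iff field_simps power2_eq_square power3_eq_cube\<close>)
  qed
qed

lemma matrix_inv_eqI:
  fixes A B :: "real^'n::finite^'n"
  assumes "A ** B = mat 1"
  shows "matrix_inv A = B"
proof -
  have "det A * det B = 1" using arg_cong[OF assms, of det] by (simp add: det_mul)
  then have "det A \<noteq> 0" by auto
  then have "matrix_inv A ** A ** B = B" by (simp add: matrix_inv_left_right)
  then show ?thesis by (simp add: matrix_mul_assoc[symmetric] assms)
qed

lemma has_derivative_swap2:
  fixes f :: "real^2 \<Rightarrow> real"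
  assumes "(f has_derivative (\<lambda>h. A * h $ 2 + B * h $ 1)) (at w)"
  shows "(f has_derivative (\<lambda>h. B * h $ 1 + A * h $ 2)) (at w)"
  using assms by (simp add: add.commute)

context toric_quotient
begin

lemma cov_frame_sum:
  assumes x: "x \<in> U" and \<psi>: "\<And>m. \<psi> m differentiable at (F x)"
  shows "cov g (E a x) (\<lambda>y. \<Sum>m\<in>UNIV. \<psi> m (F y) *\<^sub>R E m y) x =
    (\<Sum>d\<in>UNIV. ((\<Sum>m\<in>UNIV. H a m (F x) * pd m (\<psi> d) (F x)) + (\<Sum>m\<in>UNIV. \<psi> m (F x) * S a m d (F x))) *\<^sub>R E d x)"
proof -
  have dFx: "(\<lambda>y. F y $ m) differentiable at x" for m
    using smooth_F x open_U by (auto simp: smooth_vec_on_def intro: smooth_on_imp_differentiable)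
  note \<psi>F = pd_compose(2)[of "\<psi> _", OF \<psi> dFx] and Ex = diff_at[OF x smooth_E]
  have dF: "dirv (E a x) (\<lambda>y. F y $ m) x = H a m (F x)" for m
    using inn_E[OF x, of m a] inn_E[OF x, of a m] by (simp add: inn_grad[OF x, symmetric] E_def[symmetric] inn_sym[OF x])
  have "cov g (E a x) (\<lambda>y. \<Sum>m\<in>UNIV. \<psi> m (F y) *\<^sub>R E m y) x =
      (\<Sum>m\<in>UNIV. dirv (E a x) (\<lambda>y. \<psi> m (F y)) x *\<^sub>R E m x + \<psi> m (F x) *\<^sub>R cov g (E a x) (E m) x)"
    by (subst cov_sum) (auto simp: cov_scale \<psi>F Ex intro!: differentiable_scaleR)
  also have "\<dots> = (\<Sum>m\<in>UNIV. (\<Sum>n\<in>UNIV. H a n (F x) * pd n (\<psi> m) (F x)) *\<^sub>R E m x) +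
      (\<Sum>m\<in>UNIV. \<Sum>d\<in>UNIV. (\<psi> m (F x) * S a m d (F x)) *\<^sub>R E d x)"
    by (simp add: sum.distrib dirv_compose[OF \<psi> dFx] dF cov_E[OF x] scaleR_sum_right mult.commute)
  also have "(\<Sum>m\<in>UNIV. \<Sum>d\<in>UNIV. (\<psi> m (F x) * S a m d (F x)) *\<^sub>R E d x) =
      (\<Sum>d\<in>UNIV. (\<Sum>m\<in>UNIV. \<psi> m (F x) * S a m d (F x)) *\<^sub>R E d x)"
    by (subst sum.swap) (simp add: scaleR_sum_left)
  finally show ?thesis by (simp add: scaleR_add_left sum.distrib)
qed

end

lemma riemannian_gtn_sigma:
  assumes M: "M > 0" and k: "k \<in> {-1..1}"
  shows "riemannian UNIV (gtn_sigma M k)"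
proof
  have pos: "2 / M * (1 + (1 + k) * (w$1)\<^sup>2 + (1 - k) * (w$2)\<^sup>2) > 0" for w :: "real^2"
    using M k by (intro mult_pos_pos add_pos_nonneg mult_nonneg_nonneg) auto
  show "riemannian_metric_on UNIV (gtn_sigma M k)"
    unfolding riemannian_metric_on_def
  proof (intro conjI ballI allI impI)
    show "smooth_mat_on UNIV (gtn_sigma M k)"
      unfolding smooth_mat_on_def gtn_sigma_def mat_def power2_eq_square
    proof (intro allI)
      fix i j :: 2
      show "smooth_on UNIV (\<lambda>x::real^2. (\<chi> i j. if i = j then 2 / M * (1 + (1 + k) * (x$1 * x$1) + (1 - k) * (x$2 * x$2)) else 0) $ i $ j)"
      proof (cases "i = j")
        case True
        have "smooth_on UNIV (\<lambda>x::real^2. 2 / M * (1 + (1 + k) * (x$1 * x$1) + (1 - k) * (x$2 * x$2)))"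
          by (intro smooth_intros open_UNIV)
        then show ?thesis using True by (simp only: vec_lambda_beta if_True simp_thms)
      qed (simp add: smooth_on_const)
    qed
    show "transpose (gtn_sigma M k x) = gtn_sigma M k x" for x
      by (simp add: gtn_sigma_def transpose_mat)
    fix x v :: "real^2" assume "v \<noteq> 0"
    have "bilin (gtn_sigma M k x) v v = 2 / M * (1 + (1 + k) * (x$1)\<^sup>2 + (1 - k) * (x$2)\<^sup>2) * (v \<bullet> v)"
      by (simp add: bilin_sum_def gtn_sigma_def mat_def sum_2 inner_vec_def algebra_simps)
    then show "0 < bilin (gtn_sigma M k x) v v"
      using mult_pos_pos[OF pos[of x], of "v \<bullet> v"] \<open>v \<noteq> 0\<close> by (simp only: inner_gt_zero_iff simp_thms)
  qed
qed simp

section \<open>Generalized Taub-NUT metrics away from the axes\<close>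

locale gtn_local = toric_quotient U g J X \<phi> F UNIV "gtn_sigma M k" for U g J X \<phi> F M k +
  assumes M: "M > 0" and k: "k \<in> {-1..1}"
    and moment: "x \<in> U \<Longrightarrow> \<phi> i x = gtn_moment M k i (F x)"
    and pos: "x \<in> U \<Longrightarrow> F x $ 1 > 0" "x \<in> U \<Longrightarrow> F x $ 2 > 0"
begin

definition "\<alpha> = 1 + k"
definition "\<beta> = 1 - k"
definition "c = 2 / M"
definition "\<kappa> = 1 / (sqrt 2 * M)"
definition "L w = 1 + \<alpha> * (w $ 1)\<^sup>2 + \<beta> * (w $ 2)\<^sup>2" for w :: "real^2"
text \<open>The inverse of the conformal factor, which is the squared length of the gradients of
  \<open>u\<close> and \<open>v\<close>.\<close>

definition "\<eta> w = 1 / (c * L w)" for w :: "real^2"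

lemma L_pos: "L w > 0"
  unfolding L_def \<alpha>_def \<beta>_def using k by (intro add_pos_nonneg mult_nonneg_nonneg) auto

lemma c_pos: "c > 0"
  using M by (simp add: c_def)

lemma nz: "L w \<noteq> 0" "c \<noteq> 0"
  using L_pos[of w] c_pos by auto

lemma sigma_eq: "gtn_sigma M k w = mat (c * L w)"
  by (simp add: gtn_sigma_def c_def L_def \<alpha>_def \<beta>_def)

lemma H_eq: "H a b = (\<lambda>w. if a = b then \<eta> w else 0)"
proof
  fix w
  have "mat (c * L w) ** (mat (\<eta> w) :: real^2^2) = mat 1" "mat (\<eta> w) ** (mat (c * L w) :: real^2^2) = mat 1"
    using nz(1)[of w] nz(2) by (simp_all add: \<eta>_def matrix_matrix_mult_def mat_def vec_eq_iff forall_2 sum_2)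
  then have "matrix_inv (mat (c * L w) :: real^2^2) = mat (\<eta> w)"
    using matrix_inv_eqI by blast
  then show "H a b w = (if a = b then \<eta> w else 0)"
    by (simp only: sigma_eq) (simp add: mat_def)
qed

lemma H_at: "H a b w = (if a = b then \<eta> w else 0)"
  using fun_cong[OF H_eq] by simp

lemma d\<eta>: "\<eta> differentiable at w" "pd 1 \<eta> w = - 2 * \<alpha> * w $ 1 / (c * (L w)\<^sup>2)" "pd 2 \<eta> w = - 2 * \<beta> * w $ 2 / (c * (L w)\<^sup>2)"
  using has_derivative_pd12[OF has_derivative_hess(1)[OF has_derivative_nth[where i = 1 and w = w]
        has_derivative_nth[where i = 2 and w = w], where \<alpha> = \<alpha> and \<beta> = \<beta> and c = c]]
    nz(1)[of w] nz(2) unfolding \<eta>_def[abs_def] L_def by auto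

lemma S_table:
  "S 1 1 1 w = pd 1 \<eta> w / 2" "S 1 1 2 w = pd 2 \<eta> w / 2" "S 1 2 1 w = - pd 2 \<eta> w / 2" "S 1 2 2 w = pd 1 \<eta> w / 2"
  "S 2 1 1 w = pd 2 \<eta> w / 2" "S 2 1 2 w = - pd 1 \<eta> w / 2" "S 2 2 1 w = pd 1 \<eta> w / 2" "S 2 2 2 w = pd 2 \<eta> w / 2"
proof -
  have h: "gtn_sigma M k w $ a $ b = (if a = b then 1 / \<eta> w else 0)" for a b
    by (simp add: sigma_eq mat_def \<eta>_def)
  have "\<eta> w \<noteq> 0" using nz(1)[of w] nz(2) by (simp add: \<eta>_def)
  then show "S 1 1 1 w = pd 1 \<eta> w / 2" "S 1 1 2 w = pd 2 \<eta> w / 2" "S 1 2 1 w = - pd 2 \<eta> w / 2" "S 1 2 2 w = pd 1 \<eta> w / 2"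
    "S 2 1 1 w = pd 2 \<eta> w / 2" "S 2 1 2 w = - pd 1 \<eta> w / 2" "S 2 2 1 w = pd 1 \<eta> w / 2" "S 2 2 2 w = pd 2 \<eta> w / 2"
    unfolding frame_connection_def H_eq h by (simp_all add: sum_2)
qed

text \<open>The partial derivatives of the moment functions, which are the components of
  \<open>V i\<close> in the frame \<open>E\<close>.\<close>

definition \<psi> :: "2 \<Rightarrow> 2 \<Rightarrow> real^2 \<Rightarrow> real" where
  "\<psi> i m w = (if i = 1 then if m = 1 then 2 * \<alpha> * \<kappa> * w $ 1 * (w $ 2)\<^sup>2 else 2 * \<kappa> * w $ 2 * (1 + \<alpha> * (w $ 1)\<^sup>2)
    else if m = 1 then 2 * \<kappa> * w $ 1 * (1 + \<beta> * (w $ 2)\<^sup>2) else 2 * \<beta> * \<kappa> * w $ 2 * (w $ 1)\<^sup>2)"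

definition hess :: "2 \<Rightarrow> 2 \<Rightarrow> 2 \<Rightarrow> real^2 \<Rightarrow> real" where
  "hess i a b w = (if i = 1 then
       if a = b then if a = 1 then hess11 \<alpha> \<beta> c \<kappa> (w $ 1) (w $ 2) else hess22 \<alpha> \<beta> c \<kappa> (w $ 1) (w $ 2)
       else hess12 \<alpha> \<beta> c \<kappa> (w $ 1) (w $ 2)
     else if a = b then if a = 1 then hess22 \<beta> \<alpha> c \<kappa> (w $ 2) (w $ 1) else hess11 \<beta> \<alpha> c \<kappa> (w $ 2) (w $ 1)
       else hess12 \<beta> \<alpha> c \<kappa> (w $ 2) (w $ 1))"

lemma \<psi>_table: "\<psi> 1 1 = (\<lambda>w. 2 * \<alpha> * \<kappa> * w $ 1 * (w $ 2)\<^sup>2)" "\<psi> 1 2 = (\<lambda>w. 2 * \<kappa> * w $ 2 * (1 + \<alpha> * (w $ 1)\<^sup>2))"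
  "\<psi> 2 1 = (\<lambda>w. 2 * \<kappa> * w $ 1 * (1 + \<beta> * (w $ 2)\<^sup>2))" "\<psi> 2 2 = (\<lambda>w. 2 * \<beta> * \<kappa> * w $ 2 * (w $ 1)\<^sup>2)"
  by (simp_all add: \<psi>_def[abs_def])

lemma hess_table: "hess 1 1 1 = (\<lambda>w. hess11 \<alpha> \<beta> c \<kappa> (w $ 1) (w $ 2))" "hess 1 2 2 = (\<lambda>w. hess22 \<alpha> \<beta> c \<kappa> (w $ 1) (w $ 2))"
  "hess 1 1 2 = (\<lambda>w. hess12 \<alpha> \<beta> c \<kappa> (w $ 1) (w $ 2))" "hess 1 2 1 = (\<lambda>w. hess12 \<alpha> \<beta> c \<kappa> (w $ 1) (w $ 2))"
  "hess 2 1 1 = (\<lambda>w. hess22 \<beta> \<alpha> c \<kappa> (w $ 2) (w $ 1))" "hess 2 2 2 = (\<lambda>w. hess11 \<beta> \<alpha> c \<kappa> (w $ 2) (w $ 1))"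
  "hess 2 1 2 = (\<lambda>w. hess12 \<beta> \<alpha> c \<kappa> (w $ 2) (w $ 1))" "hess 2 2 1 = (\<lambda>w. hess12 \<beta> \<alpha> c \<kappa> (w $ 2) (w $ 1))"
  by (simp_all add: hess_def[abs_def])

lemma moment_der: "gtn_moment M k i differentiable at w" "pd m (gtn_moment M k i) w = \<psi> i m w"
proof -
  have 1: "(gtn_moment M k 1 has_derivative (\<lambda>h. \<psi> 1 1 w * h $ 1 + \<psi> 1 2 w * h $ 2)) (at w)"
    unfolding gtn_moment_def[abs_def] \<psi>_table \<kappa>_def \<alpha>_def using M
    by (auto intro!: derivative_eq_intros simp: fun_eq_iff field_simps power2_eq_square)
  have 2: "(gtn_moment M k 2 has_derivative (\<lambda>h. \<psi> 2 1 w * h $ 1 + \<psi> 2 2 w * h $ 2)) (at w)"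
    unfolding gtn_moment_def[abs_def] \<psi>_table \<kappa>_def \<beta>_def using M
    by (auto intro!: derivative_eq_intros simp: fun_eq_iff field_simps power2_eq_square)
  show "gtn_moment M k i differentiable at w" "pd m (gtn_moment M k i) w = \<psi> i m w"
    using has_derivative_pd12[OF 1] has_derivative_pd12[OF 2] exhaust_2[of i] exhaust_2[of m] by auto
qed

lemma \<psi>_der:
  "\<psi> i m differentiable at w"
  "pd 1 (\<psi> 1 1) w = 2 * \<alpha> * \<kappa> * (w $ 2)\<^sup>2" "pd 2 (\<psi> 1 1) w = 4 * \<alpha> * \<kappa> * w $ 1 * w $ 2"
  "pd 1 (\<psi> 1 2) w = 4 * \<alpha> * \<kappa> * w $ 1 * w $ 2" "pd 2 (\<psi> 1 2) w = 2 * \<kappa> * (1 + \<alpha> * (w $ 1)\<^sup>2)"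
  "pd 1 (\<psi> 2 1) w = 2 * \<kappa> * (1 + \<beta> * (w $ 2)\<^sup>2)" "pd 2 (\<psi> 2 1) w = 4 * \<beta> * \<kappa> * w $ 2 * w $ 1"
  "pd 1 (\<psi> 2 2) w = 4 * \<beta> * \<kappa> * w $ 2 * w $ 1" "pd 2 (\<psi> 2 2) w = 2 * \<beta> * \<kappa> * (w $ 1)\<^sup>2"
proof -
  have 11: "(\<psi> 1 1 has_derivative (\<lambda>h. 2 * \<alpha> * \<kappa> * (w $ 2)\<^sup>2 * h $ 1 + 4 * \<alpha> * \<kappa> * w $ 1 * w $ 2 * h $ 2)) (at w)"
    unfolding \<psi>_table by (auto intro!: derivative_eq_intros simp: fun_eq_iff algebra_simps)
  have 12: "(\<psi> 1 2 has_derivative (\<lambda>h. 4 * \<alpha> * \<kappa> * w $ 1 * w $ 2 * h $ 1 + 2 * \<kappa> * (1 + \<alpha> * (w $ 1)\<^sup>2) * h $ 2)) (at w)"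
    unfolding \<psi>_table by (auto intro!: derivative_eq_intros simp: fun_eq_iff algebra_simps)
  have 21: "(\<psi> 2 1 has_derivative (\<lambda>h. 2 * \<kappa> * (1 + \<beta> * (w $ 2)\<^sup>2) * h $ 1 + 4 * \<beta> * \<kappa> * w $ 2 * w $ 1 * h $ 2)) (at w)"
    unfolding \<psi>_table by (auto intro!: derivative_eq_intros simp: fun_eq_iff algebra_simps)
  have 22: "(\<psi> 2 2 has_derivative (\<lambda>h. 4 * \<beta> * \<kappa> * w $ 2 * w $ 1 * h $ 1 + 2 * \<beta> * \<kappa> * (w $ 1)\<^sup>2 * h $ 2)) (at w)"
    unfolding \<psi>_table by (auto intro!: derivative_eq_intros simp: fun_eq_iff algebra_simps)
  note d = has_derivative_pd12[OF 11] has_derivative_pd12[OF 12] has_derivative_pd12[OF 21] has_derivative_pd12[OF 22]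
  show "\<psi> i m differentiable at w"
    using d exhaust_2[of i] exhaust_2[of m] by auto
  show "pd 1 (\<psi> 1 1) w = 2 * \<alpha> * \<kappa> * (w $ 2)\<^sup>2" "pd 2 (\<psi> 1 1) w = 4 * \<alpha> * \<kappa> * w $ 1 * w $ 2"
  "pd 1 (\<psi> 1 2) w = 4 * \<alpha> * \<kappa> * w $ 1 * w $ 2" "pd 2 (\<psi> 1 2) w = 2 * \<kappa> * (1 + \<alpha> * (w $ 1)\<^sup>2)"
  "pd 1 (\<psi> 2 1) w = 2 * \<kappa> * (1 + \<beta> * (w $ 2)\<^sup>2)" "pd 2 (\<psi> 2 1) w = 4 * \<beta> * \<kappa> * w $ 2 * w $ 1"
  "pd 1 (\<psi> 2 2) w = 4 * \<beta> * \<kappa> * w $ 2 * w $ 1" "pd 2 (\<psi> 2 2) w = 2 * \<beta> * \<kappa> * (w $ 1)\<^sup>2"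
    by (rule d)+
qed

lemma V_eq: "x \<in> U \<Longrightarrow> V i x = (\<Sum>m\<in>UNIV. \<psi> i m (F x) *\<^sub>R E m x)"
proof (rule inn_eqI)
  fix w assume x: "x \<in> U"
  have dFx: "(\<lambda>y. F y $ m) differentiable at x" for m
    using smooth_F x open_U by (auto simp: smooth_vec_on_def intro: smooth_on_imp_differentiable)
  have "inn x (V i x) w = dirv w (\<lambda>y. gtn_moment M k i (F y)) x"
    unfolding inn_grad[OF x] by (rule dirv_cong[OF open_U x moment])
  also have "\<dots> = inn x (\<Sum>m\<in>UNIV. \<psi> i m (F x) *\<^sub>R E m x) w"
    by (simp add: dirv_compose[OF moment_der(1) dFx] moment_der(2) bilin_simps E_def inn_grad[OF x])
  finally show "inn x (V i x) w = inn x (\<Sum>m\<in>UNIV. \<psi> i m (F x) *\<^sub>R E m x) w" .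
qed

lemma cov_V:
  assumes x: "x \<in> U"
  shows "cov g (E a x) (V i) x = (\<Sum>d\<in>UNIV. hess i a d (F x) *\<^sub>R E d x)"
proof -
  have L1: "L w = 1 + \<alpha> * (w$1)\<^sup>2 + \<beta> * (w$2)\<^sup>2" and L2: "L w = 1 + \<beta> * (w$2)\<^sup>2 + \<alpha> * (w$1)\<^sup>2" for w
    by (simp_all add: L_def)
  \<comment> \<open>\<open>e1\<close> treats the first moment function; \<open>e2\<close>, the same
    identities with the roles of the coordinates and of \<open>\<alpha>, \<beta>\<close> exchanged,
    treats the second.\<close>
  have key: "(\<Sum>m\<in>UNIV. H a m w * pd m (\<psi> i d) w) + (\<Sum>m\<in>UNIV. \<psi> i m w * S a m d w) = hess i a d w" for d w
  proof -
    note e1 = hess_eqs[OF L1[of w] nz(1) nz(2), where \<kappa> = \<kappa>, symmetric] and e2 = hess_eqs[OF L2[of w] nz(1) nz(2), where \<kappa> = \<kappa>, symmetric]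
    have "i = 1 \<or> i = 2" "a = 1 \<or> a = 2" "d = 1 \<or> d = 2" using exhaust_2 by blast+
    then show ?thesis
      unfolding sum_2
      by (elim disjE; simp only: S_table; simp only: H_at \<psi>_der hess_table e1 e2 d\<eta>)
         (simp_all add: \<psi>_table \<eta>_def diff_divide_distrib add_divide_distrib algebra_simps)
  qed
  have "cov g (E a x) (V i) x = cov g (E a x) (\<lambda>y. \<Sum>m\<in>UNIV. \<psi> i m (F y) *\<^sub>R E m y) x"
    by (rule cov_cong[OF open_U x V_eq])
  also have "\<dots> = (\<Sum>d\<in>UNIV. ((\<Sum>m\<in>UNIV. H a m (F x) * pd m (\<psi> i d) (F x)) + (\<Sum>m\<in>UNIV. \<psi> i m (F x) * S a m d (F x))) *\<^sub>R E d x)"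
    by (rule cov_frame_sum[OF x \<psi>_der(1)])
  finally show ?thesis unfolding key .
qed

text \<open>\<open>Cc\<close>, \<open>Bc\<close>, \<open>Dc\<close> are the mixed curvature
  coefficients: for the pairs \<open>E 1, J E 1\<close> and \<open>E 2, J E 2\<close> they are
  \<open>Cc\<close> and \<open>Dc\<close>, and \<open>Bc\<close> belongs to both crossed pairs, as
  made precise in \<open>curv_frame\<close>.\<close>

definition "Cc w = (- 4 * \<alpha> - 4 * \<beta> * (\<alpha> - \<beta>) * (w $ 2)\<^sup>2) / (c\<^sup>2 * L w ^ 4)" for w :: "real^2"
definition "Bc w = (\<alpha> + \<beta> - \<alpha> * (\<alpha> - \<beta>) * (w $ 1)\<^sup>2 + \<beta> * (\<alpha> - \<beta>) * (w $ 2)\<^sup>2) / (c\<^sup>2 * L w ^ 4)" for w :: "real^2"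
definition "Dc w = (- 4 * \<beta> + 4 * \<alpha> * (\<alpha> - \<beta>) * (w $ 1)\<^sup>2) / (c\<^sup>2 * L w ^ 4)" for w :: "real^2"

lemma curv_E_X_eq:
  assumes x: "x \<in> U"
  shows "curv g (E 1 x) (X i x) (E 1 x) x =
      J x *v ((\<psi> i 1 (F x) * Cc (F x)) *\<^sub>R E 1 x + (\<psi> i 2 (F x) * Bc (F x)) *\<^sub>R E 2 x)" (is ?P1)
    "curv g (E 2 x) (X i x) (E 2 x) x =
      J x *v ((\<psi> i 1 (F x) * Bc (F x)) *\<^sub>R E 1 x + (\<psi> i 2 (F x) * Dc (F x)) *\<^sub>R E 2 x)" (is ?P2)
proof -
  have L12: "1 + \<beta> * (w$2)\<^sup>2 + \<alpha> * (w$1)\<^sup>2 \<noteq> 0" "1 + \<alpha> * (w$1)\<^sup>2 + \<beta> * (w$2)\<^sup>2 \<noteq> 0" for w :: "real^2"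
    using nz(1)[of w] by (simp_all add: L_def algebra_simps)
  note h1 = has_derivative_hess(2-4)[OF has_derivative_nth[where i = 1] has_derivative_nth[where i = 2],
      where \<alpha> = \<alpha> and \<beta> = \<beta> and c = c and \<kappa> = \<kappa>, OF L12(2) nz(2)]
  note h2 = has_derivative_hess(2-4)[OF has_derivative_nth[where i = 2] has_derivative_nth[where i = 1],
      where \<alpha> = \<beta> and \<beta> = \<alpha> and c = c and \<kappa> = \<kappa>, OF L12(1) nz(2), THEN has_derivative_swap2]
  note d1 = h1[THEN has_derivative_pd12(1)] h1[THEN has_derivative_pd12(2)] h1[THEN has_derivative_pd12(3)]
    and d2 = h2[THEN has_derivative_pd12(1)] h2[THEN has_derivative_pd12(2)] h2[THEN has_derivative_pd12(3)]
  have dh: "hess i a b differentiable at w" for i a b w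
    using d1(1-3) d2(1-3) exhaust_2[of i] exhaust_2[of a] exhaust_2[of b] by (auto simp: hess_table)
  have L1: "L w = 1 + \<alpha> * (w$1)\<^sup>2 + \<beta> * (w$2)\<^sup>2" and L2: "L w = 1 + \<beta> * (w$2)\<^sup>2 + \<alpha> * (w$1)\<^sup>2" for w
    by (simp_all add: L_def)
  \<comment> \<open>\<open>curv_E_X\<close> with the Hessian inserted: this is the component form of
    the second covariant derivative of the gradient field \<open>V i\<close>.\<close>
  have 1: "curv g (E a x) (X i x) (E b x) x = J x *v (\<Sum>e\<in>UNIV. ((\<Sum>m\<in>UNIV. H a m (F x) * pd m (hess i b e) (F x))
      + (\<Sum>m\<in>UNIV. hess i b m (F x) * S a m e (F x)) - (\<Sum>d\<in>UNIV. S a b d (F x) * hess i d e (F x))) *\<^sub>R E e x)" for a b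
  proof -
    have "cov g (E a x) (\<lambda>y. cov g (E b y) (V i) y) x = cov g (E a x) (\<lambda>y. \<Sum>e\<in>UNIV. hess i b e (F y) *\<^sub>R E e y) x"
      by (rule cov_cong[OF open_U x cov_V])
    also have "\<dots> = (\<Sum>e\<in>UNIV. ((\<Sum>m\<in>UNIV. H a m (F x) * pd m (hess i b e) (F x))
      + (\<Sum>m\<in>UNIV. hess i b m (F x) * S a m e (F x))) *\<^sub>R E e x)"
      by (rule cov_frame_sum[OF x dh])
    finally show ?thesis
      unfolding curv_E_X[OF x] cov_V[OF x]
      by (simp add: sum_2 algebra_simps)
  qed
  let ?w = "F x"
  have i: "i = 1 \<or> i = 2" using exhaust_2 by blast
  note t1 = gtn_third_derivative[OF L1[of ?w] nz(1) nz(2), where \<kappa> = \<kappa>] and t2 = gtn_third_derivative[OF L2[of ?w] nz(1) nz(2), where \<kappa> = \<kappa>]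
  have c: "\<eta> ?w * pd 1 (hess i 1 1) ?w - pd 2 \<eta> ?w * hess i 1 2 ?w = \<psi> i 1 ?w * Cc ?w \<and>
    \<eta> ?w * pd 1 (hess i 1 2) ?w + pd 2 \<eta> ?w * (hess i 1 1 ?w - hess i 2 2 ?w) / 2 = \<psi> i 2 ?w * Bc ?w \<and>
    \<eta> ?w * pd 2 (hess i 2 1) ?w + pd 1 \<eta> ?w * (hess i 2 2 ?w - hess i 1 1 ?w) / 2 = \<psi> i 1 ?w * Bc ?w \<and>
    \<eta> ?w * pd 2 (hess i 2 2) ?w - pd 1 \<eta> ?w * hess i 2 1 ?w = \<psi> i 2 ?w * Dc ?w"
  proof (cases "i = 1")
    case True
    show ?thesis
      using t1 unfolding True hess_table \<psi>_table d1(4-9) d\<eta> \<eta>_def Cc_def Bc_def Dc_def L_def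
      by blast
  next
    case False
    then have i2: "i = 2" using i by blast
    have s: "- 4 * \<alpha> - 4 * \<beta> * (\<alpha> - \<beta>) * (w $ 2)\<^sup>2 = - 4 * \<alpha> + 4 * \<beta> * (\<beta> - \<alpha>) * (w $ 2)\<^sup>2"
      "\<alpha> + \<beta> - \<alpha> * (\<alpha> - \<beta>) * (w $ 1)\<^sup>2 + \<beta> * (\<alpha> - \<beta>) * (w $ 2)\<^sup>2 =
        \<beta> + \<alpha> - \<beta> * (\<beta> - \<alpha>) * (w $ 2)\<^sup>2 + \<alpha> * (\<beta> - \<alpha>) * (w $ 1)\<^sup>2"
      "- 4 * \<beta> + 4 * \<alpha> * (\<alpha> - \<beta>) * (w $ 1)\<^sup>2 = - 4 * \<beta> - 4 * \<alpha> * (\<beta> - \<alpha>) * (w $ 1)\<^sup>2" for w :: "real^2"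
      by (simp_all add: algebra_simps)
    show ?thesis
      using t2 unfolding i2 hess_table \<psi>_table d2(4-9) d\<eta> \<eta>_def Cc_def Bc_def Dc_def s L2
      by blast
  qed
  have hs: "hess i 2 1 w = hess i 1 2 w" for w
    using i by (auto simp: hess_table)
  show ?P1
    unfolding 1 sum_2 S_table unfolding H_at c[THEN conjunct1, symmetric] c[THEN conjunct2, THEN conjunct1, symmetric]
      c[THEN conjunct2, THEN conjunct2, THEN conjunct1, symmetric] c[THEN conjunct2, THEN conjunct2, THEN conjunct2, symmetric]
    by (rule arg_cong[where f = "(*v) (J x)"], rule arg_cong2[where f = "(+)"];
        rule arg_cong2[where f = "(*\<^sub>R)", OF _ refl]) (simp_all add: hs field_simps)
  show ?P2
    unfolding 1 sum_2 S_table unfolding H_at c[THEN conjunct1, symmetric] c[THEN conjunct2, THEN conjunct1, symmetric]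
      c[THEN conjunct2, THEN conjunct2, THEN conjunct1, symmetric] c[THEN conjunct2, THEN conjunct2, THEN conjunct2, symmetric]
    by (rule arg_cong[where f = "(*v) (J x)"], rule arg_cong2[where f = "(+)"];
        rule arg_cong2[where f = "(*\<^sub>R)", OF _ refl]) (simp_all add: hs field_simps)
qed

text \<open>The formulas for \<open>X 1\<close> and \<open>X 2\<close> form a linear system in the
  two vectors \<open>J E m\<close>. Its determinant is
  \<open>- 4 * \<kappa>\<^sup>2 * u * v * L\<close>, nonzero because \<open>u\<close> and
  \<open>v\<close> are positive.\<close>

lemma curv_frame:
  assumes x: "x \<in> U"
  shows "curv g (E 1 x) (J x *v E 1 x) (E 1 x) x = Cc (F x) *\<^sub>R (J x *v E 1 x)" (is ?P1)
    "curv g (E 1 x) (J x *v E 2 x) (E 1 x) x = Bc (F x) *\<^sub>R (J x *v E 2 x)" (is ?P2)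
    "curv g (E 2 x) (J x *v E 2 x) (E 2 x) x = Dc (F x) *\<^sub>R (J x *v E 2 x)" (is ?P3)
    "curv g (E 2 x) (J x *v E 1 x) (E 2 x) x = Bc (F x) *\<^sub>R (J x *v E 1 x)" (is ?P4)
proof -
  let ?w = "F x"
  have \<kappa>: "\<kappa> \<noteq> 0" using M by (simp add: \<kappa>_def)
  have "\<psi> 1 1 ?w * \<psi> 2 2 ?w - \<psi> 1 2 ?w * \<psi> 2 1 ?w = - 4 * \<kappa>\<^sup>2 * ?w $ 1 * ?w $ 2 * L ?w"
    by (simp add: \<psi>_table L_def algebra_simps power2_eq_square)
  moreover have "- 4 * \<kappa>\<^sup>2 * ?w $ 1 * ?w $ 2 * L ?w \<noteq> 0"
    using \<kappa> nz(1)[of ?w] pos[OF x] by simp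
  ultimately have det: "\<psi> 1 1 ?w * \<psi> 2 2 ?w - \<psi> 1 2 ?w * \<psi> 2 1 ?w \<noteq> 0" by simp
  have solve: "A = 0 \<and> B = 0" if "\<psi> 1 1 ?w *\<^sub>R A + \<psi> 1 2 ?w *\<^sub>R B = 0" "\<psi> 2 1 ?w *\<^sub>R A + \<psi> 2 2 ?w *\<^sub>R B = 0" for A B :: "real^4"
  proof -
    have "(\<psi> 1 1 ?w * \<psi> 2 2 ?w - \<psi> 1 2 ?w * \<psi> 2 1 ?w) *\<^sub>R A =
       \<psi> 2 2 ?w *\<^sub>R (\<psi> 1 1 ?w *\<^sub>R A + \<psi> 1 2 ?w *\<^sub>R B) - \<psi> 1 2 ?w *\<^sub>R (\<psi> 2 1 ?w *\<^sub>R A + \<psi> 2 2 ?w *\<^sub>R B)"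
      "(\<psi> 1 1 ?w * \<psi> 2 2 ?w - \<psi> 1 2 ?w * \<psi> 2 1 ?w) *\<^sub>R B =
       \<psi> 1 1 ?w *\<^sub>R (\<psi> 2 1 ?w *\<^sub>R A + \<psi> 2 2 ?w *\<^sub>R B) - \<psi> 2 1 ?w *\<^sub>R (\<psi> 1 1 ?w *\<^sub>R A + \<psi> 1 2 ?w *\<^sub>R B)"
      by (simp_all add: algebra_simps)
    then show ?thesis unfolding that using det by simp
  qed
  have XE: "X i x = \<psi> i 1 ?w *\<^sub>R (J x *v E 1 x) + \<psi> i 2 ?w *\<^sub>R (J x *v E 2 x)" for i
    by (simp add: X_eq[OF x] V_eq[OF x] sum_2 matrix_vector_right_distrib matrix_vector_mult_scaleR)
  have 1: "\<psi> i 1 ?w *\<^sub>R (curv g (E 1 x) (J x *v E 1 x) (E 1 x) x - Cc ?w *\<^sub>R (J x *v E 1 x)) +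
      \<psi> i 2 ?w *\<^sub>R (curv g (E 1 x) (J x *v E 2 x) (E 1 x) x - Bc ?w *\<^sub>R (J x *v E 2 x)) = 0" for i
    using curv_E_X_eq(1)[OF x, of i] unfolding XE
    by (simp add: curv_add curv_scale matrix_vector_right_distrib matrix_vector_mult_scaleR algebra_simps)
  have 2: "\<psi> i 1 ?w *\<^sub>R (curv g (E 2 x) (J x *v E 1 x) (E 2 x) x - Bc ?w *\<^sub>R (J x *v E 1 x)) +
      \<psi> i 2 ?w *\<^sub>R (curv g (E 2 x) (J x *v E 2 x) (E 2 x) x - Dc ?w *\<^sub>R (J x *v E 2 x)) = 0" for i
    using curv_E_X_eq(2)[OF x, of i] unfolding XE
    by (simp add: curv_add curv_scale matrix_vector_right_distrib matrix_vector_mult_scaleR algebra_simps)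
  show ?P1 ?P2
    using solve[OF 1 1] by simp_all
  show ?P3 ?P4
    using solve[OF 2 2] by simp_all
qed

theorem gtn_curvature:
  assumes x: "x \<in> U" and flat: "scalar_curvature g x = 0"
  defines "\<rho> \<equiv> ricci_form g J x"
  shows "form_inner (g x) \<rho> \<rho> = 8 * k\<^sup>2 * M\<^sup>2 / (1 + (1 + k) * (F x $ 1)\<^sup>2 + (1 - k) * (F x $ 2)\<^sup>2) ^ 4" (is ?P1)
    and "k \<noteq> 0 \<Longrightarrow> \<zeta> \<in> anti_self_dual (g x) (J x) \<Longrightarrow> weyl_minus g J x \<zeta> =
      (- gauss_curvature (gtn_sigma M k) (F x)) *\<^sub>R
        ((6 / form_inner (g x) \<rho> \<rho> * form_inner (g x) \<rho> \<zeta>) *\<^sub>R \<rho> - 2 *\<^sub>R \<zeta>)"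
proof -
  let ?w = "F x"
  \<comment> \<open>The vectors \<open>E a\<close> have squared length \<open>1 / l\<close>, so
    scaling by \<open>sqrt l\<close> normalizes them.\<close>
  define l where "l = c * L ?w"
  have l: "l > 0" unfolding l_def using c_pos L_pos by simp
  define e1 where "e1 = sqrt l *\<^sub>R E 1 x"
  define e2 where "e2 = sqrt l *\<^sub>R E 2 x"
  have ie: "inn x (E a x) (E b x) = (if a = b then 1 / l else 0)" for a b
    by (simp add: inn_E[OF x] H_at \<eta>_def l_def)
  have h: "hor x e1" "hor x e2" unfolding e1_def e2_def by (intro hor_lin hor_E x)+
  define e where "e = (\<lambda>a::4. if a = 1 then e1 else if a = 2 then e2 else if a = 3 then J x *v e1 else J x *v e2)"
  have e: "kahler_frame U g J x e"
    unfolding e_def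
  proof (rule unitary_frame[OF x _ _ _ hor_J[OF x h]])
    show "inn x e1 e1 = 1" "inn x e2 e2 = 1" "inn x e1 e2 = 0"
      using l by (simp_all add: e1_def e2_def bilin_scale ie)
  qed
  interpret f: kahler_frame U g J x e by (rule e)
  have e12: "e 1 = e1" "e 2 = e2" by (simp_all add: e_def)
  have h': "hor x (e 1)" "hor x (e 2)" using h by (simp_all add: e12)
  have ee: "e 1 = sqrt l *\<^sub>R E 1 x" "e 2 = sqrt l *\<^sub>R E 2 x" "e 3 = sqrt l *\<^sub>R (J x *v E 1 x)" "e 4 = sqrt l *\<^sub>R (J x *v E 2 x)"
    by (simp_all add: f.e3 f.e4 e12 e1_def e2_def matrix_vector_mult_scaleR)
  have sq: "sqrt l * (sqrt l * z) = l * z" for z using l by (simp flip: mult.assoc)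
  have cu: "curv g (e 1) (e 3) (e 1) x = (l * Cc ?w) *\<^sub>R e 3" "curv g (e 1) (e 4) (e 1) x = (l * Bc ?w) *\<^sub>R e 4"
    "curv g (e 2) (e 4) (e 2) x = (l * Dc ?w) *\<^sub>R e 4"
    unfolding ee by (simp_all add: curv_scale curv_frame[OF x] sq mult_ac)
  have r: "f.r 1 3 1 3 = l * Cc ?w" "f.r 1 3 1 4 = 0" "f.r 1 4 1 4 = l * Bc ?w" "f.r 2 4 2 4 = l * Dc ?w" "f.r 2 4 2 3 = 0"
    unfolding f.r_def Rm_def cu by (simp_all add: bilin_scale f.orthonormal)
  have r2414: "f.r 2 4 1 4 = 0" using r(5) f.r_J(4) by simp
  have CD: "Cc ?w + Dc ?w = - 4 * Bc ?w"
    unfolding Cc_def Dc_def Bc_def add_divide_distrib[symmetric] by (simp add: algebra_simps)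
  \<comment> \<open>Scalar-flatness determines the horizontal component from the mixed ones. Its
    coincidence with \<open>f.r 1 4 1 4\<close> is what makes the eigenvalue 2K double.\<close>
  have A: "f.r 1 2 1 2 = l * Bc ?w"
  proof -
    have "2 * f.r 1 2 1 2 + 2 * (l * Bc ?w) + l * (Cc ?w + Dc ?w) = 0"
      using f.scalar_table flat by (simp add: r algebra_simps)
    then show ?thesis unfolding CD by simp
  qed
  \<comment> \<open>The numerator of \<open>2 * Bc + Cc\<close> is a multiple of \<open>L\<close>,
    so one power cancels; \<open>\<alpha> - \<beta> = 2 * k\<close> brings in the chirality number.
    The norm of \<rho> follows, its square being \<open>2 * (ric 1 1)\<^sup>2\<close>.\<close>
  have ric: "f.ric 1 1 = 2 * k * M / (L ?w)\<^sup>2"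
  proof -
    have N: "2 * Bc ?w + Cc ?w = - 2 * (\<alpha> - \<beta>) / (c\<^sup>2 * L ?w ^ 3)"
    proof -
      have "2 * Bc ?w + Cc ?w = (- 2 * (\<alpha> - \<beta>) * L ?w) / (c\<^sup>2 * L ?w ^ 4)"
        unfolding Bc_def Cc_def by (simp add: L_def add_divide_distrib[symmetric] algebra_simps)
      also have "\<dots> = - 2 * (\<alpha> - \<beta>) / (c\<^sup>2 * L ?w ^ 3)"
        using nz(1)[of ?w] nz(2) by (simp add: field_simps power_numeral_reduce)
      finally show ?thesis .
    qed
    have "f.ric 1 1 = - l * (2 * Bc ?w + Cc ?w)"
      by (simp add: f.ric_table r A algebra_simps)
    also have "\<dots> = 2 * k * M / (L ?w)\<^sup>2"
      unfolding N l_def \<alpha>_def \<beta>_def c_def using M nz(1)[of ?w]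
      by (simp add: field_simps power2_eq_square power3_eq_cube)
    finally show ?thesis .
  qed
  note hor = frame_curvature_hor[OF x e h']
  have \<rho>: "\<rho> \<in> anti_self_dual (g x) (J x)"
    unfolding \<rho>_def by (rule f.ricci_form_asd[OF flat])
  have \<rho>t: "bilin \<rho> (e 1) (e 2) = 0" "bilin \<rho> (e 1) (e 3) = f.ric 1 1" "bilin \<rho> (e 1) (e 4) = 0"
    unfolding \<rho>_def by (simp_all add: f.ricci_form_table f.ric_table hor r r2414)
  show ?P1
    unfolding f.form_inner_asd[OF \<rho> \<rho>] \<rho>t ric
    by (simp add: L_def \<alpha>_def \<beta>_def power_divide power_mult_distrib flip: power_mult)
       (simp add: power2_eq_square power4_eq_xxxx mult_ac)
  show "weyl_minus g J x \<zeta> = (- gauss_curvature (gtn_sigma M k) (F x)) *\<^sub>R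
        ((6 / form_inner (g x) \<rho> \<rho> * form_inner (g x) \<rho> \<zeta>) *\<^sub>R \<rho> - 2 *\<^sub>R \<zeta>)"
    if "k \<noteq> 0" and \<zeta>: "\<zeta> \<in> anti_self_dual (g x) (J x)"
  proof -
    have "f.ric 1 1 \<noteq> 0" using that M nz(1)[of ?w] by (simp add: ric)
    from f.weyl_minus_rank_one[OF flat \<zeta> hor(1-3) r(2) r2414 _ this]
    show ?thesis by (simp add: \<rho>_def r A hor(4))
  qed
qed

end

section \<open>From charts to the manifold\<close>

lemma dirv_has_derivative:
  fixes f :: "real^'n::finite \<Rightarrow> real"
  assumes "(f has_derivative f') (at x)"
  shows "dirv v f x = f' v"
proof -
  have "f differentiable at x" using assms by (auto simp: differentiable_def)
  from frechet_eq_sum_pd[OF this, of v] show ?thesis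
    by (simp add: dirv_def frechet_derivative_at[OF assms, symmetric])
qed

lemma jacobian_dirv:
  fixes F :: "real^'n::finite \<Rightarrow> real^'m::finite"
  assumes "F differentiable at x"
  shows "(jacobian F (at x) *v v) $ a = dirv v (\<lambda>y. F y $ a) x"
proof -
  have "(F has_derivative (*v) (jacobian F (at x))) (at x)"
    using assms jacobian_works by blast
  from bounded_linear.has_derivative[OF bounded_linear_vec_nth this, of a]
  show ?thesis by (simp add: dirv_has_derivative)
qed

lemma dirv_eq_differential: "dirv v f x = differential f x \<bullet> v"
  by (simp add: dirv_def differential_def inner_vec_def mult.commute)

lemma open_chart_image:
  assumes c: "is_chart c" and A: "open A"
  shows "open (snd c ` (fst c \<inter> A))"
proof -
  have h: "homeomorphism (fst c) (chart_image c) (snd c) (chart_inv c)" "open (fst c)" "open (chart_image c)"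
    using c by (auto simp: is_chart_def)
  have "snd c ` (fst c \<inter> A) = chart_image c \<inter> chart_inv c -` (fst c \<inter> A)"
    using h(1) unfolding homeomorphism_def chart_image_def by force
  moreover have "open (chart_image c \<inter> chart_inv c -` (fst c \<inter> A))"
    using h A by (intro continuous_open_preimage) (auto simp: homeomorphism_def)
  ultimately show ?thesis by simp
qed

lemma chart_inv_apply: "is_chart c \<Longrightarrow> p \<in> fst c \<Longrightarrow> chart_inv c (snd c p) = p"
  by (auto simp: is_chart_def homeomorphism_def)

lemma isCont_chart: "is_chart c \<Longrightarrow> p \<in> fst c \<Longrightarrow> isCont (snd c) p"
  by (auto simp: is_chart_def homeomorphism_def continuous_on_eq_continuous_at)

lemma isCont_chart_inv: "is_chart c \<Longrightarrow> x \<in> chart_image c \<Longrightarrow> isCont (chart_inv c) x"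
  by (auto simp: is_chart_def homeomorphism_def continuous_on_eq_continuous_at)

context toric_local
begin

text \<open>On the horizontal plane \<open>D\<close> is an isometry onto the plane with metric
  \<open>h\<close>, and the gradients represent the rows of \<open>D\<close>. Their Gram matrix is
  thus \<open>D\<close> times its adjoint, that is the inverse of \<open>h\<close>.\<close>

lemma quotient_gram:
  fixes D :: "real^4^2" and h :: "real^2^2"
  assumes x: "x \<in> U"
    and D: "\<And>v a. (D *v v) $ a = dirv v (f a) x" and DX: "\<And>i. D *v X i x = 0"
    and iso: "\<And>v. hor x v \<Longrightarrow> bilin h (D *v v) (D *v v) = inn x v v"
    and h: "transpose h = h"
  shows "inn x (grad g (f a) x) (grad g (f b) x) = matrix_inv h $ a $ b"
proof -
  have hs: "bilin h v w = bilin h w v" for v w using bilin_transpose[of h v w] h by simp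
  have pol: "bilin h (D *v v) (D *v w) = inn x v w" if "hor x v" "hor x w" for v w
    using iso[OF hor_lin(1)[OF that]] iso[OF that(1)] iso[OF that(2)] inn_sym[OF x, of w v] hs[of "D *v w" "D *v v"]
    by (simp add: matrix_vector_right_distrib bilin_simps)
  \<comment> \<open>\<open>D\<close> on the horizontal plane, written in the basis
    \<open>V 1, V 2\<close>. The isometry condition makes it injective, and equality of dimensions
    makes it onto.\<close>
  define T where "T s = D *v (s $ 1 *\<^sub>R V 1 x + s $ 2 *\<^sub>R V 2 x)" for s :: "real^2"
  have hs: "hor x (s *\<^sub>R V 1 x + t *\<^sub>R V 2 x)" for s t by (intro hor_lin hor_V x)
  have l: "linear T"
    by (rule linearI) (simp_all add: T_def matrix_vector_right_distrib matrix_vector_mult_scaleR algebra_simps)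
  have "s = 0" if "T s = 0" for s
  proof -
    have "inn x (s $ 1 *\<^sub>R V 1 x + s $ 2 *\<^sub>R V 2 x) (s $ 1 *\<^sub>R V 1 x + s $ 2 *\<^sub>R V 2 x) = 0"
      unfolding iso[OF hs, symmetric] that[unfolded T_def] by (rule bilin_0)
    then have "s $ 1 = 0 \<and> s $ 2 = 0" using indep_V[OF x] inn_eq_0D[OF x] by blast
    then show ?thesis by (simp add: vec_eq_iff forall_2)
  qed
  then have "inj T" using linear_injective_0[OF l] by blast
  then have surj: "surj T" using l linear_injective_imp_surjective by blast
  let ?E = "\<lambda>a. grad g (f a) x"
  have hE: "hor x (?E a)" for a
    unfolding hor_def inn_grad[OF x] D[symmetric] DX by simp
  define G where "G = (\<chi> a b. inn x (?E a) (?E b))"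
  have "h *v (G *v w) = w" for w
  proof -
    obtain v where v: "hor x v" "D *v v = G *v w" using surjD[OF surj, of "G *v w"] hs unfolding T_def by metis
    have DE: "(D *v v') $ a = inn x (?E a) v'" for a v' by (simp add: D inn_grad[OF x])
    have Gw: "G *v w = D *v (\<Sum>b\<in>UNIV. w $ b *\<^sub>R ?E b)"
    proof (rule vec_eq_iff[THEN iffD2], rule allI)
      fix a
      have "(G *v w) $ a = (\<Sum>b\<in>UNIV. inn x (?E a) (?E b) * w $ b)" by (simp add: G_def matrix_vector_mult_def)
      then show "(G *v w) $ a = (D *v (\<Sum>b\<in>UNIV. w $ b *\<^sub>R ?E b)) $ a"
        unfolding DE by (simp add: bilin_simps mult.commute)
    qed
    have hw: "hor x (\<Sum>b\<in>UNIV. w $ b *\<^sub>R ?E b)" by (simp add: sum_2 hor_lin hE)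
    have "(h *v (G *v w)) \<bullet> (D *v v') = w \<bullet> (D *v v')" if "hor x v'" for v'
    proof -
      have "(h *v (G *v w)) \<bullet> (D *v v') = bilin h (D *v v') (G *v w)" by (simp add: bilin_def inner_commute)
      also have "\<dots> = inn x v' (\<Sum>b\<in>UNIV. w $ b *\<^sub>R ?E b)" unfolding Gw by (rule pol[OF that hw])
      also have "\<dots> = w \<bullet> (D *v v')"
        by (simp add: bilin_simps inner_vec_def DE inn_sym[OF x, of v'])
      finally show ?thesis .
    qed
    then have "(h *v (G *v w)) \<bullet> s = w \<bullet> s" for s
      using surjD[OF surj, of s] hs unfolding T_def by metis
    then show ?thesis using vector_eq_rdot by blast
  qed
  then have "h ** G = mat 1" by (metis matrix_eq matrix_vector_mul_assoc matrix_vector_mul_lid)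
  then show ?thesis using matrix_inv_eqI[of h G] by (simp add: G_def)
qed

definition gram where "gram x = inn x (V 1 x) (V 1 x) * inn x (V 2 x) (V 2 x) - (inn x (V 1 x) (V 2 x))\<^sup>2"

lemma gram_nz: "x \<in> U \<Longrightarrow> gram x \<noteq> 0"
proof
  assume x: "x \<in> U" and 0: "gram x = 0"
  let ?w = "(- inn x (V 1 x) (V 2 x)) *\<^sub>R V 1 x + inn x (V 1 x) (V 1 x) *\<^sub>R V 2 x"
  have "inn x ?w ?w = inn x (V 1 x) (V 1 x) * gram x"
    unfolding gram_def by (simp add: bilin_simps inn_sym[OF x, of "V 2 x" "V 1 x"] algebra_simps power2_eq_square)
  then have "?w = 0" using 0 by (intro inn_eq_0D[OF x]) simp
  then have "inn x (V 1 x) (V 1 x) = 0" using indep_V[OF x] by blast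
  then have "V 1 x = 0" by (rule inn_eq_0D[OF x])
  then show False using indep_V[OF x, of 1 0] by simp
qed

lemma continuous_Rm_gram:
  "continuous_on U (\<lambda>x. Rm g x (V 1 x) (V 2 x) (V 2 x) (V 1 x))" (is ?P1) "continuous_on U gram"
proof -
  have V: "smooth_on U (\<lambda>x. V i x $ j)" for i j using smooth_V by (simp add: smooth_vec_on_def)
  have "smooth_on U (\<lambda>x. \<Sum>i\<in>UNIV. \<Sum>j\<in>UNIV. \<Sum>k\<in>UNIV. \<Sum>l\<in>UNIV.
      V 1 x $ i * V 2 x $ j * V 2 x $ k * V 1 x $ l * riemann g i j k l x)"
    by (intro smooth_intros open_U V smooth_riemann)
  then show ?P1
    by (intro iffD1[OF continuous_on_cong[OF refl] smooth_on_imp_continuous_on]) (simp_all add: Rm_sum)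
  show "continuous_on U gram"
    unfolding gram_def[abs_def] power2_eq_square
    by (intro smooth_on_imp_continuous_on smooth_intros open_U smooth_inn smooth_V)
qed

end

text \<open>Expresses the curvature of the quotient by data of \<open>N\<close> alone;
  \<open>F\<close> and \<open>h\<close> disappear from the right-hand side.\<close>

lemma (in toric_quotient) gauss_gram:
  "x \<in> U \<Longrightarrow> gauss_curvature h (F x) = Rm g x (V 1 x) (V 2 x) (V 2 x) (V 1 x) / gram x"
  using Rm_hor[of x "V 1 x" "V 2 x"] hor_V gram_nz[of x] by (simp add: gram_def)

lemma riemannian_metric_on_subset: "riemannian_metric_on S g \<Longrightarrow> T \<subseteq> S \<Longrightarrow> riemannian_metric_on T g"
  by (auto simp: riemannian_metric_on_def smooth_mat_on_def intro: smooth_on_subset)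

lemma kahler_on_subset: "kahler_on S g J \<Longrightarrow> T \<subseteq> S \<Longrightarrow> kahler_on T g J"
  unfolding kahler_on_def by (auto simp: smooth_mat_on_def intro: smooth_on_subset riemannian_metric_on_subset)

section \<open>From local quotients to functions on the manifold\<close>

locale toric_manifold =
  fixes N :: "'a::{t2_space,second_countable_topology} toric_data"
  assumes toric: "toric_kahler N"
begin

lemma chart: "c \<in> atlas N \<Longrightarrow> is_chart c"
  using toric by (auto simp: toric_kahler_def smooth_atlas_def)

lemma open_image: "c \<in> atlas N \<Longrightarrow> open (chart_image c)"
  using chart by (auto simp: is_chart_def)

lemma open_regular: "open (regular N)"
  using toric by (simp add: toric_kahler_def)

lemma kahler_chart: "c \<in> atlas N \<Longrightarrow> kahler_on (chart_image c) (metric_in N c) (cplx_in N c)"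
  using toric by (auto simp: toric_kahler_def)

lemma kahler_surface_chart: "c \<in> atlas N \<Longrightarrow> kahler_surface (chart_image c) (metric_in N c) (cplx_in N c)"
  using kahler_chart open_image
  by (auto simp: kahler_surface_def kahler_def kahler_axioms_def riemannian_def kahler_on_def)

lemma toric_local_chart:
  assumes c: "c \<in> atlas N" and U: "open U" "U \<subseteq> snd c ` (fst c \<inter> regular N)"
  shows "toric_local U (metric_in N c) (cplx_in N c) (\<lambda>i. killing_in N i c) (\<lambda>i. moment_in N i c)"
proof -
  have sub: "U \<subseteq> chart_image c" using U(2) by (auto simp: chart_image_def)
  have t: "smooth_vec_on (chart_image c) (killing_in N i c)" "smooth_on (chart_image c) (moment_in N i c)" for i
    using toric c by (auto simp: toric_kahler_def)
  have u: "lie_cov2 (killing_in N i c) (metric_in N c) x = 0"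
     "killing_in N i c x = cplx_in N c x *v grad (metric_in N c) (moment_in N i c) x"
     "lie_bracket (grad (metric_in N c) (moment_in N 1 c)) (grad (metric_in N c) (moment_in N 2 c)) x = 0"
     "differential (moment_in N i c) x \<bullet> killing_in N j c x = 0" if "x \<in> U" for x i j
    using toric c that sub unfolding toric_kahler_def by blast+
  show ?thesis
  proof
    show "open U" by fact
    show "kahler_on U (metric_in N c) (cplx_in N c)" by (rule kahler_on_subset[OF kahler_chart[OF c] sub])
    then show "riemannian_metric_on U (metric_in N c)" by (simp add: kahler_on_def)
    show "smooth_vec_on U (killing_in N i c)" "smooth_on U (moment_in N i c)" for i
      using t sub by (auto simp: smooth_vec_on_def intro: smooth_on_subset)
    show "dirv (killing_in N j c x) (moment_in N i c) x = 0" if "x \<in> U" for x i j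
      using u(4)[OF that] by (simp add: dirv_eq_differential)
    show "a = 0 \<and> b = 0" if "x \<in> U" "a *\<^sub>R killing_in N 1 c x + b *\<^sub>R killing_in N 2 c x = 0" for x a b
      using that U(2) c unfolding regular_def by blast
  qed (use u in auto)
qed

lemma toric_quotient_chart:
  assumes c: "c \<in> atlas N" and q: "local_quotient N V \<pi> h"
  defines "U \<equiv> snd c ` (fst c \<inter> V)"
  shows "toric_quotient U (metric_in N c) (cplx_in N c) (\<lambda>i. killing_in N i c) (\<lambda>i. moment_in N i c)
     (\<pi> \<circ> chart_inv c) (\<pi> ` V) h"
proof -
  have V: "open V" "V \<subseteq> regular N" and W: "open (\<pi> ` V)" "riemannian_metric_on (\<pi> ` V) h"
    and sm: "smooth_vec_on U (\<pi> \<circ> chart_inv c)"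
    using q c unfolding local_quotient_def U_def by blast+
  have D: "jacobian (\<pi> \<circ> chart_inv c) (at (snd c p)) *v killing_in N i c (snd c p) = 0"
    "(\<And>i. bilin (metric_in N c (snd c p)) v (killing_in N i c (snd c p)) = 0) \<Longrightarrow>
       bilin (h (\<pi> p)) (jacobian (\<pi> \<circ> chart_inv c) (at (snd c p)) *v v) (jacobian (\<pi> \<circ> chart_inv c) (at (snd c p)) *v v)
         = bilin (metric_in N c (snd c p)) v v" if "p \<in> fst c \<inter> V" for p i v
    using q c that unfolding local_quotient_def Let_def by blast+
  have oU: "open U" unfolding U_def by (rule open_chart_image[OF chart[OF c] V(1)])
  interpret toric_local U "metric_in N c" "cplx_in N c" "\<lambda>i. killing_in N i c" "\<lambda>i. moment_in N i c"
    by (rule toric_local_chart[OF c oU]) (use V(2) in \<open>auto simp: U_def\<close>)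
  have Ux: "\<exists>p\<in>fst c \<inter> V. x = snd c p \<and> chart_inv c x = p" if "x \<in> U" for x
    using that chart_inv_apply[OF chart[OF c]] by (auto simp: U_def)
  have jd: "(jacobian (\<pi> \<circ> chart_inv c) (at x) *v v) $ a = dirv v (\<lambda>y. (\<pi> \<circ> chart_inv c) y $ a) x" if "x \<in> U" for x v a
    by (rule jacobian_dirv[OF smooth_vec_on_imp_differentiable[OF sm oU that]])
  show ?thesis
  proof
    show "smooth_vec_on U (\<pi> \<circ> chart_inv c)" by (rule sm)
    show "(\<pi> \<circ> chart_inv c) x \<in> \<pi> ` V" if "x \<in> U" for x using Ux[OF that] by auto
    show "open (\<pi> ` V)" "riemannian_metric_on (\<pi> ` V) h" by (rule W)+
    show "dirv (killing_in N i c x) (\<lambda>y. (\<pi> \<circ> chart_inv c) y $ a) x = 0" if x: "x \<in> U" for x i a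
    proof -
      obtain p where p: "p \<in> fst c \<inter> V" "x = snd c p" using Ux[OF x] by blast
      show ?thesis unfolding jd[OF x, symmetric] unfolding p(2) D(1)[OF p(1)] by simp
    qed
    show "inn x (grad (metric_in N c) (\<lambda>y. (\<pi> \<circ> chart_inv c) y $ a) x) (grad (metric_in N c) (\<lambda>y. (\<pi> \<circ> chart_inv c) y $ b) x)
       = matrix_inv (h ((\<pi> \<circ> chart_inv c) x)) $ a $ b" if x: "x \<in> U" for x a b
    proof -
      obtain p where p: "p \<in> fst c \<inter> V" "x = snd c p" "chart_inv c x = p" using Ux[OF x] by blast
      have "transpose (h (\<pi> p)) = h (\<pi> p)" using W(2) p(1) by (auto simp: riemannian_metric_on_def)
      moreover have "bilin (h (\<pi> p)) (jacobian (\<pi> \<circ> chart_inv c) (at x) *v v) (jacobian (\<pi> \<circ> chart_inv c) (at x) *v v) = inn x v v"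
        if "hor x v" for v
        using D(2)[OF p(1), of v] that unfolding p(2) hor_def by blast
      moreover have "jacobian (\<pi> \<circ> chart_inv c) (at x) *v killing_in N i c x = 0" for i
        using D(1)[OF p(1)] p(2) by simp
      ultimately show ?thesis
        using quotient_gram[OF x, of "jacobian (\<pi> \<circ> chart_inv c) (at x)" "\<lambda>a y. (\<pi> \<circ> chart_inv c) y $ a" "h (\<pi> p)" a b]
          jd[OF x] p(3) by simp
    qed
  qed
qed

lemma quotient_eigenform:
  assumes c: "c \<in> atlas N" and p: "p \<in> fst c \<inter> regular N" and K: "is_quotient_curvature N K"
    and flat: "scalar_flat N"
  defines "x \<equiv> snd c p"
  defines "g \<equiv> metric_in N c" and "J \<equiv> cplx_in N c" and "\<omega> \<equiv> omega_minus N c x"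
  shows "\<omega> \<in> anti_self_dual (g x) (J x)" "\<omega> \<noteq> 0" "weyl_minus g J x \<omega> = (2 * K p) *\<^sub>R \<omega>" (is ?P1)
proof -
  obtain V \<pi> h where q: "local_quotient N V \<pi> h" "p \<in> V" "K p = gauss_curvature h (\<pi> p)"
    using K p unfolding is_quotient_curvature_def by blast
  interpret toric_quotient "snd c ` (fst c \<inter> V)" "metric_in N c" "cplx_in N c" "\<lambda>i. killing_in N i c" "\<lambda>i. moment_in N i c"
    "\<pi> \<circ> chart_inv c" "\<pi> ` V" h
    by (rule toric_quotient_chart[OF c q(1)])
  have x: "x \<in> snd c ` (fst c \<inter> V)" using p q(2) by (auto simp: x_def)
  have "x \<in> chart_image c" using p by (auto simp: x_def chart_image_def)
  then have s: "scalar_curvature (metric_in N c) x = 0" using flat c by (auto simp: scalar_flat_def)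
  have om: "\<omega> = omega x" by (simp add: \<omega>_def omega_minus_def omega_def)
  have Kp: "K p = gauss_curvature h ((\<pi> \<circ> chart_inv c) x)"
    using q(3) chart_inv_apply[OF chart[OF c], of p] p by (simp add: x_def)
  show "\<omega> \<in> anti_self_dual (g x) (J x)" "\<omega> \<noteq> 0" ?P1
    unfolding om g_def J_def Kp by (rule omega_eigenform[OF x s])+
qed

definition "Vc i c = grad (metric_in N c) (moment_in N i c)"

definition "gram_in c x = bilin (metric_in N c x) (Vc 1 c x) (Vc 1 c x) * bilin (metric_in N c x) (Vc 2 c x) (Vc 2 c x)
   - (bilin (metric_in N c x) (Vc 1 c x) (Vc 2 c x))\<^sup>2"

definition "horizontal_curvature c x =
   Rm (metric_in N c) x (Vc 1 c x) (Vc 2 c x) (Vc 2 c x) (Vc 1 c x) / gram_in c x"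

text \<open>The value of \<open>K\<close> does not depend on which local quotient witnesses
  \<open>is_quotient_curvature\<close> at the point.\<close>

lemma quotient_curvature_eq:
  assumes c: "c \<in> atlas N" and p: "p \<in> fst c \<inter> regular N" and K: "is_quotient_curvature N K"
  shows "K p = horizontal_curvature c (snd c p)"
proof -
  obtain V \<pi> h where q: "local_quotient N V \<pi> h" "p \<in> V" "K p = gauss_curvature h (\<pi> p)"
    using K p unfolding is_quotient_curvature_def by blast
  interpret toric_quotient "snd c ` (fst c \<inter> V)" "metric_in N c" "cplx_in N c" "\<lambda>i. killing_in N i c" "\<lambda>i. moment_in N i c"
    "\<pi> \<circ> chart_inv c" "\<pi> ` V" h
    by (rule toric_quotient_chart[OF c q(1)])
  have x: "snd c p \<in> snd c ` (fst c \<inter> V)" using p q(2) by auto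
  have "K p = gauss_curvature h ((\<pi> \<circ> chart_inv c) (snd c p))"
    using q(3) chart_inv_apply[OF chart[OF c], of p] p by simp
  also have "\<dots> = horizontal_curvature c (snd c p)"
    using gauss_gram[OF x] by (simp add: horizontal_curvature_def gram_in_def gram_def Vc_def)
  finally show ?thesis .
qed

text \<open>\<open>K\<close> may be witnessed by unrelated local quotients at different points, yet
  in a chart it is \<open>horizontal_curvature\<close>, which is continuous because the Gram
  determinant does not vanish there.\<close>

lemma isCont_quotient_curvature:
  assumes p: "p \<in> regular N" and K: "is_quotient_curvature N K"
  shows "isCont K p"
proof -
  obtain c where c: "c \<in> atlas N" "p \<in> fst c"
    using toric unfolding toric_kahler_def smooth_atlas_def by blast
  let ?U = "snd c ` (fst c \<inter> regular N)"
  have oU: "open ?U" by (rule open_chart_image[OF chart[OF c(1)] open_regular])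
  interpret toric_local ?U "metric_in N c" "cplx_in N c" "\<lambda>i. killing_in N i c" "\<lambda>i. moment_in N i c"
    by (rule toric_local_chart[OF c(1) oU order_refl])
  have "continuous_on ?U (\<lambda>x. Rm (metric_in N c) x (V 1 x) (V 2 x) (V 2 x) (V 1 x) / gram x)"
    using gram_nz by (intro continuous_on_divide continuous_Rm_gram) auto
  then have "continuous_on ?U (horizontal_curvature c)"
    unfolding horizontal_curvature_def[abs_def] gram_in_def gram_def Vc_def .
  then have "\<forall>x\<in>?U. isCont (horizontal_curvature c) x"
    by (simp only: continuous_on_eq_continuous_at[OF oU])
  then have "isCont (horizontal_curvature c) (snd c p)"
    by (rule bspec) (rule imageI, rule IntI[OF c(2) p])
  then have "isCont (\<lambda>q. horizontal_curvature c (snd c q)) p"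
    by (rule isCont_o2[OF isCont_chart[OF chart[OF c(1)] c(2)]])
  moreover have "\<forall>\<^sub>F q in nhds p. K q = horizontal_curvature c (snd c q)"
  proof -
    have "open (fst c \<inter> regular N)" using chart[OF c(1)] open_regular by (auto simp: is_chart_def)
    then have "\<forall>\<^sub>F q in nhds p. q \<in> fst c \<inter> regular N" using c p by (intro eventually_nhds_in_open) auto
    then show ?thesis by eventually_elim (rule quotient_curvature_eq[OF c(1) _ K])
  qed
  ultimately show ?thesis by (subst isCont_cong)
qed

end

section \<open>Continuity of the curvature operators on a whole chart, regular or not\<close>

context kahler_surface
begin

abbreviation cmat :: "(real^4 \<Rightarrow> real^4^4) \<Rightarrow> bool" where
  "cmat A \<equiv> \<forall>i j. continuous_on U (\<lambda>x. A x $ i $ j)"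

lemmas cont_intros = continuous_on_sum continuous_on_mult continuous_on_add continuous_on_diff
  continuous_on_divide continuous_on_const

lemma cmat_basic: "cmat (\<lambda>_. A)" "cmat g" "cmat (\<lambda>x. matrix_inv (g x))" "cmat J" "cmat (ricci g)"
  using smooth_on_imp_continuous_on[OF smooth_g] smooth_on_imp_continuous_on[OF smooth_ginv]
    smooth_on_imp_continuous_on[OF smooth_J] smooth_on_imp_continuous_on[OF smooth_ricci]
  by auto

lemma cmat_mult: "cmat A \<Longrightarrow> cmat B \<Longrightarrow> cmat (\<lambda>x. A x ** B x)"
  unfolding matrix_matrix_mult_def vec_lambda_beta by (intro allI cont_intros) auto

lemma cmat_transpose: "cmat A \<Longrightarrow> cmat (\<lambda>x. transpose (A x))"
  by (simp add: transpose_def)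

lemma cmat_raise2: "cmat Z \<Longrightarrow> cmat (\<lambda>x. raise2 (g x) (Z x))"
  unfolding raise2_def by (intro cmat_mult cmat_basic)

lemma cmat_hodge: "cmat Z \<Longrightarrow> cmat (\<lambda>x. hodge_star (g x) (J x) (Z x))"
proof -
  assume "cmat Z"
  then have r: "cmat (\<lambda>x. raise2 (g x) (Z x))" by (rule cmat_raise2)
  have w: "cmat (\<lambda>x. transpose (J x) ** g x)" by (intro cmat_mult cmat_transpose cmat_basic)
  show ?thesis
    unfolding hodge_star_def complex_volume_def Let_def vec_lambda_beta
    using r w by (intro allI cont_intros) auto
qed

lemma cmat_asd: "cmat Z \<Longrightarrow> cmat (\<lambda>x. asd_part (g x) (J x) (Z x))"
  using cmat_hodge[of Z] unfolding asd_part_def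
  by (auto intro!: cont_intros)

lemma cmat_weyl_op: "cmat Z \<Longrightarrow> cmat (\<lambda>x. weyl_op g x (Z x))"
proof -
  assume "cmat Z"
  then have r: "cmat (\<lambda>x. raise2 (g x) (Z x))" by (rule cmat_raise2)
  have w: "continuous_on U (\<lambda>x. weyl g i j k l x)" for i j k l
    unfolding weyl_def
    by (intro smooth_on_imp_continuous_on smooth_intros smooth_on_divide open_U smooth_g smooth_ricci smooth_riemann smooth_scalar) auto
  show ?thesis
    unfolding weyl_op_def tensor_act_def vec_lambda_beta
    using r w by (intro allI cont_intros) auto
qed

lemma cmat_weyl_minus: "cmat Z \<Longrightarrow> cmat (\<lambda>x. weyl_minus g J x (Z x))"
  unfolding weyl_minus_def by (intro cmat_asd cmat_weyl_op)

lemma cmat_ricci_form: "cmat (ricci_form g J)"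
proof -
  have "cmat (\<lambda>x. transpose (J x) ** ricci g x)" by (intro cmat_mult cmat_transpose cmat_basic)
  then show ?thesis by (simp add: ricci_form_def)
qed

lemma continuous_on_form_inner: "cmat Y \<Longrightarrow> cmat Z \<Longrightarrow> continuous_on U (\<lambda>x. form_inner (g x) (Y x) (Z x))"
  unfolding form_inner_def using cmat_raise2[of Z] by (intro cont_intros) auto

end

section \<open>Polar coordinates and the prescribed Taub-NUT data\<close>

lemma c2_coords_nth: "c2_coords w $ 1 = Re (fst w)" "c2_coords w $ 2 = Im (fst w)"
  "c2_coords w $ 3 = Re (snd w)" "c2_coords w $ 4 = Im (snd w)"
  by (simp_all add: c2_coords_def vector_def)

lemma c2_coords_eq_iff: "c2_coords w = c2_coords w' \<longleftrightarrow> w = w'"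
  by (auto simp: vec_eq_iff forall_4 c2_coords_nth prod_eq_iff complex_eq_iff)

lemma uv_part_nth: "uv_part y $ 1 = y $ 1" "uv_part y $ 2 = y $ 2"
  by (simp_all add: uv_part_def)

lemma theta_part_nth: "theta_part y $ 1 = y $ 3" "theta_part y $ 2 = y $ 4"
  by (simp_all add: theta_part_def)

text \<open>Derivatives along pushed-forward vectors are computed in polar coordinates, where
  \<open>f\<close> pulled back along \<Phi> has the known local expression \<open>p\<close>.\<close>

lemma dirv_jacobian_chain:
  fixes \<Phi> :: "real^4 \<Rightarrow> real^4"
  assumes f: "f differentiable at (\<Phi> y)" and \<Phi>: "\<Phi> differentiable at y"
    and T: "open T" "y \<in> T" "\<And>y'. y' \<in> T \<Longrightarrow> f (\<Phi> y') = p y'" and p: "(p has_derivative p') (at y)"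
  shows "dirv (jacobian \<Phi> (at y) *v a) f (\<Phi> y) = p' a"
proof -
  have "(f has_derivative frechet_derivative f (at (\<Phi> y))) (at (\<Phi> y))"
    using f frechet_derivative_works by blast
  moreover have "(\<Phi> has_derivative (*v) (jacobian \<Phi> (at y))) (at y)"
    using \<Phi> jacobian_works by blast
  ultimately have "((\<lambda>y. f (\<Phi> y)) has_derivative (\<lambda>a. frechet_derivative f (at (\<Phi> y)) (jacobian \<Phi> (at y) *v a))) (at y)"
    using diff_chain_at[of \<Phi> _ y f] by (simp add: o_def)
  moreover have "((\<lambda>y. f (\<Phi> y)) has_derivative p') (at y)"
    using has_derivative_cong_open[of T y "\<lambda>y. f (\<Phi> y)" p p'] T p by blast
  ultimately have "frechet_derivative f (at (\<Phi> y)) (jacobian \<Phi> (at y) *v a) = p' a"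
    by (metis has_derivative_unique)
  then show ?thesis by (simp add: dirv_def frechet_eq_sum_pd[OF f])
qed

definition polar_chart :: "real^4 \<Rightarrow> real^4" where
  "polar_chart y = c2_coords (gtn_polar y)"

lemma polar_chart_nth: "polar_chart y $ 1 = y $ 1 * cos (y $ 4 / sqrt 2)" "polar_chart y $ 2 = y $ 1 * sin (y $ 4 / sqrt 2)"
  "polar_chart y $ 3 = y $ 2 * cos (y $ 3 / sqrt 2)" "polar_chart y $ 4 = y $ 2 * sin (y $ 3 / sqrt 2)"
  by (simp_all add: polar_chart_def c2_coords_nth gtn_polar_def)

lemma has_derivative_polar:
  fixes y :: "real^4" and d :: real
  assumes "d \<noteq> 0"
  shows "((\<lambda>y. y $ i * cos (y $ j / d)) has_derivative (\<lambda>a. a $ i * cos (y $ j / d) - y $ i * sin (y $ j / d) * (a $ j / d))) (at y)"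
    "((\<lambda>y. y $ i * sin (y $ j / d)) has_derivative (\<lambda>a. a $ i * sin (y $ j / d) + y $ i * cos (y $ j / d) * (a $ j / d))) (at y)"
  using assms by (auto intro!: derivative_eq_intros simp: fun_eq_iff field_simps)

lemma polar_chart_derivative:
  "((\<lambda>y. polar_chart y $ 1) has_derivative (\<lambda>a. a $ 1 * cos (y $ 4 / sqrt 2) - y $ 1 * sin (y $ 4 / sqrt 2) * (a $ 4 / sqrt 2))) (at y)"
  "((\<lambda>y. polar_chart y $ 2) has_derivative (\<lambda>a. a $ 1 * sin (y $ 4 / sqrt 2) + y $ 1 * cos (y $ 4 / sqrt 2) * (a $ 4 / sqrt 2))) (at y)"
  "((\<lambda>y. polar_chart y $ 3) has_derivative (\<lambda>a. a $ 2 * cos (y $ 3 / sqrt 2) - y $ 2 * sin (y $ 3 / sqrt 2) * (a $ 3 / sqrt 2))) (at y)"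
  "((\<lambda>y. polar_chart y $ 4) has_derivative (\<lambda>a. a $ 2 * sin (y $ 3 / sqrt 2) + y $ 2 * cos (y $ 3 / sqrt 2) * (a $ 3 / sqrt 2))) (at y)"
  unfolding polar_chart_nth by (intro has_derivative_polar; simp)+

lemma polar_chart_differentiable: "polar_chart differentiable at y"
proof (rule differentiable_vecI)
  have "\<forall>k. (\<lambda>y. polar_chart y $ k) differentiable at y"
    unfolding forall_4 using polar_chart_derivative unfolding differentiable_def by blast
  then show "(\<lambda>y. polar_chart y $ k) differentiable at y" for k by blast
qed

text \<open>Rotating the two equations back by the angle \<open>t\<close> isolates \<open>a\<close>
  and \<open>r * b\<close>.\<close>

lemma rotation_kernel:
  fixes a b r s :: real
  assumes "a * cos t - r * sin t * b = 0" "a * sin t + r * cos t * b = 0" "r \<noteq> 0"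
  shows "a = 0 \<and> b = 0"
proof -
  have "a = cos t * (a * cos t - r * sin t * b) + sin t * (a * sin t + r * cos t * b)"
    "r * b = cos t * (a * sin t + r * cos t * b) - sin t * (a * cos t - r * sin t * b)"
    using sin_cos_squared_add[of t] by (algebra, algebra)
  then have "a = 0" "r * b = 0" unfolding assms by simp_all
  then show ?thesis using assms(3) by simp
qed

locale gtn_manifold = toric_manifold N for N :: "'a::{t2_space,second_countable_topology} toric_data" +
  fixes M k :: real and z :: "'a \<Rightarrow> complex \<times> complex"
  assumes M: "M > 0" and k: "k \<in> {-1..1}" and z: "bij z"
    and atlas0: "smooth_atlas (insert (UNIV, c2_coords \<circ> z) (atlas N))"
    and data: "\<And>y. 0 < y$1 \<Longrightarrow> 0 < y$2 \<Longrightarrow> (let p = inv z (gtn_polar y) in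
            (\<forall>i. moment N i p = gtn_moment M k i (uv_part y)) \<and>
            (\<forall>c\<in>atlas N. p \<in> fst c \<longrightarrow>
              (let D = jacobian (snd c \<circ> inv z \<circ> gtn_polar) (at y) in
                killing_in N 1 c (snd c p) = D *v axis 3 1 \<and>
                killing_in N 2 c (snd c p) = D *v axis 4 1 \<and>
                (\<forall>a b. bilin (metric_in N c (snd c p)) (D *v a) (D *v b) =
                   bilin (gtn_sigma M k (uv_part y)) (uv_part a) (uv_part b) +
                   bilin (gtn_G M k (uv_part y)) (theta_part a) (theta_part b)))))"
begin

abbreviation c0 :: "'a chart" where "c0 \<equiv> (UNIV, c2_coords \<circ> z)"

lemma chart_c0: "is_chart c0"
  using atlas0 by (simp add: smooth_atlas_def)

lemma chart_inv_c0: "chart_inv c0 (c2_coords w) = inv z w"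
proof -
  have "(c2_coords \<circ> z) (inv z w) = c2_coords w" using z by (simp add: bij_is_surj surj_f_inv_f)
  moreover have "inj (c2_coords \<circ> z)" using z by (auto simp: inj_on_def c2_coords_eq_iff bij_def)
  ultimately show ?thesis unfolding chart_inv_def by (metis fst_conv snd_conv inv_f_f)
qed

lemma z_inv: "z (inv z w) = w" "inv z (z q) = q"
  using z by (simp_all add: bij_is_surj surj_f_inv_f bij_is_inj)

lemma smooth_to_c0: "c \<in> atlas N \<Longrightarrow> smooth_vec_on (chart_image c) (\<lambda>x. c2_coords (z (chart_inv c x)))"
  and smooth_from_c0: "c \<in> atlas N \<Longrightarrow> smooth_vec_on (snd c0 ` fst c) (snd c \<circ> chart_inv c0)"
proof -
  assume c: "c \<in> atlas N"
  then have "smooth_vec_on (snd c ` (fst c \<inter> fst c0)) (snd c0 \<circ> chart_inv c)"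
    "smooth_vec_on (snd c0 ` (fst c0 \<inter> fst c)) (snd c \<circ> chart_inv c0)"
    using atlas0 unfolding smooth_atlas_def by blast+
  then show "smooth_vec_on (chart_image c) (\<lambda>x. c2_coords (z (chart_inv c x)))"
    "smooth_vec_on (snd c0 ` fst c) (snd c \<circ> chart_inv c0)"
    by (simp_all add: chart_image_def o_def)
qed

text \<open>The complement of the two axes, which is the region reached by polar coordinates with
  \<open>u, v > 0\<close>.\<close>

definition A where "A = {q. fst (z q) \<noteq> 0 \<and> snd (z q) \<noteq> 0}"

text \<open>The coordinates \<open>u, v\<close> as functions on a chart. They are continuous
  everywhere but smooth only off the axes, where the square roots in \<open>F_sqrt\<close> have
  positive arguments.\<close>

definition F where "F c x = (vector [cmod (fst (z (chart_inv c x))), cmod (snd (z (chart_inv c x)))] :: real^2)" for c x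

lemma F_nth: "F c x $ 1 = cmod (fst (z (chart_inv c x)))" "F c x $ 2 = cmod (snd (z (chart_inv c x)))"
  by (simp_all add: F_def)

lemma F_sqrt: "F c x $ 1 = sqrt (c2_coords (z (chart_inv c x)) $ 1 * c2_coords (z (chart_inv c x)) $ 1 +
    c2_coords (z (chart_inv c x)) $ 2 * c2_coords (z (chart_inv c x)) $ 2)"
  "F c x $ 2 = sqrt (c2_coords (z (chart_inv c x)) $ 3 * c2_coords (z (chart_inv c x)) $ 3 +
    c2_coords (z (chart_inv c x)) $ 4 * c2_coords (z (chart_inv c x)) $ 4)"
  by (simp_all add: F_nth c2_coords_nth cmod_def power2_eq_square)

lemma continuous_F: "c \<in> atlas N \<Longrightarrow> continuous_on (chart_image c) (\<lambda>x. F c x $ a)"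
proof -
  assume c: "c \<in> atlas N"
  have s: "continuous_on (chart_image c) (\<lambda>x. c2_coords (z (chart_inv c x)) $ i)" for i
    by (rule smooth_on_imp_continuous_on) (use smooth_to_c0[OF c] in \<open>simp add: smooth_vec_on_def\<close>)
  have "\<forall>a. continuous_on (chart_image c) (\<lambda>x. F c x $ a)"
    unfolding forall_2 F_sqrt
    by (intro conjI continuous_on_real_sqrt continuous_on_add continuous_on_mult s)
  then show ?thesis by blast
qed

lemma open_A: "open A"
proof -
  have c: "continuous_on UNIV (\<lambda>q. (c2_coords \<circ> z) q $ i)" for i
    using chart_c0 by (auto simp: is_chart_def homeomorphism_def intro: continuous_intros)
  have "A = {q. ((c2_coords \<circ> z) q $ 1 \<noteq> 0 \<or> (c2_coords \<circ> z) q $ 2 \<noteq> 0) \<and> ((c2_coords \<circ> z) q $ 3 \<noteq> 0 \<or> (c2_coords \<circ> z) q $ 4 \<noteq> 0)}"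
    by (auto simp: A_def c2_coords_nth complex_eq_iff)
  then show ?thesis
    by (simp only:) (intro open_Collect_conj open_Collect_disj open_Collect_neq c continuous_on_const)
qed

definition U where "U c = snd c ` (fst c \<inter> A)"

lemma open_U: "c \<in> atlas N \<Longrightarrow> open (U c)"
  unfolding U_def by (rule open_chart_image[OF chart open_A])

lemma U_sub: "U c \<subseteq> chart_image c"
  by (auto simp: U_def chart_image_def)

lemma smooth_F: "c \<in> atlas N \<Longrightarrow> smooth_vec_on (U c) (F c)"
proof -
  assume c: "c \<in> atlas N"
  have s: "smooth_on (U c) (\<lambda>x. c2_coords (z (chart_inv c x)) $ i)" for i
    by (rule smooth_on_subset[OF _ U_sub]) (use smooth_to_c0[OF c] in \<open>simp add: smooth_vec_on_def\<close>)
  have nz: "fst (z (chart_inv c x)) \<noteq> 0" "snd (z (chart_inv c x)) \<noteq> 0" if "x \<in> U c" for x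
    using that chart_inv_apply[OF chart[OF c]] by (auto simp: U_def A_def)
  have "\<forall>a. smooth_on (U c) (\<lambda>x. F c x $ a)"
    unfolding forall_2 F_sqrt
  proof (intro conjI smooth_on_sqrt smooth_intros open_U[OF c] s)
    fix x assume "x \<in> U c"
    from nz[OF this] show "0 < c2_coords (z (chart_inv c x)) $ 1 * c2_coords (z (chart_inv c x)) $ 1 +
       c2_coords (z (chart_inv c x)) $ 2 * c2_coords (z (chart_inv c x)) $ 2"
      "0 < c2_coords (z (chart_inv c x)) $ 3 * c2_coords (z (chart_inv c x)) $ 3 +
       c2_coords (z (chart_inv c x)) $ 4 * c2_coords (z (chart_inv c x)) $ 4"
      by (simp_all add: c2_coords_nth complex_eq_iff sum_squares_gt_zero_iff)
  qed
  then show ?thesis by (simp add: smooth_vec_on_def)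
qed

lemma polar_surj:
  assumes "q \<in> A"
  obtains y where "y $ 1 > 0" "y $ 2 > 0" "q = inv z (gtn_polar y)"
proof
  \<comment> \<open>\<open>gtn_polar\<close> divides the angles by \<open>sqrt 2\<close>, and it
    attaches the third coordinate to the second complex factor and the fourth to the first.\<close>
  let ?y = "(\<chi> i. if i = 1 then cmod (fst (z q)) else if i = 2 then cmod (snd (z q))
      else if i = 3 then sqrt 2 * Arg (snd (z q)) else sqrt 2 * Arg (fst (z q))) :: real^4"
  show "?y $ 1 > 0" "?y $ 2 > 0" using assms by (simp_all add: A_def)
  have "gtn_polar ?y = z q"
    using rcis_cmod_Arg[of "fst (z q)"] rcis_cmod_Arg[of "snd (z q)"]
    by (simp add: gtn_polar_def rcis_def prod_eq_iff)
  then show "q = inv z (gtn_polar ?y)" by (simp add: z_inv)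
qed

text \<open>Translates the prescription at \<open>gtn_polar y\<close> into an arbitrary chart. The
  derivative \<open>D\<close> of the parametrization is injective because it is so when read in the
  standard coordinates of \<open>\<complex>\<^sup>2\<close>, by
  \<open>rotation_kernel\<close>.\<close>

lemma polar_data:
  assumes c: "c \<in> atlas N" and y: "y $ 1 > 0" "y $ 2 > 0" and q: "inv z (gtn_polar y) \<in> fst c"
  defines "x \<equiv> snd c (inv z (gtn_polar y))" and "D \<equiv> jacobian (snd c \<circ> inv z \<circ> gtn_polar) (at y)"
  shows "x \<in> U c" and "F c x = uv_part y"
    and "D *v a = 0 \<Longrightarrow> a = 0"
    and "dirv (D *v a) (\<lambda>x. F c x $ i) x = uv_part a $ i" (is ?P1)
    and "killing_in N 1 c x = D *v axis 3 1" "killing_in N 2 c x = D *v axis 4 1"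
    and "bilin (metric_in N c x) (D *v a) (D *v b) =
        bilin (gtn_sigma M k (uv_part y)) (uv_part a) (uv_part b) + bilin (gtn_G M k (uv_part y)) (theta_part a) (theta_part b)" (is ?P2)
    and "moment_in N i c x = gtn_moment M k i (uv_part y)"
proof -
  note dd = data[OF y, unfolded Let_def]
  show "killing_in N 1 c x = D *v axis 3 1" "killing_in N 2 c x = D *v axis 4 1"
    ?P2
    using dd c q unfolding x_def D_def by blast+
  have ci: "chart_inv c x = inv z (gtn_polar y)" unfolding x_def by (rule chart_inv_apply[OF chart[OF c] q])
  show "moment_in N i c x = gtn_moment M k i (uv_part y)"
    using dd by (simp add: moment_in_def ci)
  have polF: "cmod (fst (gtn_polar y)) = y $ 1" "cmod (snd (gtn_polar y)) = y $ 2" if "y $ 1 > 0" "y $ 2 > 0" for y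
    using that by (simp_all add: gtn_polar_def norm_mult)
  have "inv z (gtn_polar y) \<in> A" using y by (simp add: A_def z_inv gtn_polar_def)
  then show xU: "x \<in> U c" using q by (auto simp: U_def x_def)
  then have xI: "x \<in> chart_image c" using U_sub by blast
  show "F c x = uv_part y"
    using polF[OF y] by (simp add: vec_eq_iff forall_2 F_nth uv_part_nth ci z_inv)
  let ?\<Phi> = "snd c \<circ> inv z \<circ> gtn_polar"
  have \<Phi>y: "?\<Phi> y = x" by (simp add: x_def)
  have pc: "inv z (gtn_polar y') = chart_inv c0 (polar_chart y')" for y' by (simp add: polar_chart_def chart_inv_c0)
  have open0: "open (snd c0 ` fst c)"
    using open_chart_image[OF chart_c0, of "fst c"] chart[OF c] by (simp add: is_chart_def)
  have in0: "polar_chart y' \<in> snd c0 ` fst c \<longleftrightarrow> inv z (gtn_polar y') \<in> fst c" for y'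
  proof
    assume "polar_chart y' \<in> snd c0 ` fst c"
    then show "inv z (gtn_polar y') \<in> fst c" unfolding pc using chart_inv_apply[OF chart_c0] by auto
  next
    assume "inv z (gtn_polar y') \<in> fst c"
    then have "snd c0 (inv z (gtn_polar y')) \<in> snd c0 ` fst c" by (rule imageI)
    then show "polar_chart y' \<in> snd c0 ` fst c" by (simp add: polar_chart_def z_inv)
  qed
  have "(snd c \<circ> chart_inv c0) differentiable at (polar_chart y)"
    using in0 q by (intro smooth_vec_on_imp_differentiable[OF smooth_from_c0[OF c] open0]) blast
  from differentiable_chain_at[OF polar_chart_differentiable this]
  have d\<Phi>: "?\<Phi> differentiable at y" by (simp add: o_def pc)
  \<comment> \<open>An open set of parameters whose image stays in the chart and off the axes, so
    that the local expressions may be differentiated at \<open>y\<close>.\<close>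
  define T where "T = {y'. 0 < y' $ 1} \<inter> {y'. 0 < y' $ 2} \<inter> polar_chart -` (snd c0 ` fst c)"
  have "continuous_on UNIV polar_chart"
    using polar_chart_differentiable by (intro continuous_at_imp_continuous_on ballI differentiable_imp_continuous_within) auto
  then have oT: "open T"
    unfolding T_def by (intro open_Int open_vimage open0 open_Collect_less continuous_intros)
  have yT: "y \<in> T" using y in0 q by (simp add: T_def)
  have zT: "z (chart_inv c (?\<Phi> y')) = gtn_polar y'" if "y' \<in> T" for y'
    using that in0 chart_inv_apply[OF chart[OF c]] by (simp add: T_def z_inv)
  have c4: "dirv (D *v a) (\<lambda>x. c2_coords (z (chart_inv c x)) $ j) x = p' a"
    if "((\<lambda>y. polar_chart y $ j) has_derivative p') (at y)" for j p'
  proof -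
    have "(\<lambda>x. c2_coords (z (chart_inv c x)) $ j) differentiable at (?\<Phi> y)"
      using smooth_vec_on_imp_differentiable[OF smooth_to_c0[OF c] open_image[OF c] xI] unfolding \<Phi>y
      by (rule differentiable_vec_nth)
    from dirv_jacobian_chain[OF this d\<Phi> oT yT _ that] show ?thesis
      unfolding \<Phi>y D_def by (simp add: zT[unfolded comp_apply] polar_chart_def)
  qed
  show "a = 0" if "D *v a = 0"
  proof -
    have 0: "p' a = 0" if "((\<lambda>y. polar_chart y $ j) has_derivative p') (at y)" for j p'
      using c4[OF that] \<open>D *v a = 0\<close> by (simp add: dirv_def)
    have "a $ 1 = 0 \<and> a $ 4 / sqrt 2 = 0"
      by (rule rotation_kernel[OF 0[OF polar_chart_derivative(1)] 0[OF polar_chart_derivative(2)]]) (use y in simp)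
    moreover have "a $ 2 = 0 \<and> a $ 3 / sqrt 2 = 0"
      by (rule rotation_kernel[OF 0[OF polar_chart_derivative(3)] 0[OF polar_chart_derivative(4)]]) (use y in simp)
    ultimately show ?thesis by (simp add: vec_eq_iff forall_4)
  qed
  have "dirv (D *v a) (\<lambda>x. F c x $ i) x = a $ j" if "i = 1 \<and> j = 1 \<or> i = 2 \<and> j = 2" for j
  proof -
    have "(\<lambda>x. F c x $ i) differentiable at (?\<Phi> y)"
      using smooth_vec_on_imp_differentiable[OF smooth_F[OF c] open_U[OF c] xU] unfolding \<Phi>y
      by (rule differentiable_vec_nth)
    from dirv_jacobian_chain[OF this d\<Phi> oT yT _ has_derivative_nth[of j]]
    have "(\<And>y'. y' \<in> T \<Longrightarrow> F c (?\<Phi> y') $ i = y' $ j) \<Longrightarrow> dirv (D *v a) (\<lambda>x. F c x $ i) x = a $ j"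
      unfolding \<Phi>y D_def .
    moreover have "F c (?\<Phi> y') $ i = y' $ j" if "y' \<in> T" for y'
      using \<open>i = 1 \<and> j = 1 \<or> i = 2 \<and> j = 2\<close> zT[OF that] polF[of y'] that by (auto simp: F_nth T_def)
    ultimately show ?thesis by blast
  qed
  from this[of 1] this[of 2] show ?P1
    using exhaust_2[of i] by (auto simp: uv_part_nth)
qed

text \<open>The Killing vectors are images of two coordinate vectors under the injective
  \<open>D\<close>.\<close>

lemma A_regular: "A \<subseteq> regular N"
proof
  fix q assume "q \<in> A"
  then obtain y where y: "y $ 1 > 0" "y $ 2 > 0" "q = inv z (gtn_polar y)" by (rule polar_surj)
  show "q \<in> regular N"
    unfolding regular_def
  proof (intro CollectI ballI impI allI)
    fix c a b assume c: "c \<in> atlas N" "q \<in> fst c"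
      and 0: "a *\<^sub>R killing_in N 1 c (snd c q) + b *\<^sub>R killing_in N 2 c (snd c q) = 0"
    note p = polar_data[OF c(1) y(1,2) c(2)[unfolded y(3)]]
    have "jacobian (snd c \<circ> inv z \<circ> gtn_polar) (at y) *v (a *\<^sub>R axis 3 1 + b *\<^sub>R axis 4 1) = 0"
      using 0 unfolding y(3) p(5,6) by (simp add: matrix_vector_right_distrib matrix_vector_mult_scaleR)
    then have 1: "a *\<^sub>R axis 3 1 + b *\<^sub>R axis 4 1 = (0 :: real^4)" by (rule p(3))
    show "a = 0 \<and> b = 0"
      using arg_cong[OF 1, of "\<lambda>v. v $ 3"] arg_cong[OF 1, of "\<lambda>v. v $ 4"] by (simp add: axis_def)
  qed
qed

lemma gtn_local_chart:
  assumes c: "c \<in> atlas N"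
  shows "gtn_local (U c) (metric_in N c) (cplx_in N c) (\<lambda>i. killing_in N i c) (\<lambda>i. moment_in N i c) (F c) M k"
proof -
  interpret toric_local "U c" "metric_in N c" "cplx_in N c" "\<lambda>i. killing_in N i c" "\<lambda>i. moment_in N i c"
    by (rule toric_local_chart[OF c open_U[OF c]]) (use A_regular in \<open>auto simp: U_def\<close>)
  interpret S: riemannian UNIV "gtn_sigma M k" by (rule riemannian_gtn_sigma[OF M k])
  have pol: "\<exists>y. y $ 1 > 0 \<and> y $ 2 > 0 \<and> inv z (gtn_polar y) \<in> fst c \<and> x = snd c (inv z (gtn_polar y))" if "x \<in> U c" for x
  proof -
    obtain q where "q \<in> fst c" "q \<in> A" "x = snd c q" using \<open>x \<in> U c\<close> by (auto simp: U_def)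
    then show ?thesis using polar_surj[of q] by metis
  qed
  show ?thesis
  proof
    show "smooth_vec_on (U c) (F c)" by (rule smooth_F[OF c])
    fix x assume xU: "x \<in> U c"
    obtain y where y: "y $ 1 > 0" "y $ 2 > 0" "inv z (gtn_polar y) \<in> fst c" and x: "x = snd c (inv z (gtn_polar y))"
      using pol[OF xU] by blast
    define D where "D = jacobian (snd c \<circ> inv z \<circ> gtn_polar) (at y)"
    note p = polar_data[OF c y, folded x D_def]
    show "F c x $ 1 > 0" "F c x $ 2 > 0" using y by (simp_all add: p(2) uv_part_nth)
    show "moment_in N i c x = gtn_moment M k i (F c x)" for i unfolding p(2) by (rule p(8))
    have dk: "dirv (D *v axis 3 1) (\<lambda>y. F c y $ a) x = 0" "dirv (D *v axis 4 1) (\<lambda>y. F c y $ a) x = 0" for a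
      unfolding p(4) using exhaust_2[of a] by (auto simp: uv_part_nth axis_def)
    show "dirv (killing_in N i c x) (\<lambda>y. F c y $ a) x = 0" for i a
      using exhaust_2[of i] dk p(5,6) by metis
    have surj: "\<exists>a. D *v a = w" for w
    proof -
      have "inj ((*v) D)" using p(3) linear_injective_0[OF matrix_vector_mul_linear[of D]] by blast
      then have "surj ((*v) D)" using linear_injective_imp_surjective[OF matrix_vector_mul_linear[of D]] by blast
      then show ?thesis by (metis surjD)
    qed
    define l where "l = 2 / M * (1 + (1 + k) * (y $ 1)\<^sup>2 + (1 - k) * (y $ 2)\<^sup>2)"
    have sig: "gtn_sigma M k (uv_part y) = mat l" by (simp add: gtn_sigma_def uv_part_nth l_def)
    have l: "l \<noteq> 0"
      using S.inn_pos[of "uv_part y" "axis 1 1"] by (auto simp: sig bilin_axis axis_eq_0_iff mat_def)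
    have bl: "bilin (mat l) v w = l * (v $ 1 * w $ 1 + v $ 2 * w $ 2)" for v w :: "real^2"
      by (simp add: bilin_sum_def sum_2 mat_def algebra_simps)
    \<comment> \<open>In polar coordinates the metric is block diagonal with \<open>uv\<close> block
      \<open>l\<close> times the identity, so the gradient of \<open>u\<close> or \<open>v\<close>
      is its coordinate vector divided by \<open>l\<close>.\<close>
    have gradF: "grad (metric_in N c) (\<lambda>y. F c y $ a) x = D *v axis (if a = 1 then 1 else 2) (1 / l)" for a
    proof (rule inn_eqI[OF xU])
      fix w
      obtain b where b: "w = D *v b" using surj by metis
      have t0: "theta_part (axis (if a = 1 then 1 else 2) (1 / l)) = 0"
        by (simp add: vec_eq_iff forall_2 theta_part_nth axis_def)
      show "inn x (grad (metric_in N c) (\<lambda>y. F c y $ a) x) w = inn x (D *v axis (if a = 1 then 1 else 2) (1 / l)) w"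
        unfolding inn_grad[OF xU] b p(4) p(7) sig bl t0 bilin_0
        using l exhaust_2[of a] by (auto simp: uv_part_nth axis_def)
    qed
    have mi: "matrix_inv (mat l :: real^2^2) = mat (1 / l)"
      by (rule matrix_inv_eqI) (use l in \<open>simp add: matrix_matrix_mult_def mat_def vec_eq_iff forall_2 sum_2\<close>)
    show "inn x (grad (metric_in N c) (\<lambda>y. F c y $ a) x) (grad (metric_in N c) (\<lambda>y. F c y $ b) x) = matrix_inv (gtn_sigma M k (F c x)) $ a $ b" for a b
      unfolding inn_grad[OF xU] unfolding gradF p(4) p(2) sig mi
      using exhaust_2[of a] exhaust_2[of b] by (auto simp: uv_part_nth axis_def mat_def)
  qed (use M k in auto)
qed

end

section \<open>Passage from the complement of the axes to all points by continuity\<close>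

context gtn_manifold
begin

text \<open>A real translation of both complex coordinates. For small nonzero \<open>t\<close> it
  leaves both axes, also when the point lies on one or on both of them.\<close>

definition approach :: "'a \<Rightarrow> real \<Rightarrow> 'a" where
  "approach p t = inv z (fst (z p) + of_real t, snd (z p) + of_real t)"

lemma approach_tendsto: "(approach p \<longlongrightarrow> p) (at 0)"
proof -
  let ?w = "\<lambda>t::real. (fst (z p) + of_real t, snd (z p) + of_real t)"
  have "\<forall>i. ((\<lambda>t. c2_coords (?w t) $ i) \<longlongrightarrow> c2_coords (z p) $ i) (at 0)"
    unfolding forall_4 c2_coords_nth by (auto intro!: tendsto_eq_intros)
  then have 1: "((\<lambda>t. c2_coords (?w t)) \<longlongrightarrow> c2_coords (z p)) (at 0)"
    by (intro vec_tendstoI) blast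
  have "c2_coords (z p) \<in> chart_image c0" by (auto simp: chart_image_def)
  from isCont_tendsto_compose[OF isCont_chart_inv[OF chart_c0 this] 1]
  show ?thesis by (simp add: chart_inv_c0 approach_def[abs_def] z_inv)
qed

lemma approach_in_A: "\<forall>\<^sub>F t in at 0. approach p t \<in> A"
proof -
  have "\<forall>\<^sub>F t in at (0::real). t \<noteq> - Re (fst (z p))" "\<forall>\<^sub>F t in at (0::real). t \<noteq> - Re (snd (z p))"
    by (rule eventually_neq_at_within)+
  then show ?thesis
  proof eventually_elim
    case (elim t)
    then have "Re (fst (z p) + of_real t) \<noteq> 0" "Re (snd (z p) + of_real t) \<noteq> 0" by auto
    then have "fst (z p) + of_real t \<noteq> 0" "snd (z p) + of_real t \<noteq> 0" by (metis zero_complex.sel(1))+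
    then show ?case by (simp add: approach_def A_def z_inv)
  qed
qed

context
  fixes c p
  assumes c: "c \<in> atlas N" and p: "p \<in> fst c" and flat: "scalar_flat N"
begin

abbreviation (input) g where "g \<equiv> metric_in N c"
abbreviation (input) J where "J \<equiv> cplx_in N c"
abbreviation (input) \<rho> where "\<rho> \<equiv> ricci_form g J"

lemma x_in: "snd c p \<in> chart_image c"
  using p by (auto simp: chart_image_def)

lemma approach_chart: "((\<lambda>t. snd c (approach p t)) \<longlongrightarrow> snd c p) (at 0)"
  by (rule isCont_tendsto_compose[OF isCont_chart[OF chart[OF c] p] approach_tendsto])

lemma approach_U: "\<forall>\<^sub>F t in at 0. approach p t \<in> fst c \<inter> A \<and> snd c (approach p t) \<in> U c"
proof -
  have "open (fst c)" using chart[OF c] by (simp add: is_chart_def)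
  then have "\<forall>\<^sub>F t in at 0. approach p t \<in> fst c" using topological_tendstoD[OF approach_tendsto] p by blast
  with approach_in_A show ?thesis by eventually_elim (auto simp: U_def)
qed

lemma continuous_limit:
  fixes f :: "real^4 \<Rightarrow> real"
  assumes "continuous_on (chart_image c) f"
  shows "((\<lambda>t. f (snd c (approach p t))) \<longlongrightarrow> f (snd c p)) (at 0)"
proof (rule isCont_tendsto_compose[OF _ approach_chart])
  have "\<forall>x\<in>chart_image c. isCont f x"
    using assms by (simp only: continuous_on_eq_continuous_at[OF open_image[OF c]])
  then show "isCont f (snd c p)" using x_in by (rule bspec)
qed

lemma scalar_zero: "x \<in> chart_image c \<Longrightarrow> scalar_curvature g x = 0"
  using flat c by (simp add: scalar_flat_def)

text \<open>Off the axes this is \<open>gtn_curvature\<close>. Both sides are continuous on the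
  whole chart, since \<open>F c\<close> is, and the path \<open>approach p\<close> carries the
  identity to \<open>p\<close>.\<close>

lemma ricci_form_norm:
  "form_inner (g (snd c p)) (\<rho> (snd c p)) (\<rho> (snd c p)) =
     8 * k\<^sup>2 * M\<^sup>2 / (1 + (1 + k) * (F c (snd c p) $ 1)\<^sup>2 + (1 - k) * (F c (snd c p) $ 2)\<^sup>2) ^ 4"
proof -
  interpret S: kahler_surface "chart_image c" g J by (rule kahler_surface_chart[OF c])
  interpret G: gtn_local "U c" g J "\<lambda>i. killing_in N i c" "\<lambda>i. moment_in N i c" "F c" M k
    by (rule gtn_local_chart[OF c])
  let ?R = "\<lambda>x. 8 * k\<^sup>2 * M\<^sup>2 / (1 + (1 + k) * (F c x $ 1)\<^sup>2 + (1 - k) * (F c x $ 2)\<^sup>2) ^ 4"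
  have nz: "(1 + (1 + k) * a\<^sup>2 + (1 - k) * b\<^sup>2) ^ 4 \<noteq> 0" for a b :: real
  proof -
    have "1 + (1 + k) * a\<^sup>2 + (1 - k) * b\<^sup>2 > 0"
      using k by (intro add_pos_nonneg mult_nonneg_nonneg) auto
    then show ?thesis by simp
  qed
  have 1: "((\<lambda>t. form_inner (g (snd c (approach p t))) (\<rho> (snd c (approach p t))) (\<rho> (snd c (approach p t)))) \<longlongrightarrow>
     form_inner (g (snd c p)) (\<rho> (snd c p)) (\<rho> (snd c p))) (at 0)"
    by (rule continuous_limit[where f = "\<lambda>x. form_inner (g x) (\<rho> x) (\<rho> x)"])
       (rule S.continuous_on_form_inner[OF S.cmat_ricci_form S.cmat_ricci_form])
  have 2: "((\<lambda>t. ?R (snd c (approach p t))) \<longlongrightarrow> ?R (snd c p)) (at 0)"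
    by (rule continuous_limit[where f = ?R])
       (intro continuous_on_divide continuous_on_const continuous_on_power continuous_on_add continuous_on_mult
          continuous_F[OF c] ballI nz)
  have "\<forall>\<^sub>F t in at 0. form_inner (g (snd c (approach p t))) (\<rho> (snd c (approach p t))) (\<rho> (snd c (approach p t)))
      = ?R (snd c (approach p t))"
    using approach_U by eventually_elim (rule G.gtn_curvature(1), use U_sub scalar_zero in blast, use U_sub scalar_zero in blast)
  then have "((\<lambda>t. form_inner (g (snd c (approach p t))) (\<rho> (snd c (approach p t))) (\<rho> (snd c (approach p t)))) \<longlongrightarrow>
     ?R (snd c p)) (at 0)"
    using 2 by (simp only: tendsto_cong)
  from tendsto_unique[OF _ 1 this] show ?thesis by simp
qed

lemma ricci_form_pos: "k \<noteq> 0 \<Longrightarrow> form_inner (g (snd c p)) (\<rho> (snd c p)) (\<rho> (snd c p)) > 0"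
proof -
  assume "k \<noteq> 0"
  then have 1: "8 * k\<^sup>2 * M\<^sup>2 > 0" using M by simp
  have 2: "1 + (1 + k) * a\<^sup>2 + (1 - k) * b\<^sup>2 > 0" for a b :: real
    using k by (intro add_pos_nonneg mult_nonneg_nonneg) auto
  show ?thesis unfolding ricci_form_norm by (rule divide_pos_pos[OF 1 zero_less_power[OF 2]])
qed

text \<open>The limit of the off-axis formula along \<open>approach p\<close>. Division by the norm
  of \<rho> is harmless by \<open>ricci_form_pos\<close>; continuity of \<open>K\<close> at
  \<open>p\<close> is an assumption because \<open>is_quotient_curvature\<close> is silent at points
  that are not regular.\<close>

lemma weyl_minus_formula:
  assumes k0: "k \<noteq> 0" and K: "is_quotient_curvature N K" and cont: "isCont K p"
    and \<zeta>: "\<zeta> \<in> anti_self_dual (g (snd c p)) (J (snd c p))"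
  shows "weyl_minus g J (snd c p) \<zeta> = (- K p) *\<^sub>R
     ((6 / form_inner (g (snd c p)) (\<rho> (snd c p)) (\<rho> (snd c p)) * form_inner (g (snd c p)) (\<rho> (snd c p)) \<zeta>) *\<^sub>R \<rho> (snd c p) - 2 *\<^sub>R \<zeta>)"
proof -
  interpret S: kahler_surface "chart_image c" g J by (rule kahler_surface_chart[OF c])
  interpret G: gtn_local "U c" g J "\<lambda>i. killing_in N i c" "\<lambda>i. moment_in N i c" "F c" M k
    by (rule gtn_local_chart[OF c])
  \<comment> \<open>The form is anti-self-dual for the metric at \<open>snd c p\<close> only.
    Projecting the constant matrix at each point extends it to a continuous anti-self-dual field,
    and idempotence of the projection leaves the value of \<open>weyl_minus\<close>
    unchanged.\<close>
  define \<zeta>' where "\<zeta>' x = asd_part (g x) (J x) \<zeta>" for x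
  define R where "R \<kappa> x = (- \<kappa>) *\<^sub>R ((6 / form_inner (g x) (\<rho> x) (\<rho> x) * form_inner (g x) (\<rho> x) (\<zeta>' x)) *\<^sub>R \<rho> x - 2 *\<^sub>R \<zeta>' x)" for \<kappa> x
  have tf: "two_form \<zeta>" using \<zeta> by (simp add: anti_self_dual_def)
  have parts: "\<zeta>' x \<in> anti_self_dual (g x) (J x)" "asd_part (g x) (J x) (\<zeta>' x) = \<zeta>' x"
    if x: "x \<in> chart_image c" for x
  proof -
    obtain e where e: "kahler_frame (chart_image c) g J x e" by (rule S.unitary_frame_exists[OF x])
    interpret f: kahler_frame "chart_image c" g J x e by (rule e)
    show "\<zeta>' x \<in> anti_self_dual (g x) (J x)" unfolding \<zeta>'_def by (rule f.asd_part_in[OF tf])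
    then show "asd_part (g x) (J x) (\<zeta>' x) = \<zeta>' x" by (rule f.asd_part_id)
  qed
  have \<zeta>'x: "\<zeta>' (snd c p) = \<zeta>"
  proof -
    obtain e where e: "kahler_frame (chart_image c) g J (snd c p) e" by (rule S.unitary_frame_exists[OF x_in])
    interpret f: kahler_frame "chart_image c" g J "snd c p" e by (rule e)
    show ?thesis unfolding \<zeta>'_def by (rule f.asd_part_id[OF \<zeta>])
  qed
  have WR: "weyl_minus g J (snd c q) \<zeta> = R (K q) (snd c q)" if q: "q \<in> fst c \<inter> A" for q
  proof -
    have xU: "snd c q \<in> U c" using q by (auto simp: U_def)
    then have xI: "snd c q \<in> chart_image c" using U_sub by blast
    have "weyl_minus g J (snd c q) \<zeta> = weyl_minus g J (snd c q) (\<zeta>' (snd c q))"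
      unfolding weyl_minus_def parts(2)[OF xI] by (simp only: \<zeta>'_def)
    also have "\<dots> = R (gauss_curvature (gtn_sigma M k) (F c (snd c q))) (snd c q)"
      unfolding R_def by (rule G.gtn_curvature(2)[OF xU scalar_zero[OF xI] k0 parts(1)[OF xI]])
    \<comment> \<open>The curvature of the prescribed metric and the one defining \<open>K q\<close>
      may belong to different local quotients; both equal
      \<open>horizontal_curvature\<close>.\<close>
    also have "gauss_curvature (gtn_sigma M k) (F c (snd c q)) = K q"
      using G.gauss_gram[OF xU] quotient_curvature_eq[OF c _ K, of q] q A_regular
      by (auto simp: horizontal_curvature_def gram_in_def G.gram_def Vc_def)
    finally show ?thesis .
  qed
  have c\<zeta>: "S.cmat \<zeta>'" unfolding \<zeta>'_def by (rule S.cmat_asd[OF S.cmat_basic(1)])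
  note cf = S.continuous_on_form_inner
  have Rn: "R \<kappa> x $ i $ j = (- \<kappa>) * (6 / form_inner (g x) (\<rho> x) (\<rho> x) * form_inner (g x) (\<rho> x) (\<zeta>' x) * \<rho> x $ i $ j - 2 * \<zeta>' x $ i $ j)" for \<kappa> x i j
    by (simp add: R_def)
  have lim: "weyl_minus g J (snd c p) \<zeta> $ i $ j = R (K p) (snd c p) $ i $ j" for i j
  proof (rule tendsto_unique)
    show "((\<lambda>t. weyl_minus g J (snd c (approach p t)) \<zeta> $ i $ j) \<longlongrightarrow> weyl_minus g J (snd c p) \<zeta> $ i $ j) (at 0)"
      by (rule continuous_limit[where f = "\<lambda>x. weyl_minus g J x \<zeta> $ i $ j"])
         (rule S.cmat_weyl_minus[OF S.cmat_basic(1), rule_format])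
    have "((\<lambda>t. R (K (approach p t)) (snd c (approach p t)) $ i $ j) \<longlongrightarrow> R (K p) (snd c p) $ i $ j) (at 0)"
      unfolding Rn using ricci_form_pos[OF k0]
      by (intro tendsto_mult tendsto_minus tendsto_diff tendsto_divide tendsto_const
           isCont_tendsto_compose[OF cont approach_tendsto]
           continuous_limit[where f = "\<lambda>x. form_inner (g x) (\<rho> x) (\<rho> x)", OF cf[OF S.cmat_ricci_form S.cmat_ricci_form]]
           continuous_limit[where f = "\<lambda>x. form_inner (g x) (\<rho> x) (\<zeta>' x)", OF cf[OF S.cmat_ricci_form c\<zeta>]]
           continuous_limit[where f = "\<lambda>x. \<rho> x $ i $ j", OF S.cmat_ricci_form[rule_format]]
           continuous_limit[where f = "\<lambda>x. \<zeta>' x $ i $ j", OF c\<zeta>[rule_format]]) simp_all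
    moreover have "\<forall>\<^sub>F t in at 0. weyl_minus g J (snd c (approach p t)) \<zeta> $ i $ j = R (K (approach p t)) (snd c (approach p t)) $ i $ j"
      using approach_U by eventually_elim (use WR in auto)
    ultimately show "((\<lambda>t. weyl_minus g J (snd c (approach p t)) \<zeta> $ i $ j) \<longlongrightarrow> R (K p) (snd c p) $ i $ j) (at 0)"
      by (simp only: tendsto_cong)
  qed simp
  then have "weyl_minus g J (snd c p) \<zeta> = R (K p) (snd c p)" by (simp add: vec_eq_iff)
  then show ?thesis by (simp only: R_def \<zeta>'x)
qed

end

end

lemma (in toric_manifold) gtn_manifoldE:
  assumes "generalized_taub_nut M k N" "M > 0" "k \<in> {-1..1}"
  obtains z where "gtn_manifold N M k z"
proof -
  obtain z where z: "bij z" "smooth_atlas (insert (UNIV, c2_coords \<circ> z) (atlas N))"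
    "\<forall>y. 0 < y$1 \<and> 0 < y$2 \<longrightarrow>
          (let p = inv z (gtn_polar y) in
            (\<forall>i. moment N i p = gtn_moment M k i (uv_part y)) \<and>
            (\<forall>c\<in>atlas N. p \<in> fst c \<longrightarrow>
              (let D = jacobian (snd c \<circ> inv z \<circ> gtn_polar) (at y) in
                killing_in N 1 c (snd c p) = D *v axis 3 1 \<and>
                killing_in N 2 c (snd c p) = D *v axis 4 1 \<and>
                (\<forall>a b. bilin (metric_in N c (snd c p)) (D *v a) (D *v b) =
                   bilin (gtn_sigma M k (uv_part y)) (uv_part a) (uv_part b) +
                   bilin (gtn_G M k (uv_part y)) (theta_part a) (theta_part b)))))"
    using assms(1) unfolding generalized_taub_nut_def by blast
  have "gtn_manifold N M k z"
    by unfold_locales (use assms(2,3) z(1,2) in simp_all, (use z(3) in blast)?)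
  then show ?thesis by (rule that)
qed

text \<open>W^- and W^+ are tested on their own eigenspaces of the Hodge star, so the operator
  identities become statements about each form \<zeta>. The claims free of \<open>K\<close> follow
  at every point, since only the norm of \<rho> had to be continued to the axes.\<close>

theorem proposition1p1:
  fixes N :: "'a::{t2_space,second_countable_topology} toric_data"
    and K :: "'a \<Rightarrow> real"
  assumes toric: "toric_kahler N"
    and flat: "scalar_flat N"
    and K: "is_quotient_curvature N K"
  shows "(\<forall>c\<in>atlas N. \<forall>p\<in>fst c \<inter> regular N.
            let x = snd c p; g = metric_in N c; J = cplx_in N c; \<omega> = omega_minus N c x in
              \<omega> \<in> anti_self_dual (g x) (J x) \<and>
              \<omega> \<noteq> 0 \<and>
              weyl_minus g J x \<omega> = (2 * K p) *\<^sub>R \<omega>)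
       \<and> (\<forall>M k. M > 0 \<and> k \<in> {-1..1} \<and> k \<noteq> 0 \<and> generalized_taub_nut M k N \<longrightarrow>
          (\<forall>c\<in>atlas N. \<forall>p\<in>fst c.
            let x = snd c p; g = metric_in N c; J = cplx_in N c; \<rho> = ricci_form g J x in
              \<rho> \<noteq> 0 \<and>
              \<rho> \<in> anti_self_dual (g x) (J x) \<and>
              (\<forall>\<zeta>\<in>self_dual (g x) (J x). weyl_plus g J x \<zeta> = 0) \<and>
              (p \<in> regular N \<or> continuous_on UNIV K \<longrightarrow>
                weyl_minus g J x \<rho> = (- 4 * K p) *\<^sub>R \<rho> \<and>
                (\<forall>\<zeta>\<in>anti_self_dual (g x) (J x). weyl_minus g J x \<zeta> =
                   (- K p) *\<^sub>R ((6 / (form_norm (g x) \<rho>)\<^sup>2 * form_inner (g x) \<rho> \<zeta>) *\<^sub>R \<rho>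
                               - 2 *\<^sub>R \<zeta>)))))"
proof (intro conjI ballI allI impI)
  interpret T: toric_manifold N by unfold_locales (rule toric)
  show "let x = snd c p; g = metric_in N c; J = cplx_in N c; \<omega> = omega_minus N c x in
              \<omega> \<in> anti_self_dual (g x) (J x) \<and>
              \<omega> \<noteq> 0 \<and>
              weyl_minus g J x \<omega> = (2 * K p) *\<^sub>R \<omega>"
    if "c \<in> atlas N" "p \<in> fst c \<inter> regular N" for c p
    unfolding Let_def using T.quotient_eigenform[OF that K flat] by blast
  fix M k c p
  assume h: "M > 0 \<and> k \<in> {-1..1} \<and> k \<noteq> 0 \<and> generalized_taub_nut M k N" and c: "c \<in> atlas N" and p: "p \<in> fst c"
  then obtain z where "gtn_manifold N M k z" using T.gtn_manifoldE by blast
  then interpret G: gtn_manifold N M k z .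
  interpret S: kahler_surface "chart_image c" "metric_in N c" "cplx_in N c" by (rule T.kahler_surface_chart[OF c])
  note x = G.x_in[OF c p flat]
  obtain e where e: "kahler_frame (chart_image c) (metric_in N c) (cplx_in N c) (snd c p) e"
    by (rule S.unitary_frame_exists[OF x])
  interpret f: kahler_frame "chart_image c" "metric_in N c" "cplx_in N c" "snd c p" e by (rule e)
  note s = G.scalar_zero[OF c p flat x]
  let ?\<rho> = "ricci_form (metric_in N c) (cplx_in N c) (snd c p)" and ?g = "metric_in N c (snd c p)"
  have pos: "form_inner ?g ?\<rho> ?\<rho> > 0" using G.ricci_form_pos[OF c p flat] h by blast
  then have norm: "(form_norm ?g ?\<rho>)\<^sup>2 = form_inner ?g ?\<rho> ?\<rho>" by (simp add: form_norm_def)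
  have asd: "?\<rho> \<in> anti_self_dual ?g (cplx_in N c (snd c p))" by (rule f.ricci_form_asd[OF s])
  have ne: "?\<rho> \<noteq> 0" using pos by (auto simp: form_inner_def)
  have w: "weyl_minus (metric_in N c) (cplx_in N c) (snd c p) \<zeta> = (- K p) *\<^sub>R
     ((6 / (form_norm ?g ?\<rho>)\<^sup>2 * form_inner ?g ?\<rho> \<zeta>) *\<^sub>R ?\<rho> - 2 *\<^sub>R \<zeta>)"
    if "p \<in> regular N \<or> continuous_on UNIV K" "\<zeta> \<in> anti_self_dual ?g (cplx_in N c (snd c p))" for \<zeta>
  proof -
    have "isCont K p"
      using that(1) T.isCont_quotient_curvature[OF _ K] by (auto simp: continuous_on_eq_continuous_at)
    then show ?thesis unfolding norm using G.weyl_minus_formula[OF c p flat _ K _ that(2)] h by blast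
  qed
  show "let x = snd c p; g = metric_in N c; J = cplx_in N c; \<rho> = ricci_form g J x in
              \<rho> \<noteq> 0 \<and>
              \<rho> \<in> anti_self_dual (g x) (J x) \<and>
              (\<forall>\<zeta>\<in>self_dual (g x) (J x). weyl_plus g J x \<zeta> = 0) \<and>
              (p \<in> regular N \<or> continuous_on UNIV K \<longrightarrow>
                weyl_minus g J x \<rho> = (- 4 * K p) *\<^sub>R \<rho> \<and>
                (\<forall>\<zeta>\<in>anti_self_dual (g x) (J x). weyl_minus g J x \<zeta> =
                   (- K p) *\<^sub>R ((6 / (form_norm (g x) \<rho>)\<^sup>2 * form_inner (g x) \<rho> \<zeta>) *\<^sub>R \<rho>
                               - 2 *\<^sub>R \<zeta>)))"
    unfolding Let_def
  proof (intro conjI impI ballI ne asd)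
    show "weyl_plus (metric_in N c) (cplx_in N c) (snd c p) \<zeta> = 0"
      if "\<zeta> \<in> self_dual ?g (cplx_in N c (snd c p))" for \<zeta>
      by (rule f.weyl_plus_eq_0[OF s that])
    assume r: "p \<in> regular N \<or> continuous_on UNIV K"
    show "weyl_minus (metric_in N c) (cplx_in N c) (snd c p) \<zeta> = (- K p) *\<^sub>R
     ((6 / (form_norm ?g ?\<rho>)\<^sup>2 * form_inner ?g ?\<rho> \<zeta>) *\<^sub>R ?\<rho> - 2 *\<^sub>R \<zeta>)"
      if "\<zeta> \<in> anti_self_dual ?g (cplx_in N c (snd c p))" for \<zeta>
      by (rule w[OF r that])
    \<comment> \<open>Applied to \<rho> itself the quotient of inner products is 1, and
      \<open>6 - 2 = 4\<close>.\<close>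
    show "weyl_minus (metric_in N c) (cplx_in N c) (snd c p) ?\<rho> = (- 4 * K p) *\<^sub>R ?\<rho>"
      unfolding w[OF r asd] norm using pos by (simp flip: scaleR_left_diff_distrib)
  qed
qed

end
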